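(* Let $(M,\mathbf D)$ be an oriented $(2,3,5)$ distribution. If $\sigma\in\Gamma(\mathcal E[1])$ is a nonzero solution of the first BGG equation $\Theta_0(\sigma)=0$, with corresponding parallel standard tractor $t\in\Gamma(\mathcal V)$ (that is, $\nabla^{\mathcal V}t=0$ and $\Pi_0(t)=\sigma$), then the holonomy $\mathrm{Hol}(\nabla^{\mathcal V})$ of the normal tractor connection admits a reduction to $\mathrm{SU}(1,2)$, $\mathrm{SL}(2,\mathbb R)\ltimes P_+$, or $\mathrm{SL}(3,\mathbb R)$ when $t$ is, respectively, spacelike, isotropic, or timelike. Here $\mathrm{SL}(2,\mathbb R)\ltimes P_+<P$ is the subgroup of $\mathrm G_2$ preserving an isotropic vector in the standard representation $\mathbb V$.
   Context: All objects are smooth and $M$ is connected. A $(2,3,5)$ distribution on a $5$-manifold $M$ is a rank-$2$ subbundle $\mathbf D\subset TM$ such that $[\mathbf D,\mathbf D]$ has rank $3$ and $[\mathbf D,[\mathbf D,\mathbf D]]=TM$; it is oriented if the bundle $\mathbf D\to M$ is oriented. The Lie bracket modulo $\mathbf D$ induces an isomorphism $\bigwedge^2\mathbf D\cong[\mathbf D,\mathbf D]/\mathbf D$. Put $\mathcal E[1]:=[\mathbf D,\mathbf D]/\mathbf D\cong\bigwedge^2\mathbf D$, $\mathcal E[w]:=\mathcal E[1]^{\otimes w}$, $B[w]:=B\otimes\mathcal E[w]$. Cartan geometry. $\mathrm G_2$ is the automorphism group of the split octonions, $\mathbb V$ its $7$-dimensional irreducible representation, carrying an invariant inner product of signature $(3,4)$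 (three positive, four negative directions), $P<\mathrm G_2$ the (parabolic) stabiliser of an isotropic ray in $\mathbb V$, $\mathfrak p_+$ the nilradical of the Lie algebra $\mathfrak p$ of $P$ and $P_+=\exp\mathfrak p_+$. Oriented $(2,3,5)$ distributions are equivalent (as a category) to regular, normal parabolic geometries $(\mathcal G\to M,\omega)$ of type $(\mathrm G_2,P)$. $\mathbb V$ has the $P$-invariant filtration $\mathbb V=\mathbb V^{-2}\supset\mathbb V^{-1}\supset\mathbb V^0\supset\mathbb V^1\supset\mathbb V^2$, $\mathbb V^{i+1}=\mathfrak p_+\cdot\mathbb V^i$, with successive quotients of dimensions $1,2,1,2,1$. The (standard) tractor bundle is $\mathcal V:=\mathcal G\times_P\mathbb V$, filtered by $\mathcal V^i:=\mathcal G\times_P\mathbb V^i$, with the linear connection $\nabla^{\mathcal V}$ (normal tractor connection) induced by $\omega$ and the parallel bundle metric of signature $(3,4)$ induced by the inner product on $\mathbb V$; the holonomy of $\nabla^{\mathcal V}$ is regarded as a subgroup of $\mathrm G_2$, defined up to conjugacy. A parallel tractor is spacelike, isotropic or timelike if its square norm is positive, zero or negative. Naturally $\mathcal V/\mathcal V^{-1}\cong\mathcal E[1]$, giving $\Pi_0:\mathcal V\to\mathcal E[1]$; and $\mathcal V^{-1}/\mathcal V^0\cong\mathbf D^*[1]$, normalised so that the class of $t\in\Gamma(\mathcal V^{-1})$ corresponds to $\tau\in\Gamma(\mathbf D^*[1])$ with $\Pi_0(\nabla^{\mathcal V}_\xi t)=-\tau(\xi)$ for $\xi\in\Gamma(\mathbf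 D)$. BGG operator. Using $T^*M\cong\mathcal G\times_P\mathfrak p_+$ and writing $\bullet$ for the induced action on $\mathcal V$, the Kostant codifferentials are $\partial^*:T^*M\otimes\mathcal V\to\mathcal V$, $\phi\otimes t\mapsto-\phi\bullet t$, and $\partial^*:\bigwedge^2T^*M\otimes\mathcal V\to T^*M\otimes\mathcal V$ (the bundle map induced by the Lie algebra homology differential of $\mathfrak p_+$ with coefficients in $\mathbb V$). The splitting operator $L_0:\Gamma(\mathcal E[1])\to\Gamma(\mathcal V)$ is the differential operator characterised by $\Pi_0\circ L_0=\mathrm{id}$ and $\partial^*\circ\nabla^{\mathcal V}\circ L_0=0$. Let $\Pi_1$ be the projection from $\ker\partial^*\subset T^*M\otimes\mathcal V$ onto $\ker\partial^*/\operatorname{im}\partial^*\cong\bigodot^2\mathbf D^*[1]$; explicitly $\Pi_1(\psi)$ is obtained by restricting $\psi$ to $\mathbf D$ (where it takes values in $\mathcal V^{-1}$), projecting to $\mathcal V^{-1}/\mathcal V^0\cong\mathbf D^*[1]$, and symmetrising. The first BGG operator is $\Theta_0:=\Pi_1\circ\nabla^{\mathcal V}\circ L_0:\Gamma(\mathcal E[1])\to\Gamma(\bigodot^2\mathbf D^*[1])$. Every solution of $\Theta_0(\sigma)=0$ is of the form $\sigma=\Pi_0(t)$ for a $\nabla^{\mathcal V}$-parallel section $t\in\Gamma(\mathcal V)$, namely $t=L_0(\sigma)$. *)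

theory Defs
  imports
    "HOL-Analysis.Analysis"
    "HOL-Algebra.Group_Action"
    "HOL-Library.Function_Algebras"
begin

section \<open>Smooth manifolds\<close>

text \<open>Used only for finite-dimensional spaces and open \<open>S\<close>, where \<open>Ck_on k S f\<close> says that all
  iterated directional derivatives of order at most \<open>k\<close> exist and are continuous.\<close>

primrec Ck_on :: "nat \<Rightarrow> 'a::real_normed_vector set \<Rightarrow> ('a \<Rightarrow> 'b::real_normed_vector) \<Rightarrow> bool" where
  "Ck_on 0 S f \<longleftrightarrow> continuous_on S f"
| "Ck_on (Suc k) S f \<longleftrightarrow>
     f differentiable_on S \<and> (\<forall>v. Ck_on k S (\<lambda>x. frechet_derivative f (at x) v))"

definition smooth_on :: "'a::real_normed_vector set \<Rightarrow> ('a \<Rightarrow> 'b::real_normed_vector) \<Rightarrow> bool" where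
  "smooth_on S f \<longleftrightarrow> (\<forall>k. Ck_on k S f)"

text \<open>A manifold is a whole Hausdorff, second countable type together with an atlas (not required to
  be maximal); a chart is a pair of its domain and its coordinate map. \<open>inv_into U \<phi>\<close> is the
  inverse of the chart \<open>(U, \<phi>)\<close>.\<close>

type_synonym ('m, 'e) atlas = "('m set \<times> ('m \<Rightarrow> 'e)) set"

definition smooth_atlas :: "('m::topological_space, 'e::euclidean_space) atlas \<Rightarrow> bool" where
  "smooth_atlas A \<longleftrightarrow>
     (\<forall>(U, \<phi>)\<in>A. open U \<and> open (\<phi> ` U) \<and> homeomorphism U (\<phi> ` U) \<phi> (inv_into U \<phi>)) \<and>
     (\<Union>(U, \<phi>)\<in>A. U) = UNIV \<and>
     (\<forall>(U, \<phi>)\<in>A. \<forall>(V, \<psi>)\<in>A. smooth_on (\<phi> ` (U \<inter> V)) (\<psi> \<circ> inv_into U \<phi>))"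

text \<open>In the next two definitions the set \<open>W\<close> is open.\<close>

definition smooth_fun_on ::
  "('m, 'e::euclidean_space) atlas \<Rightarrow> 'm set \<Rightarrow> ('m \<Rightarrow> 'v::real_normed_vector) \<Rightarrow> bool" where
  "smooth_fun_on A W f \<longleftrightarrow> (\<forall>(U, \<phi>)\<in>A. smooth_on (\<phi> ` (U \<inter> W)) (f \<circ> inv_into U \<phi>))"

definition smooth_map_on ::
  "('m::topological_space, 'e::euclidean_space) atlas \<Rightarrow>
   ('n::topological_space, 'f::euclidean_space) atlas \<Rightarrow> 'm set \<Rightarrow> ('m \<Rightarrow> 'n) \<Rightarrow> bool" where
  "smooth_map_on A B W F \<longleftrightarrow> continuous_on W F \<and>
     (\<forall>(U, \<phi>)\<in>A. \<forall>(V, \<psi>)\<in>B. smooth_on (\<phi> ` (U \<inter> W \<inter> F -` V)) (\<psi> \<circ> F \<circ> inv_into U \<phi>))"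

definition real_line :: "(real, real) atlas" where
  "real_line = {(UNIV, \<lambda>x. x)}"

definition Cinf :: "('m, 'e::euclidean_space) atlas \<Rightarrow> ('m \<Rightarrow> real) set" where
  "Cinf A = {f. smooth_fun_on A UNIV f}"

text \<open>The pointwise vector space structure on functions, so that \<open>span\<close>, \<open>dim\<close> and
  \<open>independent\<close> apply to tangent vectors.\<close>

instantiation "fun" :: (type, real_vector) real_vector
begin

definition scaleR_fun :: "real \<Rightarrow> ('a \<Rightarrow> 'b) \<Rightarrow> 'a \<Rightarrow> 'b" where
  "scaleR_fun r f = (\<lambda>x. r *\<^sub>R f x)"

instance
  by standard (simp_all add: scaleR_fun_def fun_eq_iff scaleR_add_right scaleR_add_left)

end

text \<open>Tangent vectors at \<open>p\<close> are the derivations at \<open>p\<close> of the algebra of smooth functions; they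
  are given the value \<open>0\<close> on non-smooth functions, so that equality of tangent vectors is equality of
  functionals.\<close>

type_synonym 'm tvec = "('m \<Rightarrow> real) \<Rightarrow> real"

definition tangent :: "('m, 'e::euclidean_space) atlas \<Rightarrow> 'm \<Rightarrow> 'm tvec set" where
  "tangent A p = {v.
     (\<forall>f. f \<notin> Cinf A \<longrightarrow> v f = 0) \<and>
     (\<forall>f\<in>Cinf A. \<forall>g\<in>Cinf A. \<forall>a b. v (\<lambda>x. a * f x + b * g x) = a * v f + b * v g) \<and>
     (\<forall>f\<in>Cinf A. \<forall>g\<in>Cinf A. v (\<lambda>x. f x * g x) = f p * v g + g p * v f)}"

definition pushforward :: "('n, 'f::euclidean_space) atlas \<Rightarrow> ('m \<Rightarrow> 'n) \<Rightarrow> 'm tvec \<Rightarrow> 'n tvec" where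
  "pushforward B F v = (\<lambda>f. if f \<in> Cinf B then v (f \<circ> F) else 0)"

definition velocity :: "('m, 'e::euclidean_space) atlas \<Rightarrow> (real \<Rightarrow> 'm) \<Rightarrow> real \<Rightarrow> 'm tvec" where
  "velocity A c t = (\<lambda>f. if f \<in> Cinf A then deriv (f \<circ> c) t else 0)"

definition vec_deriv :: "'m tvec \<Rightarrow> ('m \<Rightarrow> 'v::euclidean_space) \<Rightarrow> 'v" where
  "vec_deriv v s = (\<Sum>b\<in>Basis. v (\<lambda>x. s x \<bullet> b) *\<^sub>R b)"

definition vfields :: "('m, 'e::euclidean_space) atlas \<Rightarrow> ('m \<Rightarrow> 'm tvec) set" where
  "vfields A = {X. (\<forall>p. X p \<in> tangent A p) \<and> (\<forall>f\<in>Cinf A. (\<lambda>p. X p f) \<in> Cinf A)}"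

definition vf_bracket :: "('m \<Rightarrow> 'm tvec) \<Rightarrow> ('m \<Rightarrow> 'm tvec) \<Rightarrow> 'm \<Rightarrow> 'm tvec" where
  "vf_bracket X Y p = (\<lambda>f. X p (\<lambda>q. Y q f) - Y p (\<lambda>q. X q f))"

definition piecewise_smooth_curve ::
  "('m::topological_space, 'e::euclidean_space) atlas \<Rightarrow> (real \<Rightarrow> 'm) \<Rightarrow> bool" where
  "piecewise_smooth_curve A c \<longleftrightarrow> continuous_on {0..1} c \<and>
     (\<exists>n \<tau>. \<tau> 0 = 0 \<and> \<tau> n = 1 \<and>
        (\<forall>i<n. \<tau> i < \<tau> (Suc i) \<and>
           (\<exists>\<epsilon>>0. \<exists>c'. smooth_map_on real_line A {\<tau> i - \<epsilon><..<\<tau> (Suc i) + \<epsilon>} c' \<and>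
              (\<forall>t\<in>{\<tau> i..\<tau> (Suc i)}. c t = c' t))))"


section \<open>Oriented (2,3,5) distributions\<close>

definition dist_sections ::
  "('m, 'e::euclidean_space) atlas \<Rightarrow> ('m \<Rightarrow> 'm tvec set) \<Rightarrow> ('m \<Rightarrow> 'm tvec) set" where
  "dist_sections A D = {X \<in> vfields A. \<forall>p. X p \<in> D p}"

text \<open>The values of \<open>[D, E]\<close>. As \<open>[X, f Y] = f [X, Y] + (X f) Y\<close>, the span of the brackets contains
  \<open>E\<close> wherever \<open>D\<close> is nonzero.\<close>

definition dist_bracket ::
  "('m, 'e::euclidean_space) atlas \<Rightarrow> ('m \<Rightarrow> 'm tvec set) \<Rightarrow> ('m \<Rightarrow> 'm tvec set) \<Rightarrow> 'm \<Rightarrow> 'm tvec set"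
  where "dist_bracket A D E p =
    span {vf_bracket X Y p | X Y. X \<in> dist_sections A D \<and> Y \<in> dist_sections A E}"

definition oriented_frames :: "'v::real_vector \<Rightarrow> 'v \<Rightarrow> ('v \<times> 'v) set" where
  "oriented_frames v w =
     {(a *\<^sub>R v + b *\<^sub>R w, c *\<^sub>R v + d *\<^sub>R w) | a b c d. a * d - b * c > 0}"

text \<open>A rank-2 subbundle \<open>D\<close> with an orientation, the latter given by the set \<open>Or p\<close> of positively
  oriented bases of each fibre.\<close>

definition oriented_plane_field ::
  "('m::topological_space, 'e::euclidean_space) atlas \<Rightarrow> ('m \<Rightarrow> 'm tvec set) \<Rightarrow>
   ('m \<Rightarrow> ('m tvec \<times> 'm tvec) set) \<Rightarrow> bool" where
  "oriented_plane_field A D Or \<longleftrightarrow>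
     (\<forall>p. \<exists>U X Y. open U \<and> p \<in> U \<and> X \<in> vfields A \<and> Y \<in> vfields A \<and>
        (\<forall>q\<in>U. X q \<noteq> Y q \<and> independent {X q, Y q} \<and> D q = span {X q, Y q} \<and>
           Or q = oriented_frames (X q) (Y q)))"

definition oriented_235_distribution ::
  "('m::topological_space, real^5) atlas \<Rightarrow> ('m \<Rightarrow> 'm tvec set) \<Rightarrow>
   ('m \<Rightarrow> ('m tvec \<times> 'm tvec) set) \<Rightarrow> bool" where
  "oriented_235_distribution A D Or \<longleftrightarrow>
     oriented_plane_field A D Or \<and>
     (\<forall>p. dim (dist_bracket A D D p) = 3) \<and>
     (\<forall>p. dist_bracket A D (dist_bracket A D D) p = tangent A p)"

text \<open>Sections of \<open>[D, D] / D\<close>; elements of a fibre of the quotient bundle are cosets.\<close>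

definition E1_sections ::
  "('m::topological_space, 'e::euclidean_space) atlas \<Rightarrow> ('m \<Rightarrow> 'm tvec set) \<Rightarrow> ('m \<Rightarrow> 'm tvec set) set"
  where "E1_sections A D =
    {\<sigma>. \<forall>p. \<exists>U. open U \<and> p \<in> U \<and>
       (\<exists>Z\<in>dist_sections A (dist_bracket A D D). \<forall>q\<in>U. \<sigma> q = {Z q + v | v. v \<in> D q})}"


section \<open>Split octonions, the group of their automorphisms and its Lie algebra\<close>

text \<open>Zorn's vector matrices: \<open>(a, u, v, b)\<close> stands for the 2 by 2 array with diagonal
  \<open>a, b\<close> and off-diagonal entries \<open>u, v\<close>. The norm \<open>a b - u \<bullet> v\<close> is multiplicative.\<close>

type_synonym oct = "real \<times> (real^3) \<times> (real^3) \<times> real"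
type_synonym octop = "oct \<Rightarrow>\<^sub>L oct"

fun omult :: "oct \<Rightarrow> oct \<Rightarrow> oct" where
  "omult (a, u, v, b) (a', u', v', b') =
     (a * a' + u \<bullet> v',
      a *\<^sub>R u' + b' *\<^sub>R u - cross3 v v',
      a' *\<^sub>R v + b *\<^sub>R v' + cross3 u u',
      v \<bullet> u' + b * b')"

text \<open>The polarised norm; on the imaginary split octonions it has signature (3,4).\<close>

fun oinner :: "oct \<Rightarrow> oct \<Rightarrow> real" where
  "oinner (a, u, v, b) (a', u', v', b') = (a * b' + a' * b - u \<bullet> v' - u' \<bullet> v) / 2"

definition imag_oct :: "oct set" where
  "imag_oct = {(a, u, v, b) | a u v b. a + b = 0}"

definition G2 :: "octop monoid" where
  "G2 = \<lparr>carrier = {g. bij (blinfun_apply g) \<and> (\<forall>x y. g (omult x y) = omult (g x) (g y))},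
         mult = (o\<^sub>L), one = id_blinfun\<rparr>"

definition op_exp :: "octop \<Rightarrow> octop" where
  "op_exp A = (\<Sum>n. (1 / fact n) *\<^sub>R ((\<lambda>B. A o\<^sub>L B) ^^ n) id_blinfun)"

definition comm :: "octop \<Rightarrow> octop \<Rightarrow> octop" where
  "comm A B = (A o\<^sub>L B) - (B o\<^sub>L A)"

definition lie_algebra :: "octop set \<Rightarrow> octop set" where
  "lie_algebra H = {A. \<forall>t::real. op_exp (t *\<^sub>R A) \<in> H}"

abbreviation g2 :: "octop set" where
  "g2 \<equiv> lie_algebra (carrier G2)"

text \<open>The trace of a linear endomorphism \<open>f\<close> of a finite-dimensional subspace \<open>S\<close>.\<close>

definition trace_on :: "'v::real_vector set \<Rightarrow> ('v \<Rightarrow> 'v) \<Rightarrow> real" where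
  "trace_on S f =
     (let B = (SOME B. B \<subseteq> S \<and> independent B \<and> span B = S)
      in \<Sum>b\<in>B. representation B (f b) b)"

definition killing :: "octop \<Rightarrow> octop \<Rightarrow> real" where
  "killing A B = trace_on g2 (\<lambda>X. comm A (comm B X))"

primrec lower_central :: "octop set \<Rightarrow> nat \<Rightarrow> octop set" where
  "lower_central I 0 = I"
| "lower_central I (Suc n) = span {comm X Y | X Y. X \<in> I \<and> Y \<in> lower_central I n}"

definition nilpotent_ideal :: "octop set \<Rightarrow> octop set \<Rightarrow> bool" where
  "nilpotent_ideal q I \<longleftrightarrow> subspace I \<and> I \<subseteq> q \<and> (\<forall>X\<in>q. \<forall>Y\<in>I. comm X Y \<in> I) \<and>
     (\<exists>n. lower_central I n = {0})"

text \<open>The largest nilpotent ideal, as the sum of all of them.\<close>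

definition nilradical :: "octop set \<Rightarrow> octop set" where
  "nilradical q = span (\<Union> {I. nilpotent_ideal q I})"


section \<open>The parabolic subgroup\<close>

text \<open>Everything depends on a nonzero isotropic vector \<open>l\<close> spanning the ray stabilised by \<open>P\<close>.\<close>

definition isotropic_vector :: "oct \<Rightarrow> bool" where
  "isotropic_vector l \<longleftrightarrow> l \<in> imag_oct \<and> l \<noteq> 0 \<and> oinner l l = 0"

definition Par :: "oct \<Rightarrow> octop set" where
  "Par l = {g \<in> carrier G2. \<exists>r>0. g l = r *\<^sub>R l}"

abbreviation par :: "oct \<Rightarrow> octop set" where
  "par l \<equiv> lie_algebra (Par l)"

definition par_plus :: "oct \<Rightarrow> octop set" where
  "par_plus l = nilradical (par l)"

definition Par_plus :: "oct \<Rightarrow> octop set" where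
  "Par_plus l = op_exp ` par_plus l"

text \<open>\<open>vfil l i\<close> for \<open>i \<ge> -2\<close> and \<open>gfil l i\<close> for \<open>i \<ge> -3\<close> are the filtrations of the standard
  representation and of the Lie algebra, the latter of dimensions 14, 12, 11, 9, 5, 3, 2 for
  \<open>i = -3, \<dots>, 3\<close>; below these ranges they are constant.\<close>

definition vfil :: "oct \<Rightarrow> int \<Rightarrow> oct set" where
  "vfil l i = ((\<lambda>W. span {blinfun_apply Z w | Z w. Z \<in> par_plus l \<and> w \<in> W}) ^^ nat (i + 2)) imag_oct"

definition gfil :: "oct \<Rightarrow> int \<Rightarrow> octop set" where
  "gfil l i = ((\<lambda>W. span {comm Z X | Z X. Z \<in> par_plus l \<and> X \<in> W}) ^^ nat (i + 3)) g2"

text \<open>Bases of \<open>g2 / par l\<close> and \<open>par_plus l\<close> dual for the Killing form, which identifies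
  \<open>par_plus l\<close> with the dual of \<open>g2 / par l\<close>.\<close>

definition dual_bases :: "oct \<Rightarrow> (nat \<Rightarrow> octop) \<times> (nat \<Rightarrow> octop) \<Rightarrow> bool" where
  "dual_bases l = (\<lambda>(X, Z).
     (\<forall>i<5. X i \<in> g2 \<and> Z i \<in> par_plus l) \<and> span (Z ` {..<5}) = par_plus l \<and>
     (\<forall>i<5. \<forall>j<5. killing (Z i) (X j) = (if i = j then 1 else 0)))"

text \<open>Kostant codifferentials. Cochains are functions on \<open>g2\<close> vanishing when an argument is in
  \<open>par l\<close>. With \<open>Z \<otimes> w\<close> viewed as \<open>X \<mapsto> killing Z X w\<close>, \<open>codiff1\<close> is
  \<open>Z \<otimes> w \<mapsto> - Z w\<close> and \<open>codiff2\<close> is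
  \<open>(Y \<and> Z) \<otimes> A \<mapsto> - Z \<otimes> [Y, A] + Y \<otimes> [Z, A] - [Y, Z] \<otimes> A\<close>, both independent of
  the dual bases. Coefficients are the standard representation for \<open>codiff1\<close> and the adjoint
  representation for \<open>codiff2\<close>.\<close>

definition codiff1 :: "oct \<Rightarrow> (octop \<Rightarrow> oct) \<Rightarrow> oct" where
  "codiff1 l \<psi> = (let (X, Z) = (SOME b. dual_bases l b) in - (\<Sum>i<5. Z i (\<psi> (X i))))"

definition codiff2 :: "oct \<Rightarrow> (octop \<Rightarrow> octop \<Rightarrow> octop) \<Rightarrow> octop \<Rightarrow> octop" where
  "codiff2 l \<kappa> A = (let (X, Z) = (SOME b. dual_bases l b) in
     (\<Sum>i<5. comm (Z i) (\<kappa> A (X i))) - (1/2) *\<^sub>R (\<Sum>i<5. \<kappa> (comm (Z i) A) (X i)))"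


section \<open>Regular normal parabolic geometries\<close>

record ('m, 'g) cartan_geometry =
  base :: "('m, real^5) atlas"
  total :: "('g, real^14) atlas"
  act :: "'g \<Rightarrow> octop \<Rightarrow> 'g"
  proj :: "'g \<Rightarrow> 'm"
  form :: "'g \<Rightarrow> 'g tvec \<Rightarrow> octop"

text \<open>Joint smoothness of the right action: as \<open>P\<close> is a closed subgroup, hence an embedded
  submanifold, of the general linear group, smooth functions on a product with \<open>P\<close> are the local
  restrictions of smooth functions on the product with the ambient vector space of operators.\<close>

definition smooth_action :: "oct \<Rightarrow> ('m, 'g::topological_space) cartan_geometry \<Rightarrow> bool" where
  "smooth_action l C \<longleftrightarrow>
     (\<forall>u. act C u id_blinfun = u) \<and>
     (\<forall>u. \<forall>p\<in>Par l. \<forall>q\<in>Par l. act C (act C u p) q = act C u (p o\<^sub>L q)) \<and>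
     (\<forall>u. \<forall>p\<in>Par l. \<forall>(U, \<phi>)\<in>total C. \<forall>(V, \<psi>)\<in>total C. u \<in> U \<and> act C u p \<in> V \<longrightarrow>
        (\<exists>S F. open S \<and> (\<phi> u, p) \<in> S \<and> smooth_on S F \<and>
           (\<forall>u'\<in>U. \<forall>p'\<in>Par l. (\<phi> u', p') \<in> S \<longrightarrow>
              act C u' p' \<in> V \<and> \<psi> (act C u' p') = F (\<phi> u', p'))))"

text \<open>Local triviality is expressed by a local section \<open>s\<close> and the fibre component \<open>\<Phi>\<close> of the
  trivialisation \<open>(x, p) \<mapsto> s x p\<close>.\<close>

definition principal_bundle ::
  "oct \<Rightarrow> ('m::topological_space, 'g::topological_space) cartan_geometry \<Rightarrow> bool" where
  "principal_bundle l C \<longleftrightarrow>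
     smooth_atlas (base C) \<and> smooth_atlas (total C) \<and> smooth_action l C \<and>
     smooth_map_on (total C) (base C) UNIV (proj C) \<and>
     (\<forall>u. \<forall>p\<in>Par l. proj C (act C u p) = proj C u) \<and>
     (\<forall>x. \<exists>U s \<Phi>. open U \<and> x \<in> U \<and>
        smooth_map_on (base C) (total C) U s \<and> (\<forall>y\<in>U. proj C (s y) = y) \<and>
        smooth_fun_on (total C) (proj C -` U) \<Phi> \<and>
        (\<forall>u\<in>proj C -` U. \<Phi> u \<in> Par l \<and> u = act C (s (proj C u)) (\<Phi> u)) \<and>
        (\<forall>y\<in>U. \<forall>p\<in>Par l. \<Phi> (act C (s y) p) = p))"

definition cartan_connection :: "oct \<Rightarrow> ('m, 'g) cartan_geometry \<Rightarrow> bool" where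
  "cartan_connection l C \<longleftrightarrow>
     (\<forall>u. bij_betw (form C u) (tangent (total C) u) g2 \<and>
        (\<forall>v\<in>tangent (total C) u. \<forall>w\<in>tangent (total C) u. \<forall>a b.
           form C u (a *\<^sub>R v + b *\<^sub>R w) = a *\<^sub>R form C u v + b *\<^sub>R form C u w)) \<and>
     (\<forall>X\<in>vfields (total C). smooth_fun_on (total C) UNIV (\<lambda>u. form C u (X u))) \<and>
     (\<forall>u. \<forall>p\<in>Par l. \<forall>v\<in>tangent (total C) u.
        form C (act C u p) (pushforward (total C) (\<lambda>u'. act C u' p) v) =
        inv\<^bsub>G2\<^esub> p o\<^sub>L form C u v o\<^sub>L p) \<and>
     (\<forall>u. \<forall>A\<in>par l.
        form C u (velocity (total C) (\<lambda>t. act C u (op_exp (t *\<^sub>R A))) 0) = A)"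

definition const_field :: "('m, 'g) cartan_geometry \<Rightarrow> octop \<Rightarrow> 'g \<Rightarrow> 'g tvec" where
  "const_field C X u = inv_into (tangent (total C) u) (form C u) X"

definition base_vec :: "('m, 'g) cartan_geometry \<Rightarrow> 'g \<Rightarrow> octop \<Rightarrow> 'm tvec" where
  "base_vec C u X = pushforward (base C) (proj C) (const_field C X u)"

text \<open>The curvature \<open>d\<omega> + [\<omega>, \<omega>] / 2\<close> evaluated on constant vector fields.\<close>

definition curvature :: "('m, 'g) cartan_geometry \<Rightarrow> 'g \<Rightarrow> octop \<Rightarrow> octop \<Rightarrow> octop" where
  "curvature C u X Y = comm X Y - form C u (vf_bracket (const_field C X) (const_field C Y) u)"

definition regular_normal_geometry ::
  "oct \<Rightarrow> ('m::topological_space, 'g::topological_space) cartan_geometry \<Rightarrow> bool" where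
  "regular_normal_geometry l C \<longleftrightarrow>
     principal_bundle l C \<and> cartan_connection l C \<and>
     (\<forall>u. \<forall>i\<in>{-3..-1}. \<forall>j\<in>{-3..-1}. \<forall>X\<in>gfil l i. \<forall>Y\<in>gfil l j.
        curvature C u X Y \<in> gfil l (i + j + 1)) \<and>
     (\<forall>u. \<forall>X\<in>g2. codiff2 l (curvature C u) X = 0)"

text \<open>The oriented distribution underlying a geometry: the image of \<open>gfil l (-1)\<close>, with the
  orientation induced by a basis \<open>X, Y\<close> of \<open>gfil l (-1)\<close> modulo \<open>par l\<close>. Both orientations of this
  quotient (which are preserved by \<open>P\<close>) are allowed, so that no sign convention is imposed.\<close>

definition underlying_distribution ::
  "oct \<Rightarrow> ('m, 'g) cartan_geometry \<Rightarrow> ('m \<Rightarrow> 'm tvec set) \<Rightarrow>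
   ('m \<Rightarrow> ('m tvec \<times> 'm tvec) set) \<Rightarrow> bool" where
  "underlying_distribution l C D Or \<longleftrightarrow>
     (\<forall>u. D (proj C u) = base_vec C u ` gfil l (-1)) \<and>
     (\<exists>X\<in>gfil l (-1). \<exists>Y\<in>gfil l (-1). \<forall>u.
        Or (proj C u) = oriented_frames (base_vec C u X) (base_vec C u Y))"


section \<open>Standard tractors and the first BGG operator\<close>

text \<open>Sections of \<open>\<G> \<times>\<^sub>P W\<close> are the \<open>P\<close>-equivariant smooth functions from the total space to \<open>W\<close>.\<close>

definition tractor_sections ::
  "oct \<Rightarrow> ('m, 'g::topological_space) cartan_geometry \<Rightarrow> ('g \<Rightarrow> oct) set" where
  "tractor_sections l C = {t. smooth_fun_on (total C) UNIV t \<and> (\<forall>u. t u \<in> imag_oct) \<and>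
     (\<forall>u. \<forall>p\<in>Par l. t (act C u p) = (inv\<^bsub>G2\<^esub> p) (t u))}"

text \<open>The normal tractor connection: in direction \<open>\<xi>\<close> on the base it is \<open>\<eta> \<cdot> t + \<omega>(\<eta>) t\<close> for any
  lift \<open>\<eta>\<close> of \<open>\<xi>\<close>, here \<open>\<eta> = \<omega>\<^sup>-\<^sup>1(X)\<close>; the result vanishes for \<open>X\<close> in \<open>par l\<close>.\<close>

definition tractor_nabla ::
  "('m, 'g) cartan_geometry \<Rightarrow> ('g \<Rightarrow> oct) \<Rightarrow> 'g \<Rightarrow> octop \<Rightarrow> oct" where
  "tractor_nabla C t u X = vec_deriv (const_field C X u) t + X (t u)"

definition parallel_tractor :: "('m, 'g) cartan_geometry \<Rightarrow> ('g \<Rightarrow> oct) \<Rightarrow> bool" where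
  "parallel_tractor C t \<longleftrightarrow> (\<forall>u. \<forall>X\<in>g2. tractor_nabla C t u X = 0)"

text \<open>A map \<open>\<iota>\<close> inducing an isomorphism of the one-dimensional \<open>P\<close>-modules
  \<open>gfil l (-2) / gfil l (-1)\<close> and \<open>imag_oct / vfil l (-1)\<close>, hence of \<open>[D, D] / D\<close> with the top
  quotient of the tractor bundle. It is unique up to a nonzero factor.\<close>

definition E1_identification :: "oct \<Rightarrow> (octop \<Rightarrow> oct) \<Rightarrow> bool" where
  "E1_identification l \<iota> \<longleftrightarrow> linear \<iota> \<and> \<iota> ` gfil l (-2) \<subseteq> imag_oct \<and>
     (\<forall>X\<in>gfil l (-2). \<iota> X \<in> vfil l (-1) \<longleftrightarrow> X \<in> gfil l (-1)) \<and>
     (\<forall>p\<in>Par l. \<forall>X\<in>gfil l (-2). \<iota> (p o\<^sub>L X o\<^sub>L inv\<^bsub>G2\<^esub> p) - p (\<iota> X) \<in> vfil l (-1))"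

text \<open>The coset in \<open>[D, D] / D\<close> determined by the class of a tractor, the latter represented by \<open>w\<close>
  in the frame \<open>u\<close>.\<close>

definition E1_class ::
  "oct \<Rightarrow> (octop \<Rightarrow> oct) \<Rightarrow> ('m, 'g) cartan_geometry \<Rightarrow> 'g \<Rightarrow> oct \<Rightarrow> 'm tvec set" where
  "E1_class l \<iota> C u w = {base_vec C u X | X. X \<in> gfil l (-2) \<and> \<iota> X - w \<in> vfil l (-1)}"

text \<open>The set \<open>E1_class l \<iota> C u (t u)\<close> is the same for all \<open>u\<close> over a point.\<close>

definition Pi0 ::
  "oct \<Rightarrow> (octop \<Rightarrow> oct) \<Rightarrow> ('m, 'g) cartan_geometry \<Rightarrow> ('g \<Rightarrow> oct) \<Rightarrow> 'm \<Rightarrow> 'm tvec set" where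
  "Pi0 l \<iota> C t x = (\<Union>u\<in>{u. proj C u = x}. E1_class l \<iota> C u (t u))"

definition L0 ::
  "oct \<Rightarrow> (octop \<Rightarrow> oct) \<Rightarrow> ('m, 'g::topological_space) cartan_geometry \<Rightarrow>
   ('m \<Rightarrow> 'm tvec set) \<Rightarrow> 'g \<Rightarrow> oct" where
  "L0 l \<iota> C \<sigma> = (THE s. s \<in> tractor_sections l C \<and> Pi0 l \<iota> C s = \<sigma> \<and>
     (\<forall>u. codiff1 l (tractor_nabla C s u) = 0))"

text \<open>The class of \<open>t \<in> \<Gamma>(\<V>\<^sup>-\<^sup>1)\<close> corresponds to \<open>\<tau>\<close> with \<open>\<tau>(\<eta>) = - \<Pi>\<^sub>0(\<nabla>\<^sub>\<eta> t)\<close>; as the derivative of \<open>t\<close>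
  again has values in \<open>vfil l (-1)\<close>, for \<open>\<eta>\<close> represented by \<open>Y\<close> this is the class of \<open>- Y t\<close>. Hence
  the class of \<open>\<psi>(\<xi>)\<close>, for \<open>\<xi>\<close> represented by \<open>X\<close>, is \<open>Y \<mapsto> - Y (\<psi> X)\<close>.\<close>

definition Pi1 ::
  "oct \<Rightarrow> (octop \<Rightarrow> oct) \<Rightarrow> ('m, 'g) cartan_geometry \<Rightarrow> ('g \<Rightarrow> octop \<Rightarrow> oct) \<Rightarrow>
   'm \<Rightarrow> 'm tvec \<Rightarrow> 'm tvec \<Rightarrow> 'm tvec set" where
  "Pi1 l \<iota> C \<psi> x \<xi> \<eta> =
     \<Union> {E1_class l \<iota> C u ((1/2) *\<^sub>R (- (blinfun_apply Y (\<psi> u X)) - blinfun_apply X (\<psi> u Y))) | u X Y.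
        proj C u = x \<and> X \<in> gfil l (-1) \<and> Y \<in> gfil l (-1) \<and> base_vec C u X = \<xi> \<and> base_vec C u Y = \<eta>}"

definition Theta0 ::
  "oct \<Rightarrow> (octop \<Rightarrow> oct) \<Rightarrow> ('m, 'g::topological_space) cartan_geometry \<Rightarrow>
   ('m \<Rightarrow> 'm tvec set) \<Rightarrow> 'm \<Rightarrow> 'm tvec \<Rightarrow> 'm tvec \<Rightarrow> 'm tvec set" where
  "Theta0 l \<iota> C \<sigma> = Pi1 l \<iota> C (tractor_nabla C (L0 l \<iota> C \<sigma>))"

definition spacelike_tractor :: "('g \<Rightarrow> oct) \<Rightarrow> bool" where
  "spacelike_tractor t \<longleftrightarrow> (\<forall>u. oinner (t u) (t u) > 0)"

definition isotropic_tractor :: "('g \<Rightarrow> oct) \<Rightarrow> bool" where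
  "isotropic_tractor t \<longleftrightarrow> (\<forall>u. oinner (t u) (t u) = 0)"

definition timelike_tractor :: "('g \<Rightarrow> oct) \<Rightarrow> bool" where
  "timelike_tractor t \<longleftrightarrow> (\<forall>u. oinner (t u) (t u) < 0)"


section \<open>Holonomy\<close>

text \<open>\<open>h\<close> is the parallel transport along \<open>c\<close>, in the frames \<open>c t\<close>: for every \<open>w\<close>, the tractors
  represented by \<open>h t w\<close> in the frame \<open>c t\<close> are parallel along the projected curve.\<close>

definition tractor_transport ::
  "('m, 'g) cartan_geometry \<Rightarrow> (real \<Rightarrow> 'g) \<Rightarrow> (real \<Rightarrow> octop) \<Rightarrow> bool" where
  "tractor_transport C c h \<longleftrightarrow> continuous_on {0..1} h \<and> h 0 = id_blinfun \<and>
     (\<exists>K. finite K \<and> (\<forall>t\<in>{0<..<1} - K.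
        (h has_vector_derivative - (form C (c t) (velocity (total C) c t) o\<^sub>L h t)) (at t)))"

text \<open>Holonomy of the tractor connection with respect to the frame \<open>u\<close>. Every piecewise smooth loop at
  \<open>proj C u\<close> is the projection of such a curve \<open>c\<close> (and the result does not depend on the lift); a
  tractor represented by \<open>w\<close> in the final frame \<open>act C u p\<close> is represented by \<open>p w\<close> in the frame \<open>u\<close>.
  On all of the split octonions the operators fix the unit.\<close>

definition holonomy :: "oct \<Rightarrow> ('m, 'g::topological_space) cartan_geometry \<Rightarrow> 'g \<Rightarrow> octop set" where
  "holonomy l C u = {p o\<^sub>L h 1 | p c h. p \<in> Par l \<and> piecewise_smooth_curve (total C) c \<and>
     c 0 = u \<and> c 1 = act C u p \<and> tractor_transport C c h}"

definition conjugate_into :: "octop set \<Rightarrow> octop set \<Rightarrow> bool" where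
  "conjugate_into S H \<longleftrightarrow> (\<exists>g\<in>carrier G2. (\<lambda>x. g o\<^sub>L x o\<^sub>L inv\<^bsub>G2\<^esub> g) ` S \<subseteq> H)"

definition matrix_monoid :: "('a::semiring_1^'n^'n) set \<Rightarrow> ('a^'n^'n) monoid" where
  "matrix_monoid S = \<lparr>carrier = S, mult = (**), one = mat 1\<rparr>"

definition SL :: "(real^'n^'n) monoid" where
  "SL = matrix_monoid {A. det A = 1}"

definition SU12 :: "(complex^3^3) monoid" where
  "SU12 = (let J = (\<chi> i j. if i = j then if i = 1 then 1 else - 1 else 0) in
     matrix_monoid {A. (\<chi> i j. cnj (A $ j $ i)) ** J ** A = J \<and> det A = 1})"

text \<open>Isomorphism of closed linear groups as topological groups; continuous homomorphisms of Lie groups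
  are smooth, so this is isomorphism as Lie groups.\<close>

definition lie_group_iso ::
  "('a::topological_space) monoid \<Rightarrow> ('b::topological_space) monoid \<Rightarrow> bool" where
  "lie_group_iso G H \<longleftrightarrow>
     (\<exists>f g. f \<in> iso G H \<and> homeomorphism (carrier G) (carrier H) f g)"

definition reduces_to :: "octop set \<Rightarrow> ('b::topological_space) monoid \<Rightarrow> bool" where
  "reduces_to S K \<longleftrightarrow>
     (\<exists>H. subgroup H G2 \<and> lie_group_iso (G2\<lparr>carrier := H\<rparr>) K \<and> conjugate_into S H)"

text \<open>\<open>H\<close> is an internal semidirect product of a subgroup isomorphic to \<open>SL(2, \<real>)\<close> and the normal
  subgroup \<open>P\<^sub>+\<close>, and is contained in \<open>P\<close>.\<close>

definition SL2_semidirect_Par_plus :: "oct \<Rightarrow> octop set \<Rightarrow> bool" where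
  "SL2_semidirect_Par_plus l H \<longleftrightarrow> subgroup H G2 \<and> H \<subseteq> Par l \<and>
     Par_plus l \<lhd> G2\<lparr>carrier := H\<rparr> \<and>
     (\<exists>L. subgroup L (G2\<lparr>carrier := H\<rparr>) \<and>
        lie_group_iso (G2\<lparr>carrier := L\<rparr>) (SL :: (real^2^2) monoid) \<and>
        L \<inter> Par_plus l = {\<one>\<^bsub>G2\<^esub>} \<and> L <#>\<^bsub>G2\<^esub> Par_plus l = H)"

end

theory Submission
  imports Defs
begin

text \<open>In frames, parallel transport along a curve is a solution \<open>h\<close> of \<open>h' = A h\<close>, where the \<open>A s\<close> are derivations
  of the split octonions. The product of two solutions of \<open>y' = A y\<close> is again a solution and the inner
  product of two solutions is constant. Hence \<open>h\<close> consists of automorphisms and carries the parallel tractor \<open>t\<close>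
  along the curve, without any regularity of \<open>A\<close>, and the holonomy group fixes the vector \<open>t u\<close>.

  The group \<open>SL(3, \<real>)\<close> and an explicit family of unipotent automorphisms show that \<open>G\<^sub>2\<close> is transitive on the nonzero
  imaginary vectors of given square norm, so that stabilisers can be computed at standard vectors. Fixing the timelike vector
  \<open>(1, 0, 0, -1)\<close> means fixing the idempotents of Zorn's algebra, which leaves \<open>SL(3, \<real>)\<close>. Multiplication by a
  spacelike unit vector is a complex structure for which the split octonions become \<open>\<complex> \<oplus> \<complex>\<^sup>3\<close> with a
  Hermitian form of signature (1,2), which leaves \<open>SU(1,2)\<close>. For an isotropic vector, the nilradical of the parabolic
  subalgebra consists of the derivations raising the induced filtration; logarithms of unipotent automorphisms
  are derivations, so its exponentials are all automorphisms that are the identity on the graded space.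

  In the isotropic case \<open>t u\<close> has to be nonzero; as the zero set of a parallel tractor projects to an open
  and closed subset of \<open>M\<close>, this follows from \<open>\<sigma> \<noteq> 0\<close>.\<close>

section \<open>Calculus of smooth functions\<close>

text \<open>The isotropic case shapes the second half. Up to operators in \<open>shifts 1\<close>,
  an element of the stabiliser of \<open>l0\<close>, or a derivation scaling \<open>l0\<close>, is
  controlled by the 2 by 2 matrix that it induces on \<open>filt 1\<close>, the annihilator of
  \<open>l0\<close>, modulo \<open>l0\<close>: the lower degrees are dual to the upper ones, so
  orthogonality, and for automorphisms one product, recovers the action on them. Nilradical and Levi
  decomposition thus become statements on 2 by 2 matrices. An element of a nilpotent ideal acts on
  the top degree derivations \<open>sigma x y\<close> by a nilpotent matrix, which gives trace and
  determinant zero; brackets with the nilpotent elements \<open>dE\<close>, \<open>dF\<close> of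
  sl(2, R) remove what is left. Along curves a solution is pinned down by its constant inner
  products with transported vectors. Openness of the zero set of a tractor is of a different kind:
  it rests on a local bound for the connection form, and this bound is the purpose of the bump
  functions.\<close>

lemma Ck_on_Suc_imp_continuous_on: "Ck_on (Suc k) S f \<Longrightarrow> continuous_on S f"
  by (simp add: differentiable_imp_continuous_on)

text \<open>\<open>Ck_on\<close> uses derivatives at points, not within \<open>S\<close>; agreement
  on \<open>S\<close> passes to them because \<open>S\<close> is open.\<close>

lemma Ck_on_cong:
  assumes "open S" "\<And>x. x \<in> S \<Longrightarrow> f x = g x" "Ck_on k S f"
  shows "Ck_on k S g"
  using assms
proof (induction k arbitrary: f g)
  case 0
  then show ?case by (simp cong: continuous_on_cong)
next
  case (Suc k)
  have d: "f differentiable at x" if "x \<in> S" for x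
    using Suc.prems that by (simp add: differentiable_on_eq_differentiable_at)
  have "(g has_derivative frechet_derivative f (at x)) (at x)" if "x \<in> S" for x
    using d[OF that, unfolded frechet_derivative_works]
    by (rule has_derivative_transform_within_open[OF _ Suc.prems(1) that]) (use Suc.prems(2) in auto)
  then have g: "g differentiable at x" "frechet_derivative f (at x) = frechet_derivative g (at x)" if "x \<in> S" for x
    using that by (auto simp: differentiable_def frechet_derivative_at)
  have "Ck_on k S (\<lambda>x. frechet_derivative g (at x) v)" for v
    by (rule Suc.IH[OF Suc.prems(1), of "\<lambda>x. frechet_derivative f (at x) v"]) (use g(2) Suc.prems(3) in auto)
  with g(1) show ?case using Suc.prems(1) by (simp add: differentiable_on_eq_differentiable_at)
qed

text \<open>Admits any explicit formula for the derivative in place of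
  \<open>frechet_derivative\<close>; product and chain rule enter through it.\<close>

lemma Ck_on_SucI:
  assumes "open S" "\<And>x. x \<in> S \<Longrightarrow> (f has_derivative f' x) (at x)" "\<And>v. Ck_on k S (\<lambda>x. f' x v)"
  shows "Ck_on (Suc k) S f"
proof -
  have "f differentiable_on S"
    using assms(1,2) by (auto simp: differentiable_on_eq_differentiable_at differentiable_def)
  moreover have "Ck_on k S (\<lambda>x. frechet_derivative f (at x) v)" for v
    by (rule Ck_on_cong[OF assms(1) _ assms(3)[of v]]) (simp add: frechet_derivative_at[OF assms(2), symmetric])
  ultimately show ?thesis by simp
qed

lemma Ck_on_SucD:
  assumes "open S" "Ck_on (Suc k) S f" "x \<in> S"
  shows "(f has_derivative frechet_derivative f (at x)) (at x)"
  using assms by (simp add: differentiable_on_eq_differentiable_at frechet_derivative_works[symmetric])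

lemma Ck_on_subset: "Ck_on k S f \<Longrightarrow> T \<subseteq> S \<Longrightarrow> Ck_on k T f"
  by (induction k arbitrary: f) (auto intro: continuous_on_subset differentiable_on_subset)

lemma Ck_on_local:
  assumes "open S" "\<And>x. x \<in> S \<Longrightarrow> \<exists>T. open T \<and> x \<in> T \<and> Ck_on k T f"
  shows "Ck_on k S f"
  using assms(2)
proof (induction k arbitrary: f)
  case 0
  have "isCont f x" if x: "x \<in> S" for x
  proof -
    obtain T where "open T" "x \<in> T" "continuous_on T f" using 0[OF x] by auto
    then show ?thesis by (simp add: continuous_on_eq_continuous_at)
  qed
  then show ?case by (simp add: continuous_at_imp_continuous_on)
next
  case (Suc k)
  have "f differentiable at x" if x: "x \<in> S" for x
  proof -
    obtain T where "open T" "x \<in> T" "Ck_on (Suc k) T f" using Suc.prems[OF x] by blast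
    then show ?thesis by (simp add: differentiable_on_eq_differentiable_at)
  qed
  moreover have "Ck_on k S (\<lambda>x. frechet_derivative f (at x) v)" for v
    by (rule Suc.IH) (use Suc.prems in fastforce)
  ultimately show ?case
    using assms(1) by (simp add: differentiable_on_eq_differentiable_at)
qed

lemma Ck_on_Suc_imp:
  assumes "open S" "Ck_on (Suc k) S f"
  shows "Ck_on k S f"
  using assms(2)
proof (induction k arbitrary: f)
  case 0
  then show ?case using Ck_on_Suc_imp_continuous_on[OF 0] by simp
next
  case (Suc k)
  then show ?case by simp
qed

lemma Ck_on_imp_continuous_on: "Ck_on k S f \<Longrightarrow> continuous_on S f"
  using Ck_on_Suc_imp_continuous_on by (cases k) auto

lemma Ck_on_const: "Ck_on k S (\<lambda>x. c)"
  by (induction k arbitrary: c) simp_all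

lemma Ck_on_linear:
  assumes "open S" "bounded_linear L" "Ck_on k S f"
  shows "Ck_on k S (\<lambda>x. L (f x))"
  using assms(3)
proof (induction k arbitrary: f)
  case 0
  then show ?case using bounded_linear.continuous_on[OF assms(2)] by simp
next
  case (Suc k)
  show ?case
  proof (rule Ck_on_SucI[OF assms(1)])
    show "((\<lambda>x. L (f x)) has_derivative (\<lambda>v. L (frechet_derivative f (at x) v))) (at x)" if "x \<in> S" for x
      by (rule bounded_linear.has_derivative[OF assms(2) Ck_on_SucD[OF assms(1) Suc.prems that]])
    show "Ck_on k S (\<lambda>x. L (frechet_derivative f (at x) v))" for v
      using Suc by simp
  qed
qed

lemma Ck_on_id: "open S \<Longrightarrow> Ck_on k S (\<lambda>x. x)"
  by (cases k) (auto intro!: Ck_on_SucI[where f' = "\<lambda>x v. v"] Ck_on_const continuous_on_id)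

lemma Ck_on_add:
  assumes "open S" "Ck_on k S f" "Ck_on k S g"
  shows "Ck_on k S (\<lambda>x. f x + g x)"
  using assms(2,3)
proof (induction k arbitrary: f g)
  case 0
  then show ?case by (simp add: continuous_on_add)
next
  case (Suc k)
  show ?case
  proof (rule Ck_on_SucI[OF assms(1)])
    show "((\<lambda>x. f x + g x) has_derivative (\<lambda>v. frechet_derivative f (at x) v + frechet_derivative g (at x) v)) (at x)"
      if "x \<in> S" for x
      using Suc.prems that assms(1) by (intro has_derivative_add Ck_on_SucD)
    show "Ck_on k S (\<lambda>x. frechet_derivative f (at x) v + frechet_derivative g (at x) v)" for v
      using Suc by simp
  qed
qed

lemma Ck_on_sum:
  assumes "open S" "finite I" "\<And>i. i \<in> I \<Longrightarrow> Ck_on k S (f i)"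
  shows "Ck_on k S (\<lambda>x. \<Sum>i\<in>I. f i x)"
  using assms(2,3) by (induction I rule: finite_induct) (auto intro: Ck_on_const Ck_on_add assms(1))

lemma Ck_on_bilinear:
  assumes bil: "bounded_bilinear B" and "open S" "Ck_on k S f" "Ck_on k S g"
  shows "Ck_on k S (\<lambda>x. B (f x) (g x))"
  using assms(3,4)
proof (induction k arbitrary: f g)
  case 0
  then show ?case using bounded_bilinear.continuous_on[OF bil] by simp
next
  case (Suc k)
  show ?case
  proof (rule Ck_on_SucI[OF assms(2)])
    show "((\<lambda>x. B (f x) (g x)) has_derivative
        (\<lambda>v. B (f x) (frechet_derivative g (at x) v) + B (frechet_derivative f (at x) v) (g x))) (at x)"
      if "x \<in> S" for x
      using Suc.prems that assms(2) by (intro bounded_bilinear.FDERIV[OF bil] Ck_on_SucD)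
    show "Ck_on k S (\<lambda>x. B (f x) (frechet_derivative g (at x) v) + B (frechet_derivative f (at x) v) (g x))" for v
      using Suc.prems Suc.prems[THEN Ck_on_Suc_imp[OF assms(2)]]
      by (intro Ck_on_add[OF assms(2)] Suc.IH) simp_all
  qed
qed

text \<open>The chain rule produces \<open>dg (f x) (df x v)\<close>, in which the linear map itself
  varies with \<open>x\<close>. Expanding \<open>df x v\<close> over \<open>Basis\<close> gives a
  finite sum of products, and the induction hypothesis applies to each
  \<open>\<lambda>y. dg y b\<close>.\<close>

lemma Ck_on_compose:
  fixes f :: "'a::real_normed_vector \<Rightarrow> 'b::euclidean_space"
  assumes "open S" "open T" "Ck_on k S f" "Ck_on k T g" "f ` S \<subseteq> T"
  shows "Ck_on k S (\<lambda>x. g (f x))"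
  using assms(3,4)
proof (induction k arbitrary: g)
  case 0
  then show ?case using assms(5) by (auto intro: continuous_on_compose2)
next
  case (Suc k)
  define df where "df x = frechet_derivative f (at x)" for x
  define dg where "dg y = frechet_derivative g (at y)" for y
  show ?case
  proof (rule Ck_on_SucI[OF assms(1)])
    fix x assume x: "x \<in> S"
    then have fx: "f x \<in> T" using assms(5) by blast
    have g: "(g has_derivative dg (f x)) (at (f x))"
      unfolding dg_def by (rule Ck_on_SucD[OF assms(2) Suc.prems(2) fx])
    have "((\<lambda>x. g (f x)) has_derivative (\<lambda>v. dg (f x) (df x v))) (at x)"
      unfolding df_def
      by (rule has_derivative_compose[OF Ck_on_SucD[OF assms(1) Suc.prems(1) x] g])
    moreover have "dg (f x) (df x v) = (\<Sum>b\<in>Basis. (df x v \<bullet> b) *\<^sub>R dg (f x) b)" for v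
    proof -
      have lin: "linear (dg (f x))" using has_derivative_linear[OF g] .
      have "dg (f x) (df x v) = dg (f x) (\<Sum>b\<in>Basis. (df x v \<bullet> b) *\<^sub>R b)"
        by (simp add: euclidean_representation)
      then show ?thesis by (simp add: linear_sum[OF lin] linear_scale[OF lin])
    qed
    ultimately show "((\<lambda>x. g (f x)) has_derivative (\<lambda>v. \<Sum>b\<in>Basis. (df x v \<bullet> b) *\<^sub>R dg (f x) b)) (at x)"
      by simp
  next
    fix v
    have "Ck_on k S (\<lambda>x. df x v \<bullet> b)" "Ck_on k S (\<lambda>x. dg (f x) b)" for b
      using Suc.prems Ck_on_Suc_imp[OF assms(1) Suc.prems(1)] Suc.IH[of "\<lambda>y. dg y b"]
      by (auto simp: df_def dg_def intro!: Ck_on_linear[OF assms(1) bounded_linear_inner_left])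
    then show "Ck_on k S (\<lambda>x. \<Sum>b\<in>Basis. (df x v \<bullet> b) *\<^sub>R dg (f x) b)"
      by (intro Ck_on_sum assms(1) Ck_on_bilinear[OF bounded_bilinear_scaleR]) auto
  qed
qed

lemma smooth_on_imp_continuous_on: "smooth_on S f \<Longrightarrow> continuous_on S f"
  using Ck_on_imp_continuous_on by (auto simp: smooth_on_def)

lemma smooth_on_has_derivative:
  "open S \<Longrightarrow> smooth_on S f \<Longrightarrow> x \<in> S \<Longrightarrow> (f has_derivative frechet_derivative f (at x)) (at x)"
  using Ck_on_SucD[of S 0 f x] by (auto simp: smooth_on_def)

lemma smooth_on_frechet_derivative:
  assumes "smooth_on S f"
  shows "smooth_on S (\<lambda>x. frechet_derivative f (at x) v)"
  unfolding smooth_on_def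
proof
  fix k
  have "Ck_on (Suc k) S f" using assms unfolding smooth_on_def by blast
  then show "Ck_on k S (\<lambda>x. frechet_derivative f (at x) v)" by simp
qed

subsection \<open>A bump function\<close>

text \<open>\<open>expo 0\<close> is the classical flat function. All \<open>n\<close> are treated
  together because differentiation stays within the family.\<close>

definition expo :: "nat \<Rightarrow> real \<Rightarrow> real" where
  "expo n x = (if x > 0 then exp (- (1 / x)) / x ^ n else 0)"

lemma expo_has_derivative:
  "(expo n has_real_derivative expo (n + 2) x - real n * expo (n + 1) x) (at x)"
proof -
  consider "x > 0" | "x < 0" | "x = 0" by linarith
  then show ?thesis
  proof cases
    case 1
    have "((\<lambda>x. exp (- (1 / x)) / x ^ n) has_real_derivative expo (n + 2) x - real n * expo (n + 1) x) (at x)"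
      using 1
      by (auto intro!: derivative_eq_intros simp: expo_def)
        (cases n; simp add: field_simps power2_eq_square)
    then show ?thesis
      by (rule has_field_derivative_transform_within_open[of _ _ _ "{0<..}"]) (use 1 in \<open>auto simp: expo_def\<close>)
  next
    case 2
    have "((\<lambda>x. 0) has_real_derivative 0) (at x)" by simp
    then have "(expo n has_real_derivative 0) (at x)"
      by (rule has_field_derivative_transform_within_open[of _ _ _ "{..<0}"]) (use 2 in \<open>auto simp: expo_def\<close>)
    then show ?thesis using 2 by (simp add: expo_def)
  next
    case 3
    have "((\<lambda>h. expo n h / h) \<longlongrightarrow> 0) (at 0)"
    proof (rule filterlim_split_at)
      have "((\<lambda>h. 0) \<longlongrightarrow> (0::real)) (at_left 0)" by simp
      then show "((\<lambda>h. expo n h / h) \<longlongrightarrow> 0) (at_left 0)"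
        by (rule Lim_transform_eventually) (auto simp: eventually_at_filter expo_def)
      \<comment> \<open>Substituting y = 1 / h turns the right difference quotient at 0 into this
        limit at infinity.\<close>
      have "((\<lambda>y::real. y ^ Suc n / exp y) \<longlongrightarrow> 0) at_top" by (rule tendsto_power_div_exp_0)
      then have "((\<lambda>h::real. inverse h ^ Suc n / exp (inverse h)) \<longlongrightarrow> 0) (at_right 0)"
        by (rule filterlim_compose[OF _ filterlim_inverse_at_top_right])
      then show "((\<lambda>h. expo n h / h) \<longlongrightarrow> 0) (at_right 0)"
        by (rule Lim_transform_eventually)
          (auto simp: eventually_at_filter expo_def exp_minus field_simps)
    qed
    then show ?thesis using 3 by (simp add: DERIV_def expo_def)
  qed
qed

lemma Ck_on_expo: "Ck_on k UNIV (expo n)"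
proof (induction k arbitrary: n)
  case 0
  have "isCont (expo n) x" for x
    using expo_has_derivative DERIV_isCont by blast
  then show ?case by (simp add: continuous_on_eq_continuous_at)
next
  case (Suc k)
  show ?case
  proof (rule Ck_on_SucI)
    show "(expo n has_derivative (\<lambda>v. v * (expo (n + 2) x + (- real n) * expo (n + 1) x))) (at x)" for x
      using expo_has_derivative[of n x] by (simp add: has_field_derivative_def mult.commute mult_commute_abs)
    show "Ck_on k UNIV (\<lambda>x. v * (expo (n + 2) x + (- real n) * expo (n + 1) x))" for v
      by (intro Ck_on_linear[OF _ bounded_linear_mult_right] Ck_on_add Suc.IH) auto
  qed simp
qed

text \<open>The squared distance is used because, unlike the distance, it is smooth at the
  centre.\<close>

definition bump :: "'a::euclidean_space \<Rightarrow> real \<Rightarrow> 'a \<Rightarrow> real" where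
  "bump c r x = expo 0 (r\<^sup>2 - (x - c) \<bullet> (x - c))"

lemma bump_pos: "bump c r x > 0 \<longleftrightarrow> dist x c < \<bar>r\<bar>" and bump_zero: "\<bar>r\<bar> \<le> dist x c \<Longrightarrow> bump c r x = 0"
proof -
  have "(x - c) \<bullet> (x - c) < r\<^sup>2 \<longleftrightarrow> dist x c < \<bar>r\<bar>"
    using abs_le_square_iff[of r "dist x c"] by (simp add: dist_norm power2_norm_eq_inner flip: not_le)
  then show "bump c r x > 0 \<longleftrightarrow> dist x c < \<bar>r\<bar>" "\<bar>r\<bar> \<le> dist x c \<Longrightarrow> bump c r x = 0"
    by (auto simp: bump_def expo_def)
qed

lemma Ck_on_bump: "Ck_on k UNIV (bump c r)"
proof -
  have 1: "Ck_on k UNIV (\<lambda>x. x + (- c))" for c :: 'a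
    by (intro Ck_on_add Ck_on_id Ck_on_const) auto
  have "Ck_on k UNIV (\<lambda>x. r\<^sup>2 + - ((x + - c) \<bullet> (x + - c)))"
    by (intro Ck_on_add Ck_on_const Ck_on_linear[OF _ bounded_linear_minus[OF bounded_linear_ident]]
        Ck_on_bilinear[OF bounded_bilinear_inner] 1) auto
  then have "Ck_on k UNIV (\<lambda>x. expo 0 (r\<^sup>2 + - ((x + - c) \<bullet> (x + - c))))"
    by (rule Ck_on_compose[OF open_UNIV open_UNIV _ Ck_on_expo]) simp
  then show ?thesis by (simp add: bump_def[abs_def])
qed

text \<open>\<open>oct\<close> is a product type; without this the simplifier would break every
  quantified octonion into its four components.\<close>

declare split_paired_All [simp del] split_paired_Ex [simp del]

section \<open>Split octonions\<close>

definition oone :: oct where "oone = (1, 0, 0, 1)"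

lemma bilinear_omult: "bilinear omult"
proof -
  have "omult (x + y) z = omult x z + omult y z" "omult z (x + y) = omult z x + omult z y"
    "omult (c *\<^sub>R x) z = c *\<^sub>R omult x z" "omult z (c *\<^sub>R x) = c *\<^sub>R omult z x" for x y z c
    by (cases x rule: prod_cases4; cases y rule: prod_cases4; cases z rule: prod_cases4;
        simp add: algebra_simps cross_add_left cross_add_right cross_mult_left cross_mult_right
          inner_add_left inner_add_right)+
  then show ?thesis
    unfolding bilinear_def by (auto intro!: linearI)
qed

lemma bounded_bilinear_omult: "bounded_bilinear omult"
  using bilinear_omult bilinear_conv_bounded_bilinear by blast

lemma bilinear_oinner: "bilinear oinner"
proof -
  have "oinner (x + y) z = oinner x z + oinner y z" "oinner z (x + y) = oinner z x + oinner z y"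
    "oinner (c *\<^sub>R x) z = c *\<^sub>R oinner x z" "oinner z (c *\<^sub>R x) = c *\<^sub>R oinner z x" for x y z c
    by (cases x rule: prod_cases4; cases y rule: prod_cases4; cases z rule: prod_cases4;
        simp add: field_simps inner_add_left inner_add_right)+
  then show ?thesis
    unfolding bilinear_def by (auto intro!: linearI)
qed

lemma bounded_bilinear_oinner: "bounded_bilinear oinner"
  using bilinear_oinner bilinear_conv_bounded_bilinear by blast

interpretation omult: bounded_bilinear omult by (rule bounded_bilinear_omult)
interpretation oinner: bounded_bilinear oinner by (rule bounded_bilinear_oinner)

lemma oinner_commute: "oinner x y = oinner y x"
  by (cases x rule: prod_cases4; cases y rule: prod_cases4) (simp add: inner_commute algebra_simps)

lemma omult_oone [simp]: "omult oone x = x" "omult x oone = x"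
  by (cases x rule: prod_cases4; simp add: oone_def)+

lemma oinner_oone_oone [simp]: "oinner oone oone = 1"
  by (simp add: oone_def)

lemma oone_nonzero [simp]: "oone \<noteq> 0"
  by (simp add: oone_def zero_prod_def)

text \<open>Polarised form of the quadratic equation that every octonion satisfies. It expresses
  \<open>oinner\<close> by the multiplication and the unit, and is the reason why automorphisms and
  derivations respect \<open>oinner\<close>.\<close>

lemma omult_anticommute:
  "omult x y + omult y x = (2 * oinner x oone) *\<^sub>R y + (2 * oinner y oone) *\<^sub>R x - (2 * oinner x y) *\<^sub>R oone"
proof (cases x rule: prod_cases4; cases y rule: prod_cases4)
  fix a u v b a' u' v' b'
  assume "x = (a, u, v, b)" "y = (a', u', v', b')"
  then show ?thesis
    using cross_skew[of v v'] cross_skew[of u u']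
    by (simp add: oone_def inner_commute algebra_simps add_divide_distrib diff_divide_distrib)
qed

lemma omult_self: "omult x x = (2 * oinner x oone) *\<^sub>R x - oinner x x *\<^sub>R oone"
proof -
  have "2 *\<^sub>R omult x x = 2 *\<^sub>R ((2 * oinner x oone) *\<^sub>R x - oinner x x *\<^sub>R oone)"
    using omult_anticommute[of x x] by (simp add: algebra_simps flip: scaleR_2)
  then show ?thesis by simp
qed

lemma oinner_nondegenerate:
  assumes "\<And>y. oinner x y = 0"
  shows "x = 0"
proof (cases x rule: prod_cases4)
  fix a u v b
  assume x: "x = (a, u, v, b)"
  have "a = 0" "b = 0" "u = 0" "v = 0"
    using assms[of "(0, 0, 0, 1)"] assms[of "(1, 0, 0, 0)"] assms[of "(0, 0, u, 0)"] assms[of "(0, v, 0, 0)"]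
    by (simp_all add: x)
  then show ?thesis by (simp add: x zero_prod_def)
qed

lemma oinner_eqI:
  assumes "\<And>y. oinner x y = oinner x' y"
  shows "x = x'"
  using oinner_nondegenerate[of "x - x'"] assms by (simp add: oinner.diff_left)

lemma imag_oct_iff: "x \<in> imag_oct \<longleftrightarrow> oinner x oone = 0"
  by (cases x rule: prod_cases4) (auto simp: imag_oct_def oone_def)

lemma subspace_imag_oct: "subspace imag_oct"
  by (auto simp: subspace_def imag_oct_iff oinner.add_left oinner.scaleR_left oinner.zero_left)

lemma dependent_oone:
  assumes "a *\<^sub>R x = b *\<^sub>R oone" "a \<noteq> 0"
  shows "\<exists>c. x = c *\<^sub>R oone"
proof
  have "x = (1 / a) *\<^sub>R (a *\<^sub>R x)" using assms(2) by simp
  then show "x = (b / a) *\<^sub>R oone" by (simp add: assms(1))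
qed

section \<open>Automorphisms and derivations\<close>

lemma G2_carrier_iff: "g \<in> carrier G2 \<longleftrightarrow> bij (blinfun_apply g) \<and> (\<forall>x y. g (omult x y) = omult (g x) (g y))"
  by (simp add: G2_def)

lemma G2_mult [simp]: "g \<otimes>\<^bsub>G2\<^esub> h = g o\<^sub>L h" and G2_one [simp]: "\<one>\<^bsub>G2\<^esub> = id_blinfun"
  by (simp_all add: G2_def)

lemma G2_apply_omult: "g \<in> carrier G2 \<Longrightarrow> g (omult x y) = omult (g x) (g y)"
  by (simp add: G2_carrier_iff)

lemma blinfun_bij_inverse:
  fixes g :: octop
  assumes "bij (blinfun_apply g)"
  obtains h :: octop where "h o\<^sub>L g = id_blinfun" "g o\<^sub>L h = id_blinfun" "blinfun_apply h = inv_into UNIV (blinfun_apply g)"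
proof -
  have "linear (blinfun_apply g)" by (rule bounded_linear.linear) (rule blinfun.bounded_linear_right)
  then have "linear (inv_into UNIV (blinfun_apply g))"
    using assms by (simp add: bij_def linear_inj_imp_surj linear_injective_left_inverse inj_linear_imp_inv_linear)
  then have *: "bounded_linear (inv_into UNIV (blinfun_apply g))" by (simp add: linear_conv_bounded_linear)
  show thesis
    by (rule that[of "Blinfun (inv_into UNIV (blinfun_apply g))"])
      (use assms * in \<open>auto intro!: blinfun_eqI simp: bounded_linear_Blinfun_apply bij_is_inj bij_is_surj surj_f_inv_f\<close>)
qed

lemma G2_inverse:
  assumes "g \<in> carrier G2"
  obtains h where "h \<in> carrier G2" "h o\<^sub>L g = id_blinfun" "g o\<^sub>L h = id_blinfun"
proof -
  obtain h :: octop where h: "h o\<^sub>L g = id_blinfun" "g o\<^sub>L h = id_blinfun" "blinfun_apply h = inv_into UNIV (blinfun_apply g)"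
    using assms blinfun_bij_inverse by (auto simp: G2_carrier_iff)
  have hg: "h (g x) = x" "g (h x) = x" for x
    using arg_cong[OF h(1), of "\<lambda>h. blinfun_apply h x"] arg_cong[OF h(2), of "\<lambda>h. blinfun_apply h x"] by simp_all
  have "h (omult x y) = omult (h x) (h y)" for x y
    by (metis assms G2_apply_omult hg)
  moreover have "bij (blinfun_apply h)"
    using assms by (simp add: h(3) G2_carrier_iff bij_imp_bij_inv)
  ultimately show thesis
    using h(1,2) that[of h] unfolding G2_carrier_iff by blast
qed

lemma group_G2: "group G2"
proof (rule groupI)
  fix g h assume "g \<in> carrier G2" "h \<in> carrier G2"
  then show "g \<otimes>\<^bsub>G2\<^esub> h \<in> carrier G2"
    using bij_comp[of "blinfun_apply h" "blinfun_apply g"]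
    by (simp add: G2_carrier_iff blinfun_compose.rep_eq)
next
  show "\<one>\<^bsub>G2\<^esub> \<in> carrier G2" by (simp add: G2_carrier_iff id_blinfun.rep_eq bij_id[unfolded id_def])
next
  fix g assume "g \<in> carrier G2"
  then show "\<exists>h\<in>carrier G2. h \<otimes>\<^bsub>G2\<^esub> g = \<one>\<^bsub>G2\<^esub>" using G2_inverse by (metis G2_mult G2_one)
qed (auto intro: blinfun_eqI)

interpretation G2: group G2 by (rule group_G2)

lemma G2_inv_apply [simp]:
  assumes "g \<in> carrier G2"
  shows "(inv\<^bsub>G2\<^esub> g) (g x) = x" "g ((inv\<^bsub>G2\<^esub> g) x) = x"
  using arg_cong[OF G2.l_inv[OF assms], of "\<lambda>h. blinfun_apply h x"]
    arg_cong[OF G2.r_inv[OF assms], of "\<lambda>h. blinfun_apply h x"] by simp_all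

lemma G2_apply_oone:
  assumes "g \<in> carrier G2"
  shows "g oone = oone"
proof -
  have "omult (g oone) (g x) = g x" for x
    using assms by (metis G2_apply_omult omult_oone(1))
  then have "omult (g oone) oone = oone"
    using G2_inv_apply(2)[OF assms] by metis
  then show ?thesis by simp
qed

lemma oinner_polarize: "oinner x y = (oinner (x + y) (x + y) - oinner x x - oinner y y) / 2"
  using oinner_commute[of x y] by (simp add: oinner.add_left oinner.add_right)

text \<open>Applying \<open>g\<close> to the quadratic equation of \<open>x\<close> and comparing
  with that of \<open>g x\<close> leaves a linear relation between \<open>g x\<close> and the unit.
  Unless \<open>x\<close> is a multiple of the unit, both coefficients vanish, and one of them is
  the difference of the norms.\<close>

lemma G2_oinner:
  assumes g: "g \<in> carrier G2"
  shows "oinner (g x) (g y) = oinner x y"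
proof -
  have norm: "oinner (g x) (g x) = oinner x x" for x
  proof (cases "\<exists>c. x = c *\<^sub>R oone")
    case True
    then show ?thesis by (auto simp: blinfun.scaleR_right G2_apply_oone[OF g])
  next
    case False
    have "g (omult x x) = omult (g x) (g x)" by (rule G2_apply_omult[OF g])
    then have "(2 * oinner x oone - 2 * oinner (g x) oone) *\<^sub>R g x =
        (oinner x x - oinner (g x) (g x)) *\<^sub>R oone"
      by (simp add: omult_self[of x] omult_self[of "g x"] blinfun.diff_right blinfun.scaleR_right
          G2_apply_oone[OF g] algebra_simps)
    moreover have "2 * oinner x oone - 2 * oinner (g x) oone = 0"
    proof (rule ccontr)
      assume "\<not> ?thesis"
      with calculation obtain c where c: "g x = c *\<^sub>R oone" using dependent_oone by blast
      have "g x = g (c *\<^sub>R oone)" by (simp add: c blinfun.scaleR_right G2_apply_oone[OF g])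
      then have "x = c *\<^sub>R oone"
        using g by (metis G2_carrier_iff bij_is_inj injD)
      with False show False by blast
    qed
    ultimately show ?thesis by simp
  qed
  show ?thesis
    by (simp add: oinner_polarize[of x y] oinner_polarize[of "g x" "g y"] norm flip: blinfun.add_right)
qed

lemma G2_imag_oct: "g \<in> carrier G2 \<Longrightarrow> g x \<in> imag_oct \<longleftrightarrow> x \<in> imag_oct"
  using G2_oinner[of g x oone] by (simp add: imag_oct_iff G2_apply_oone)

section \<open>Derivations of the split octonions\<close>

definition der :: "octop set" where
  "der = {A::octop. \<forall>x y. A (omult x y) = omult (A x) y + omult x (A y)}"

lemma der_omult: "A \<in> der \<Longrightarrow> A (omult x y) = omult (A x) y + omult x (A y)"
  by (simp add: der_def)

lemma der_oone: "A \<in> der \<Longrightarrow> A oone = 0"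
  using der_omult[of A oone oone] by simp

text \<open>Infinitesimal version of \<open>G2_oinner\<close>: the quadratic equation is
  differentiated instead of transformed.\<close>

lemma der_skew:
  assumes A: "A \<in> der"
  shows "oinner (A x) y = - oinner x (A y)"
proof -
  have norm: "oinner (A x) x = 0" "oinner (A x) oone = 0" for x
  proof -
    have "oinner (A x) x = 0 \<and> oinner (A x) oone = 0"
    proof (cases "\<exists>c. x = c *\<^sub>R oone")
      case True
      then show ?thesis by (auto simp: blinfun.scaleR_right der_oone[OF A] oinner.zero_left)
    next
      case False
      have "A (omult x x) = omult (A x) x + omult x (A x)" by (rule der_omult[OF A])
      then have eq: "(2 * oinner (A x) oone) *\<^sub>R x = (2 * oinner (A x) x) *\<^sub>R oone"
        unfolding omult_anticommute
        by (simp add: omult_self[of x] blinfun.diff_right blinfun.scaleR_right der_oone[OF A] algebra_simps)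
      then have "2 * oinner (A x) oone = 0"
        using False dependent_oone by blast
      with eq show ?thesis by simp
    qed
    then show "oinner (A x) x = 0" "oinner (A x) oone = 0" by auto
  qed
  show ?thesis
    using norm(1)[of "x + y"] norm(1)[of x] norm(1)[of y] oinner_commute[of "A y" x]
    by (simp add: blinfun.add_right oinner.add_left oinner.add_right)
qed

lemma der_imag_oct: "A \<in> der \<Longrightarrow> A x \<in> imag_oct"
  using der_skew[of A x oone] by (simp add: imag_oct_iff der_oone oinner.zero_right)

lemma subspace_der: "subspace der"
  unfolding subspace_def der_def
  by (simp add: blinfun.add_left blinfun.scaleR_left omult.add_left omult.add_right
      omult.scaleR_left omult.scaleR_right scaleR_add_right omult.zero_left omult.zero_right)

lemma comm_apply: "comm A B x = A (B x) - B (A x)"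
  by (simp add: comm_def blinfun.diff_left)

lemma comm_der: "A \<in> der \<Longrightarrow> B \<in> der \<Longrightarrow> comm A B \<in> der"
  unfolding der_def by (simp add: comm_apply blinfun.add_right omult.diff_left omult.diff_right)

section \<open>Operator exponentials and parallel transport\<close>

lemma op_exp_power_apply: "((\<lambda>B. A o\<^sub>L B) ^^ n) id_blinfun x = (blinfun_apply A ^^ n) x"
  for A :: octop
  by (induction n) auto

lemma norm_op_power: "norm (((\<lambda>B. A o\<^sub>L B) ^^ n) (id_blinfun :: octop)) \<le> norm A ^ n" for A :: octop
proof (induction n)
  case 0
  then show ?case by (simp add: norm_blinfun_id_le)
next
  case (Suc n)
  then show ?case
    using norm_blinfun_compose[of A "((\<lambda>B. A o\<^sub>L B) ^^ n) id_blinfun"]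
    by simp (rule order_trans, assumption, rule mult_left_mono, simp_all)
qed

lemma summable_op_exp: "summable (\<lambda>n. (1 / fact n) *\<^sub>R ((\<lambda>B. A o\<^sub>L B) ^^ n) (id_blinfun :: octop))"
  for A :: octop
proof (rule summable_comparison_test)
  show "summable (\<lambda>n. inverse (fact n) * norm A ^ n)" by (rule summable_exp)
  show "\<exists>N. \<forall>n\<ge>N. norm ((1 / fact n) *\<^sub>R ((\<lambda>B. A o\<^sub>L B) ^^ n) (id_blinfun :: octop)) \<le> inverse (fact n) * norm A ^ n"
    using norm_op_power[of _ A] by (auto simp: divide_inverse intro!: mult_left_mono)
qed

lemma op_exp_apply_sums: "(\<lambda>n. (1 / fact n) *\<^sub>R (blinfun_apply A ^^ n) x) sums op_exp A x"
proof -
  have "(\<lambda>n. (1 / fact n) *\<^sub>R ((\<lambda>B. A o\<^sub>L B) ^^ n) (id_blinfun :: octop)) sums op_exp A"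
    unfolding op_exp_def using summable_op_exp by (rule summable_sums)
  from bounded_linear.sums[OF blinfun.bounded_linear_left[of x] this] show ?thesis
    by (simp add: blinfun.scaleR_left op_exp_power_apply)
qed

lemma blinfun_scaleR_funpow: "(blinfun_apply (t *\<^sub>R A) ^^ n) x = t ^ n *\<^sub>R (blinfun_apply A ^^ n) x"
  for A :: octop
  by (induction n) (simp_all add: blinfun.scaleR_left blinfun.scaleR_right)

text \<open>After pairing with a basis vector the exponential becomes a real power series in
  \<open>t\<close>, which may be differentiated term by term.\<close>

lemma op_exp_scaleR_has_vector_derivative:
  "((\<lambda>t. op_exp (t *\<^sub>R A) x) has_vector_derivative A (op_exp (t *\<^sub>R A) x)) (at t)"
proof -
  have sums: "(\<lambda>n. (t ^ n / fact n) *\<^sub>R (blinfun_apply A ^^ n) x) sums op_exp (t *\<^sub>R A) x" for t x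
    using op_exp_apply_sums[of "t *\<^sub>R A" x] by (simp add: blinfun_scaleR_funpow)
  have "((\<lambda>t. op_exp (t *\<^sub>R A) x \<bullet> b) has_real_derivative A (op_exp (t *\<^sub>R A) x) \<bullet> b) (at t)" for b
  proof -
    define c where "c n = ((blinfun_apply A ^^ n) x \<bullet> b) / fact n" for n
    have s: "(\<lambda>n. c n * t ^ n) sums (op_exp (t *\<^sub>R A) x \<bullet> b)" for t
      using bounded_linear.sums[OF bounded_linear_inner_left[of b] sums[of t x]]
      by (simp add: c_def mult_ac)
    have "diffs c n = ((blinfun_apply A ^^ n) (A x) \<bullet> b) / fact n" for n
      by (simp add: diffs_def c_def funpow_swap1 del: of_nat_Suc)
    then have s': "(\<lambda>n. diffs c n * t ^ n) sums (op_exp (t *\<^sub>R A) (A x) \<bullet> b)" for t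
      using bounded_linear.sums[OF bounded_linear_inner_left[of b] sums[of t "A x"]]
      by (simp add: mult_ac)
    have comm: "op_exp (t *\<^sub>R A) (A x) = A (op_exp (t *\<^sub>R A) x)"
      using bounded_linear.sums[OF blinfun.bounded_linear_right[of A] sums[of t x]] sums[of t "A x"]
      by (simp add: blinfun.scaleR_right funpow_swap1 sums_unique2)
    have "((\<lambda>t. \<Sum>n. c n * t ^ n) has_real_derivative (\<Sum>n. diffs c n * t ^ n)) (at t)"
      by (rule termdiffs_strong_converges_everywhere) (use s sums_summable in blast)
    then show ?thesis
      using s s' by (simp add: sums_iff comm)
  qed
  then have "((\<lambda>t. op_exp (t *\<^sub>R A) x) has_derivative (\<lambda>h. h *\<^sub>R A (op_exp (t *\<^sub>R A) x))) (at t)"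
    by (subst has_derivative_componentwise_within)
      (simp add: has_field_derivative_def mult_commute_abs)
  then show ?thesis by (simp add: has_vector_derivative_def)
qed

lemma op_exp_0 [simp]: "op_exp 0 = id_blinfun"
proof (rule blinfun_eqI)
  fix x :: oct
  have "(\<lambda>n. (1 / fact n) *\<^sub>R (blinfun_apply (0 :: octop) ^^ n) x) = (\<lambda>n. if n = 0 then x else 0)"
  proof
    show "(1 / fact n) *\<^sub>R (blinfun_apply (0 :: octop) ^^ n) x = (if n = 0 then x else 0)" for n
      by (cases n) simp_all
  qed
  then show "op_exp 0 x = id_blinfun x"
    using sums_unique2[OF op_exp_apply_sums[of 0 x]] sums_single[of 0 "\<lambda>_. x"] by simp
qed

section \<open>Solutions of linear equations along a curve\<close>

lemma constant_on_interval:
  fixes f :: "real \<Rightarrow> 'a::banach"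
  assumes "a \<le> b" "finite K" "continuous_on {a..b} f"
    and "\<And>t. t \<in> {a<..<b} - K \<Longrightarrow> (f has_vector_derivative 0) (at t)"
  shows "f b = f a"
proof (rule has_derivative_zero_unique_strong_interval[of "K \<union> {a, b}"])
  fix x assume "x \<in> {a..b} - (K \<union> {a, b})"
  then have "(f has_vector_derivative 0) (at x)" by (intro assms(4)) auto
  then show "(f has_derivative (\<lambda>h. 0)) (at x within {a..b})"
    unfolding has_vector_derivative_def by (auto intro: has_derivative_at_withinI)
qed (use assms in auto)

text \<open>\<open>K\<close> is meant for the finitely many exceptional parameters of a piecewise
  smooth curve; continuity on the closed interval carries conserved quantities across them.\<close>

definition transported :: "real set \<Rightarrow> real \<Rightarrow> real \<Rightarrow> (real \<Rightarrow> octop) \<Rightarrow> (real \<Rightarrow> oct) \<Rightarrow> bool" where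
  "transported K a b A y \<longleftrightarrow> continuous_on {a..b} y \<and>
     (\<forall>t\<in>{a<..<b} - K. (y has_vector_derivative A t (y t)) (at t))"

lemma transported_oinner:
  assumes "a \<le> b" "finite K" and der: "\<And>t. t \<in> {a<..<b} - K \<Longrightarrow> A t \<in> der"
    and y: "transported K a b A y" and z: "transported K a b A z"
  shows "oinner (y b) (z b) = oinner (y a) (z a)"
proof (rule constant_on_interval[OF assms(1,2)])
  show "continuous_on {a..b} (\<lambda>t. oinner (y t) (z t))"
    using y z by (intro oinner.continuous_on) (auto simp: transported_def)
  fix t assume t: "t \<in> {a<..<b} - K"
  have "((\<lambda>t. oinner (y t) (z t)) has_vector_derivative
      (oinner (y t) (A t (z t)) + oinner (A t (y t)) (z t))) (at t)"
    using y z t by (intro oinner.has_vector_derivative) (auto simp: transported_def)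
  then show "((\<lambda>t. oinner (y t) (z t)) has_vector_derivative 0) (at t)"
    by (simp add: der_skew[OF der[OF t]])
qed

lemma transported_omult:
  assumes der: "\<And>t. t \<in> {a<..<b} - K \<Longrightarrow> A t \<in> der"
    and y: "transported K a b A y" and z: "transported K a b A z"
  shows "transported K a b A (\<lambda>t. omult (y t) (z t))"
  unfolding transported_def
proof (intro conjI ballI)
  show "continuous_on {a..b} (\<lambda>t. omult (y t) (z t))"
    using y z by (intro omult.continuous_on) (auto simp: transported_def)
  fix t assume t: "t \<in> {a<..<b} - K"
  have "((\<lambda>t. omult (y t) (z t)) has_vector_derivative
      (omult (y t) (A t (z t)) + omult (A t (y t)) (z t))) (at t)"
    using y z t by (intro omult.has_vector_derivative) (auto simp: transported_def)
  then show "((\<lambda>t. omult (y t) (z t)) has_vector_derivative A t (omult (y t) (z t))) (at t)"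
    by (simp add: der_omult[OF der[OF t]] add.commute)
qed

text \<open>Both conclusions are tested against the vectors \<open>h b z\<close>, which exhaust the
  space as \<open>h b\<close> is bijective. The pairings are constant in time and can be evaluated
  at \<open>a\<close>, where \<open>h\<close> is the identity.\<close>

lemma transport_G2:
  fixes h :: "real \<Rightarrow> octop"
  assumes ab: "a \<le> b" "finite K" and der: "\<And>t. t \<in> {a<..<b} - K \<Longrightarrow> A t \<in> der"
    and h: "\<And>x. transported K a b A (\<lambda>t. h t x)" and ha: "h a = id_blinfun"
  shows "h b \<in> carrier G2"
    and "transported K a b A y \<Longrightarrow> y b = h b (y a)"
proof -
  have iso: "oinner (h b x) (h b y) = oinner x y" for x y
    using transported_oinner[OF ab der h h] by (simp add: ha)
  have lin: "linear (blinfun_apply (h b))"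
    by (rule bounded_linear.linear) (rule blinfun.bounded_linear_right)
  have "inj (blinfun_apply (h b))"
  proof (subst linear_injective_0[OF lin], intro allI impI)
    fix x assume "h b x = 0"
    then have "oinner x y = 0" for y
      using iso[of x y] by (simp add: oinner.zero_left)
    then show "x = 0" by (rule oinner_nondegenerate)
  qed
  then have bij: "bij (blinfun_apply (h b))"
    using linear_injective_imp_surjective[OF lin] by (simp add: bij_def)
  have eqI: "x = x'" if "\<And>z. oinner x (h b z) = oinner x' (h b z)" for x x'
  proof (rule oinner_eqI)
    fix y
    obtain z where "y = h b z" using bij_is_surj[OF bij] by (rule surjE)
    then show "oinner x y = oinner x' y" by (simp add: that)
  qed
  have "h b (omult x y) = omult (h b x) (h b y)" for x y
  proof (rule eqI)
    fix z
    have "oinner (omult (h b x) (h b y)) (h b z) = oinner (omult x y) z"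
      using transported_oinner[OF ab der transported_omult[OF der h[of x] h[of y]] h[of z]]
      by (simp add: ha)
    then show "oinner (h b (omult x y)) (h b z) = oinner (omult (h b x) (h b y)) (h b z)"
      by (simp add: iso)
  qed
  with bij show "h b \<in> carrier G2"
    unfolding G2_carrier_iff by blast
  assume y: "transported K a b A y"
  show "y b = h b (y a)"
  proof (rule eqI)
    fix z
    show "oinner (y b) (h b z) = oinner (h b (y a)) (h b z)"
      using transported_oinner[OF ab der y h] by (simp add: iso ha)
  qed
qed

section \<open>Exponentials of derivations and the Lie algebras of \<open>G2\<close> and its
  parabolic subgroup\<close>

lemma transported_op_exp: "transported {} 0 b (\<lambda>_. A) (\<lambda>t. op_exp (t *\<^sub>R A) x)"
  unfolding transported_def
  by (intro conjI ballI op_exp_scaleR_has_vector_derivative continuous_at_imp_continuous_on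
      has_vector_derivative_continuous[OF op_exp_scaleR_has_vector_derivative])

lemma op_exp_in_G2: "A \<in> der \<Longrightarrow> op_exp A \<in> carrier G2"
  using transport_G2(1)[of 0 1 "{}" "\<lambda>_. A" "\<lambda>t. op_exp (t *\<^sub>R A)"] transported_op_exp by simp

lemma op_exp_unique:
  assumes "A \<in> der" "transported {} 0 1 (\<lambda>_. A) y"
  shows "y 1 = op_exp A (y 0)"
  using transport_G2(2)[of 0 1 "{}" "\<lambda>_. A" "\<lambda>t. op_exp (t *\<^sub>R A)" y] transported_op_exp assms by simp

lemma der_if_op_exp_in_G2:
  assumes G2: "\<And>t::real. op_exp (t *\<^sub>R A) \<in> carrier G2"
  shows "A \<in> der"
  unfolding der_def
proof (intro CollectI allI)
  fix x y
  have d: "((\<lambda>t. op_exp (t *\<^sub>R A) x) has_vector_derivative A x) (at 0)" for x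
    using op_exp_scaleR_has_vector_derivative[of A x 0] by simp
  have "((\<lambda>t. omult (op_exp (t *\<^sub>R A) x) (op_exp (t *\<^sub>R A) y)) has_vector_derivative
      (omult (op_exp (0 *\<^sub>R A) x) (A y) + omult (A x) (op_exp (0 *\<^sub>R A) y))) (at 0)"
    by (intro omult.has_vector_derivative d)
  then have "((\<lambda>t. op_exp (t *\<^sub>R A) (omult x y)) has_vector_derivative (omult x (A y) + omult (A x) y)) (at 0)"
    using G2 by (simp add: G2_apply_omult)
  then show "A (omult x y) = omult (A x) y + omult x (A y)"
    by (rule trans[OF vector_derivative_unique_at[OF d]]) (rule add.commute)
qed

lemma g2_eq_der: "g2 = der"
proof (intro subset_antisym subsetI)
  fix A assume "A \<in> g2"
  then show "A \<in> der" by (intro der_if_op_exp_in_G2) (simp add: lie_algebra_def)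
next
  fix A assume "A \<in> der"
  then show "A \<in> g2"
    unfolding lie_algebra_def by (simp add: op_exp_in_G2 subspace_scale[OF subspace_der])
qed

lemma op_exp_eigenvector:
  assumes "A \<in> der" "A l = r *\<^sub>R l"
  shows "op_exp A l = exp r *\<^sub>R l"
proof -
  have "transported {} 0 1 (\<lambda>_. A) (\<lambda>t. exp (t * r) *\<^sub>R l)"
    unfolding transported_def
  proof (intro conjI ballI)
    show "continuous_on {0..1} (\<lambda>t. exp (t * r) *\<^sub>R l)" by (intro continuous_intros)
    fix t :: real
    have "((\<lambda>t. exp (t * r)) has_vector_derivative exp (t * r) * r) (at t)"
      by (auto intro!: derivative_eq_intros simp flip: has_real_derivative_iff_has_vector_derivative)
    then have "((\<lambda>t. exp (t * r) *\<^sub>R l) has_vector_derivative (exp (t * r) * r) *\<^sub>R l) (at t)"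
      by (rule bounded_linear.has_vector_derivative[OF bounded_linear_scaleR_left])
    then show "((\<lambda>t. exp (t * r) *\<^sub>R l) has_vector_derivative A (exp (t * r) *\<^sub>R l)) (at t)"
      by (simp add: blinfun.scaleR_right assms(2))
  qed
  from op_exp_unique[OF assms(1) this] show ?thesis by simp
qed

lemma par_eq:
  assumes "l \<noteq> 0"
  shows "par l = {A \<in> der. \<exists>r. A l = r *\<^sub>R l}"
proof (intro subset_antisym subsetI)
  fix A assume A: "A \<in> par l"
  then have "A \<in> der"
    by (intro der_if_op_exp_in_G2) (simp add: lie_algebra_def Par_def)
  moreover have "\<exists>r. A l = r *\<^sub>R l"
  proof
    \<comment> \<open>The eigenvalue is only known to exist for each \<open>t\<close> separately;
      this formula for it is differentiable in \<open>t\<close>.\<close>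
    define c where "c t = (op_exp (t *\<^sub>R A) l \<bullet> l) / (l \<bullet> l)" for t
    have eq: "op_exp (t *\<^sub>R A) l = c t *\<^sub>R l" for t
    proof -
      obtain r where "op_exp (t *\<^sub>R A) l = r *\<^sub>R l"
        using A unfolding lie_algebra_def Par_def by blast
      then show ?thesis using assms by (simp add: c_def)
    qed
    have d: "((\<lambda>t. op_exp (t *\<^sub>R A) l) has_vector_derivative A l) (at 0)"
      using op_exp_scaleR_has_vector_derivative[of A l 0] by simp
    have "(c has_vector_derivative (A l \<bullet> l) / (l \<bullet> l)) (at 0)"
      using bounded_linear.has_vector_derivative[OF bounded_linear_divide[of "l \<bullet> l"]
          bounded_linear.has_vector_derivative[OF bounded_linear_inner_left[of l] d]]
      by (simp add: c_def[abs_def])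
    then have "((\<lambda>t. c t *\<^sub>R l) has_vector_derivative ((A l \<bullet> l) / (l \<bullet> l)) *\<^sub>R l) (at 0)"
      by (rule bounded_linear.has_vector_derivative[OF bounded_linear_scaleR_left])
    then show "A l = ((A l \<bullet> l) / (l \<bullet> l)) *\<^sub>R l"
      by (rule vector_derivative_unique_at[OF d[unfolded eq]])
  qed
  ultimately show "A \<in> {A \<in> der. \<exists>r. A l = r *\<^sub>R l}" by blast
next
  fix A assume "A \<in> {A \<in> der. \<exists>r. A l = r *\<^sub>R l}"
  then obtain r where A: "A \<in> der" "A l = r *\<^sub>R l" by blast
  have "op_exp (t *\<^sub>R A) \<in> Par l" for t
  proof -
    have "t *\<^sub>R A \<in> der" using A(1) subspace_scale[OF subspace_der] by blast
    moreover from this have "op_exp (t *\<^sub>R A) l = exp (t * r) *\<^sub>R l"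
      by (rule op_exp_eigenvector) (simp add: blinfun.scaleR_left A(2))
    ultimately show ?thesis
      using op_exp_in_G2 exp_gt_zero[of "t * r"] unfolding Par_def by blast
  qed
  then show "A \<in> par l" by (simp add: lie_algebra_def)
qed

lemma G2_Blinfun:
  assumes "linear f" "\<And>x y. f (omult x y) = omult (f x) (f y)" "\<And>x. f (f' x) = x" "\<And>x. f' (f x) = x"
  shows "blinfun_apply (Blinfun f) = f" "Blinfun f \<in> carrier G2"
proof -
  show "blinfun_apply (Blinfun f) = f"
    using assms(1) by (simp add: bounded_linear_Blinfun_apply linear_conv_bounded_linear)
  moreover have "bij f"
    by (rule o_bij[of f']) (simp_all add: fun_eq_iff assms(3,4))
  ultimately show "Blinfun f \<in> carrier G2"
    unfolding G2_carrier_iff using assms(2) by simp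
qed

section \<open>Some explicit automorphisms\<close>

text \<open>The cofactor matrix. A matrix of determinant 1 acts on the \<open>u\<close> components,
  its cofactor matrix on the dual \<open>v\<close> components. The polynomial formula makes sense
  over the complex numbers as well and is visibly continuous.\<close>

definition cof3 :: "'a::comm_ring_1^3^3 \<Rightarrow> 'a^3^3" where
  "cof3 A = vector [
     vector [A$2$2 * A$3$3 - A$2$3 * A$3$2, A$2$3 * A$3$1 - A$2$1 * A$3$3, A$2$1 * A$3$2 - A$2$2 * A$3$1],
     vector [A$3$2 * A$1$3 - A$3$3 * A$1$2, A$3$3 * A$1$1 - A$3$1 * A$1$3, A$3$1 * A$1$2 - A$3$2 * A$1$1],
     vector [A$1$2 * A$2$3 - A$1$3 * A$2$2, A$1$3 * A$2$1 - A$1$1 * A$2$3, A$1$1 * A$2$2 - A$1$2 * A$2$1]]"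

lemma cof3_transpose_mult: "(\<Sum>k\<in>UNIV. A$k$i * cof3 A$k$j) = (if i = j then det A else 0)"
  using exhaust_3[of i] exhaust_3[of j]
  by (auto simp: cof3_def det_3 sum_3 vector_3 algebra_simps)

lemma cof3_inner: "(A *v u) \<bullet> (cof3 A *v v) = det A * (u \<bullet> v)" for A :: "real^3^3"
  by (simp add: cof3_def det_3 matrix_vector_mult_def inner_vec_def sum_3 vector_3 algebra_simps)

lemma cof3_cross: "cof3 A *v cross3 u v = cross3 (A *v u) (A *v v)" for A :: "real^3^3"
  by (simp add: cof3_def matrix_vector_mult_def cross3_def vec_eq_iff forall_3 sum_3 vector_3 algebra_simps)

lemma cross_cof3: "cross3 (cof3 A *v u) (cof3 A *v v) = det A *\<^sub>R (A *v cross3 u v)" for A :: "real^3^3"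
  by (simp add: cof3_def det_3 matrix_vector_mult_def cross3_def vec_eq_iff forall_3 sum_3 vector_3 algebra_simps)

lemma cof3_mult: "cof3 (A ** B) = cof3 A ** cof3 B"
  by (simp add: cof3_def matrix_matrix_mult_def vec_eq_iff forall_3 sum_3 vector_3 algebra_simps)

lemma cof3_mat_1: "cof3 (mat 1) = mat 1"
  by (simp add: cof3_def mat_def vec_eq_iff forall_3 vector_3)

lemma continuous_on_vector_3 [continuous_intros]:
  assumes "continuous_on S f" "continuous_on S g" "continuous_on S h"
  shows "continuous_on S (\<lambda>x. vector [f x, g x, h x] :: ('a::real_normed_vector)^3)"
proof -
  have "(vector [f x, g x, h x] :: 'a^3) = (\<chi> i. if i = 1 then f x else if i = 2 then g x else h x)" for x
    by (simp add: vec_eq_iff forall_3 vector_3)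
  moreover have "continuous_on S (\<lambda>x. if i = 1 then f x else if i = 2 then g x else h x)" for i :: 3
    using assms by (cases "i = 1"; cases "i = 2"; simp)
  ultimately show ?thesis by (simp add: continuous_on_vec_lambda)
qed

lemma continuous_on_cof3 [continuous_intros]:
  "continuous_on S f \<Longrightarrow> continuous_on S (\<lambda>x. cof3 (f x))" for f :: "_ \<Rightarrow> real^3^3"
  unfolding cof3_def by (intro continuous_intros)

definition sl3_fun :: "real^3^3 \<Rightarrow> oct \<Rightarrow> oct" where
  "sl3_fun A = (\<lambda>(a, u, v, b). (a, A *v u, cof3 A *v v, b))"

definition sl3_op :: "real^3^3 \<Rightarrow> octop" where
  "sl3_op A = Blinfun (sl3_fun A)"

lemma linear_sl3_fun: "linear (sl3_fun A)"
  by (rule linearI) (auto simp: sl3_fun_def matrix_vector_right_distrib scaleR_matrix_vector_assoc matrix_vector_mult_scaleR)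

lemma sl3_op_apply: "sl3_op A (a, u, v, b) = (a, A *v u, cof3 A *v v, b)"
  by (simp add: sl3_op_def bounded_linear_Blinfun_apply linear_sl3_fun linear_conv_bounded_linear[symmetric])
     (simp add: sl3_fun_def)

lemma sl3_op_mult: "sl3_op (A ** B) = sl3_op A o\<^sub>L sl3_op B"
  by (rule blinfun_eqI) (auto simp: sl3_op_apply cof3_mult matrix_vector_mul_assoc)

lemma sl3_op_one: "sl3_op (mat 1) = id_blinfun"
  by (rule blinfun_eqI) (auto simp: sl3_op_apply cof3_mat_1)

lemma sl3_op_G2:
  assumes "det A = 1"
  shows "sl3_op A \<in> carrier G2"
proof -
  have "invertible A" using assms by (simp add: invertible_det_nz)
  then obtain B where B: "A ** B = mat 1" "B ** A = mat 1" unfolding invertible_def by blast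
  have inv: "sl3_fun A (sl3_fun B x) = x" "sl3_fun B (sl3_fun A x) = x" for x
    by (cases x rule: prod_cases4; simp add: sl3_fun_def matrix_vector_mul_assoc B cof3_mat_1 flip: cof3_mult)+
  have "sl3_fun A (omult x y) = omult (sl3_fun A x) (sl3_fun A y)" for x y
  proof (cases x rule: prod_cases4; cases y rule: prod_cases4)
    fix a u v b a' u' v' b'
    assume "x = (a, u, v, b)" "y = (a', u', v', b')"
    then show ?thesis
      using cof3_inner[of A u v'] cof3_inner[of A u' v] cross_cof3[of A v v'] assms
      by (simp add: sl3_fun_def cof3_cross matrix_vector_right_distrib matrix_vector_mult_diff_distrib
          matrix_vector_mult_scaleR inner_commute)
  qed
  from G2_Blinfun(2)[OF linear_sl3_fun this inv] show ?thesis unfolding sl3_op_def .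
qed

text \<open>The exponential of the derivation \<open>(a, u, v, b) \<mapsto> (- n \<bullet> v, (a -
  b) *\<^sub>R n, cross3 n u, n \<bullet> v)\<close>, whose cube is zero; the only quadratic term is
  the multiple \<open>- n \<bullet> v\<close> of \<open>n\<close>.\<close>

definition tau_fun :: "real^3 \<Rightarrow> oct \<Rightarrow> oct" where
  "tau_fun n = (\<lambda>(a, u, v, b). (a - n \<bullet> v, u + (a - b - n \<bullet> v) *\<^sub>R n, v + cross3 n u, b + n \<bullet> v))"

definition tau :: "real^3 \<Rightarrow> octop" where
  "tau n = Blinfun (tau_fun n)"

lemma linear_tau_fun: "linear (tau_fun n)"
  by (rule linearI) (auto simp: tau_fun_def inner_add_right cross_add_right cross_mult_right algebra_simps)

lemma tau_fun_omult: "tau_fun n (omult x y) = omult (tau_fun n x) (tau_fun n y)"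
proof (cases x rule: prod_cases4; cases y rule: prod_cases4)
  fix a u v b a' u' v' b'
  assume xy: "x = (a, u, v, b)" "y = (a', u', v', b')"
  show ?thesis
    unfolding xy tau_fun_def
    apply (simp only: omult.simps prod.case prod.inject cross3_def inner_vec_def vec_eq_iff forall_3 sum_3
      vector_3 vector_add_component vector_minus_component vector_scaleR_component inner_real_def real_scaleR_def)
    apply (intro conjI)
    by algebra+
qed

lemma tau_fun_inverse: "tau_fun n (tau_fun (- n) x) = x"
  by (cases x rule: prod_cases4)
    (simp add: tau_fun_def inner_add_right cross_add_right cross_mult_right cross_minus_left dot_cross_self Cross3.right_diff_distrib
      algebra_simps)

lemma tau_G2: "tau n \<in> carrier G2"
  and tau_apply: "tau n (a, u, v, b) = (a - n \<bullet> v, u + (a - b - n \<bullet> v) *\<^sub>R n, v + cross3 n u, b + n \<bullet> v)"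
  using G2_Blinfun[OF linear_tau_fun tau_fun_omult tau_fun_inverse, of n] tau_fun_inverse[of "- n"]
  by (simp_all add: tau_def) (simp add: tau_fun_def)

definition swap_fun :: "oct \<Rightarrow> oct" where
  "swap_fun = (\<lambda>(a, u, v, b). (b, - v, - u, a))"

definition swap_op :: octop where
  "swap_op = Blinfun swap_fun"

lemma swap_op_G2: "swap_op \<in> carrier G2"
  and swap_op_apply: "swap_op (a, u, v, b) = (b, - v, - u, a)"
proof -
  have lin: "linear swap_fun" by (rule linearI) (auto simp: swap_fun_def)
  have mult: "swap_fun (omult x y) = omult (swap_fun x) (swap_fun y)" for x y
    by (cases x rule: prod_cases4; cases y rule: prod_cases4)
      (simp add: swap_fun_def cross_minus_left cross_minus_right inner_commute algebra_simps)
  have inv: "swap_fun (swap_fun x) = x" for x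
    by (cases x rule: prod_cases4) (simp add: swap_fun_def)
  show "swap_op \<in> carrier G2" "swap_op (a, u, v, b) = (b, - v, - u, a)"
    using G2_Blinfun[OF lin mult inv inv] by (simp_all add: swap_op_def) (simp add: swap_fun_def)
qed

section \<open>Orbits on imaginary split octonions\<close>

definition G2_equiv :: "oct \<Rightarrow> oct \<Rightarrow> bool" where
  "G2_equiv w w' \<longleftrightarrow> (\<exists>g\<in>carrier G2. g w = w')"

lemma G2_equiv_refl: "G2_equiv w w"
  unfolding G2_equiv_def using G2.one_closed by (intro bexI[of _ "id_blinfun"]) simp_all

lemma G2_equiv_apply: "g \<in> carrier G2 \<Longrightarrow> G2_equiv w (g w)"
  unfolding G2_equiv_def by blast

lemma G2_equiv_trans:
  assumes "G2_equiv w w'" "G2_equiv w' w''"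
  shows "G2_equiv w w''"
proof -
  obtain g h where "g \<in> carrier G2" "g w = w'" "h \<in> carrier G2" "h w' = w''"
    using assms unfolding G2_equiv_def by blast
  then show ?thesis
    using G2.m_closed[of h g] G2_equiv_apply[of "h o\<^sub>L g" w] by simp
qed

lemma G2_equiv_step: "g \<in> carrier G2 \<Longrightarrow> G2_equiv (g w) w' \<Longrightarrow> G2_equiv w w'"
  using G2_equiv_trans[OF G2_equiv_apply] .

lemma G2_equiv_sym:
  assumes "G2_equiv w w'"
  shows "G2_equiv w' w"
proof -
  obtain g where g: "g \<in> carrier G2" "g w = w'" using assms unfolding G2_equiv_def by blast
  then have "(inv\<^bsub>G2\<^esub> g) w' = w" using G2_inv_apply(1) by blast
  then show ?thesis unfolding G2_equiv_def using G2.inv_closed[OF g(1)] by blast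
qed

abbreviation e1 :: "real^3" where "e1 \<equiv> axis 1 1"

text \<open>A rotation is its own cofactor matrix, so it moves \<open>u\<close> and the parallel
  vector in the \<open>v\<close> slot to the first axis together. The diagonal matrix
  \<open>S\<close> then normalises the length of the first and scales the second inversely.\<close>

lemma G2_equiv_axis:
  assumes "u \<noteq> 0"
  shows "G2_equiv (0, u, (c / (u \<bullet> u)) *\<^sub>R u, 0) (0, e1, c *\<^sub>R e1, 0)"
proof -
  define r where "r = norm u"
  have r: "r \<noteq> 0" "u \<bullet> u = r * r"
    using assms by (auto simp: r_def power2_norm_eq_inner simp flip: power2_eq_square)
  obtain f :: "real^3 \<Rightarrow> real^3" where f: "orthogonal_transformation f" "det (matrix f) = 1" "f u = r *\<^sub>R e1"
    using rotation_exists[of u "r *\<^sub>R e1"] by (auto simp: r_def)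
  define R where "R = matrix f"
  have Ru: "R *v u = r *\<^sub>R e1"
    using f(1,3) by (simp add: R_def matrix_works orthogonal_transformation_linear)
  have orth: "orthogonal_matrix R" using f(1) by (simp add: R_def orthogonal_transformation_matrix)
  have Rc: "cof3 R *v v = R *v v" for v
  proof -
    have "(R *v x) \<bullet> (cof3 R *v v - R *v v) = 0" for x
    proof -
      have "(R *v x) \<bullet> (R *v v) = x \<bullet> v"
        using f(1) by (simp add: R_def matrix_works orthogonal_transformation_linear orthogonal_transformation_def)
      then show ?thesis using cof3_inner[of R x v] f(2) by (simp add: R_def inner_diff_right)
    qed
    moreover obtain x where "R *v x = cof3 R *v v - R *v v"
    proof -
      have "R *v (transpose R *v y) = y" for y
        using orth by (simp add: matrix_vector_mul_assoc orthogonal_matrix_def del: transpose_matrix_vector)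
      then show thesis using that by blast
    qed
    ultimately have "(cof3 R *v v - R *v v) \<bullet> (cof3 R *v v - R *v v) = 0" by metis
    then show ?thesis by simp
  qed
  define S :: "real^3^3" where
    "S = vector [vector [1 / r, 0, 0], vector [0, r, 0], vector [0, 0, 1]]"
  have S: "det S = 1" "S *v e1 = (1 / r) *\<^sub>R e1" "cof3 S *v e1 = r *\<^sub>R e1"
    using r(1) by (auto simp: S_def cof3_def det_3 vector_3 matrix_vector_mult_def vec_eq_iff forall_3 sum_3 axis_def)
  show ?thesis
  proof (rule G2_equiv_step)
    show "sl3_op R \<in> carrier G2" using f(2) by (simp add: R_def sl3_op_G2)
    show "G2_equiv (sl3_op R (0, u, (c / (u \<bullet> u)) *\<^sub>R u, 0)) (0, e1, c *\<^sub>R e1, 0)"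
    proof (rule G2_equiv_step)
      show "sl3_op S \<in> carrier G2" using S(1) by (rule sl3_op_G2)
      show "G2_equiv (sl3_op S (sl3_op R (0, u, (c / (u \<bullet> u)) *\<^sub>R u, 0))) (0, e1, c *\<^sub>R e1, 0)"
        using r by (simp add: sl3_op_apply Rc Ru matrix_vector_mult_scaleR S G2_equiv_refl)
    qed
  qed
qed

lemma G2_equiv_canonical:
  assumes "w \<in> imag_oct" "w \<noteq> 0"
  shows "G2_equiv w (0, e1, (- oinner w w) *\<^sub>R e1, 0)"
proof -
  \<comment> \<open>Swapping makes the \<open>v\<close> slot nonzero if \<open>u\<close> is; for a
    vector that is purely diagonal, \<open>tau e1\<close> first creates a nonzero
    \<open>u\<close>.\<close>
  have 1: "\<exists>a u v. v \<noteq> 0 \<and> G2_equiv w (a, u, v, - a)"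
  proof -
    obtain a u v b where "w = (a, u, v, b)" "a + b = 0"
      using assms(1) unfolding imag_oct_def by blast
    then have w: "w = (a, u, v, - a)" by simp
    consider "v \<noteq> 0" | "v = 0" "u \<noteq> 0" | "v = 0" "u = 0" "a \<noteq> 0"
      using assms(2) by (force simp: w zero_prod_def)
    then show ?thesis
    proof cases
      case 1
      then show ?thesis using G2_equiv_refl w by blast
    next
      case 2
      have "G2_equiv w (- a, - v, - u, - (- a))"
        by (rule G2_equiv_step[OF swap_op_G2]) (simp add: w swap_op_apply G2_equiv_refl)
      moreover have "- u \<noteq> 0" using 2 by simp
      ultimately show ?thesis by blast
    next
      case 3
      have "G2_equiv w (- a, 0, (- 2 * a) *\<^sub>R e1, - (- a))"
        by (rule G2_equiv_step[OF tau_G2[of e1]], rule G2_equiv_step[OF swap_op_G2])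
          (simp add: w 3 tau_apply swap_op_apply G2_equiv_refl)
      moreover have "(- 2 * a) *\<^sub>R e1 \<noteq> 0" using 3 by (simp add: axis_eq_0_iff)
      ultimately show ?thesis by blast
    qed
  qed
  have 2: "\<exists>u v. u \<noteq> 0 \<and> G2_equiv w (0, u, v, 0)"
  proof -
    obtain a u v where v: "v \<noteq> 0" and eq: "G2_equiv w (a, u, v, - a)" using 1 by blast
    \<comment> \<open>Chosen with \<open>n \<bullet> v = a\<close>, so that \<open>tau n\<close>
      clears both diagonal entries.\<close>
    define n where "n = (a / (v \<bullet> v)) *\<^sub>R v"
    have "n \<bullet> v = a" using v by (simp add: n_def)
    then have "tau n (a, u, v, - a) = (0, u + a *\<^sub>R n, v + cross3 n u, 0)"
      by (simp add: tau_apply)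
    then have eq': "G2_equiv w (0, u + a *\<^sub>R n, v + cross3 n u, 0)"
      using G2_equiv_trans[OF eq G2_equiv_apply[OF tau_G2[of n]]] by simp
    show ?thesis
    proof (cases "u + a *\<^sub>R n = 0")
      case True
      have "v + cross3 n u \<noteq> 0"
      proof
        assume "v + cross3 n u = 0"
        with eq' True obtain g where g: "g \<in> carrier G2" "g w = 0"
          unfolding G2_equiv_def zero_prod_def by metis
        then show False using G2_inv_apply(1)[OF g(1), of w] assms(2) by (simp add: blinfun.zero_right)
      qed
      moreover have "G2_equiv w (0, - (v + cross3 n u), 0, 0)"
        by (rule G2_equiv_trans[OF eq'], rule G2_equiv_step[OF swap_op_G2])
          (unfold True, simp add: swap_op_apply G2_equiv_refl)
      moreover from calculation have "- (v + cross3 n u) \<noteq> 0" by (metis neg_equal_0_iff_equal)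
      ultimately show ?thesis by blast
    qed (use eq' in blast)
  qed
  then obtain u v where u: "u \<noteq> 0" and eq: "G2_equiv w (0, u, v, 0)" by blast
  \<comment> \<open>As \<open>n\<close> is orthogonal to \<open>v\<close>, \<open>tau n\<close>
    keeps the diagonal zero and fixes \<open>u\<close>; the added term \<open>cross3 n u\<close>
    cancels the part of \<open>v\<close> orthogonal to \<open>u\<close>.\<close>
  define n where "n = (1 / (u \<bullet> u)) *\<^sub>R cross3 v u"
  have "n \<bullet> v = 0" by (simp add: n_def dot_cross_self)
  moreover have "v + cross3 n u = ((u \<bullet> v) / (u \<bullet> u)) *\<^sub>R u"
  proof -
    have "cross3 (cross3 v u) u = (u \<bullet> v) *\<^sub>R u - (u \<bullet> u) *\<^sub>R v"
      by (simp add: cross3_def inner_vec_def vec_eq_iff forall_3 sum_3 vector_3 algebra_simps)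
    then show ?thesis using u
      by (simp add: n_def cross_mult_left scaleR_diff_right)
  qed
  ultimately have "tau n (0, u, v, 0) = (0, u, ((u \<bullet> v) / (u \<bullet> u)) *\<^sub>R u, 0)"
    by (simp add: tau_apply)
  then have "G2_equiv (0, u, v, 0) (0, e1, (u \<bullet> v) *\<^sub>R e1, 0)"
    using G2_equiv_trans[OF G2_equiv_apply[OF tau_G2[of n], of "(0, u, v, 0)"]] G2_equiv_axis[OF u] by simp
  with eq have *: "G2_equiv w (0, e1, (u \<bullet> v) *\<^sub>R e1, 0)" by (rule G2_equiv_trans)
  moreover have "u \<bullet> v = - oinner w w"
  proof -
    obtain g where g: "g \<in> carrier G2" "g w = (0, e1, (u \<bullet> v) *\<^sub>R e1, 0)"
      using * unfolding G2_equiv_def by blast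
    have "oinner (g w) (g w) = - (u \<bullet> v)" unfolding g(2) by (simp add: inner_axis_axis)
    then show ?thesis using G2_oinner[OF g(1), of w w] by simp
  qed
  ultimately show ?thesis by simp
qed

lemma G2_equiv_iff:
  assumes "w \<in> imag_oct" "w \<noteq> 0" "w' \<in> imag_oct" "w' \<noteq> 0" "oinner w w = oinner w' w'"
  shows "G2_equiv w w'"
  using G2_equiv_trans[OF G2_equiv_canonical[OF assms(1,2)]
      G2_equiv_sym[OF G2_equiv_canonical[OF assms(3,4)], folded assms(5)]] .

section \<open>Stabilisers\<close>

abbreviation stab :: "oct \<Rightarrow> octop set" where
  "stab w \<equiv> stabilizer G2 blinfun_apply w"

lemma stab_iff: "g \<in> stab w \<longleftrightarrow> g \<in> carrier G2 \<and> g w = w"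
  by (simp add: stabilizer_def)

lemma subgroup_stab: "subgroup (stab w) G2"
proof (rule G2.subgroupI)
  show "stab w \<noteq> {}"
    using G2.one_closed stab_iff[of id_blinfun w] by auto
  show "inv\<^bsub>G2\<^esub> g \<in> stab w" if "g \<in> stab w" for g
    using that G2_inv_apply(1)[of g w] by (simp add: stab_iff)
  show "g \<otimes>\<^bsub>G2\<^esub> h \<in> stab w" if "g \<in> stab w" "h \<in> stab w" for g h
    using that G2.m_closed[of g h] by (simp add: stab_iff)
qed (auto simp: stab_iff)

lemma stab_scaleR: "c \<noteq> 0 \<Longrightarrow> stab (c *\<^sub>R w) = stab w"
  by (auto simp: stab_iff blinfun.scaleR_right)

lemma conjugate_into_stab:
  assumes "S \<subseteq> stab w" "G2_equiv w w'"
  shows "conjugate_into S (stab w')"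
proof -
  obtain g where g: "g \<in> carrier G2" "g w = w'" using assms(2) unfolding G2_equiv_def by blast
  have "g o\<^sub>L x o\<^sub>L inv\<^bsub>G2\<^esub> g \<in> stab w'" if "x \<in> S" for x
  proof -
    have x: "x \<in> carrier G2" "x w = w" using that assms(1) by (auto simp: stab_iff)
    have "g o\<^sub>L x o\<^sub>L inv\<^bsub>G2\<^esub> g \<in> carrier G2"
      using G2.m_closed[OF G2.m_closed[OF g(1) x(1)] G2.inv_closed[OF g(1)]] by simp
    moreover have "(g o\<^sub>L x o\<^sub>L inv\<^bsub>G2\<^esub> g) w' = w'"
      using x(2) G2_inv_apply(1)[OF g(1), of w] by (simp flip: g(2))
    ultimately show ?thesis by (simp add: stab_iff)
  qed
  then show ?thesis unfolding conjugate_into_def using g(1) by blast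
qed

lemma reduces_to_stab:
  assumes "S \<subseteq> stab w" "G2_equiv w w'" "lie_group_iso (G2\<lparr>carrier := stab w'\<rparr>) K"
  shows "reduces_to S K"
  using conjugate_into_stab[OF assms(1,2)] assms(3) subgroup_stab unfolding reduces_to_def by blast

lemma lie_group_isoI:
  fixes F :: "('a::{semiring_1,topological_space})^'n^'n \<Rightarrow> octop"
    and f :: "octop \<Rightarrow> 'a^'n^'n"
  assumes F: "\<And>A. A \<in> K \<Longrightarrow> F A \<in> H" and f: "\<And>g. g \<in> H \<Longrightarrow> f g \<in> K"
    and fF: "\<And>A. A \<in> K \<Longrightarrow> f (F A) = A" and Ff: "\<And>g. g \<in> H \<Longrightarrow> F (f g) = g"
    and mult: "\<And>A B. A \<in> K \<Longrightarrow> B \<in> K \<Longrightarrow> A ** B \<in> K \<and> F (A ** B) = F A o\<^sub>L F B"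
    and "continuous_on H f" "continuous_on K F"
  shows "lie_group_iso (G2\<lparr>carrier := H\<rparr>) (matrix_monoid K)"
  unfolding lie_group_iso_def
proof (intro exI conjI)
  have "f (g o\<^sub>L h) = f g ** f h" if "g \<in> H" "h \<in> H" for g h
    using mult[OF f[OF that(1)] f[OF that(2)]] fF Ff that by metis
  moreover have "bij_betw f H K"
    by (rule bij_betw_byWitness[where f' = F]) (use F f fF Ff in auto)
  ultimately show "f \<in> iso (G2\<lparr>carrier := H\<rparr>) (matrix_monoid K)"
    by (auto simp: iso_def hom_def matrix_monoid_def f)
  show "homeomorphism (carrier (G2\<lparr>carrier := H\<rparr>)) (carrier (matrix_monoid K)) f F"
  proof -
    have "f ` H = K" "F ` K = H" using F f fF Ff by force+
    then show ?thesis using assms by (simp add: homeomorphism_def matrix_monoid_def)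
  qed
qed

section \<open>The stabiliser of a timelike vector\<close>

definition w_time :: oct where "w_time = (1, 0, 0, - 1)"

lemma continuous_on_sl3_op: "continuous_on S sl3_op"
proof (rule continuous_on_blinfun_componentwise)
  fix x :: oct
  obtain a u v b where x: "x = (a, u, v, b)" by (rule prod_cases4)
  show "continuous_on S (\<lambda>A. sl3_op A x)"
    unfolding x sl3_op_apply matrix_vector_mult_def
    by (intro continuous_intros)
qed

definition upper_matrix :: "octop \<Rightarrow> real^3^3" where
  "upper_matrix g = (\<chi> i j. fst (snd (g (0, axis j 1, 0, 0))) $ i)"

lemma upper_matrix_sl3_op: "upper_matrix (sl3_op A) = A"
  by (simp add: upper_matrix_def sl3_op_apply vec_eq_iff matrix_vector_mul_component inner_axis)

lemma continuous_on_upper_matrix: "continuous_on S upper_matrix"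
proof -
  have "continuous_on S (\<lambda>g. blinfun_apply g (0, axis j 1, 0, 0))" for j :: 3
    by (intro continuous_intros)
  then show ?thesis
    unfolding upper_matrix_def by (intro continuous_intros)
qed

lemma stab_w_time:
  assumes g: "g \<in> stab w_time"
  shows "det (upper_matrix g) = 1" "sl3_op (upper_matrix g) = g"
proof -
  note g2 = g[unfolded stab_iff, THEN conjunct1]
  note mult = G2_apply_omult[OF g2]
  define p q :: oct where "p = (1, 0, 0, 0)" and "q = (0, 0, 0, 1)"
  have p: "p = (1/2) *\<^sub>R (oone + w_time)" and q: "q = (1/2) *\<^sub>R (oone - w_time)"
    by (simp_all add: p_def q_def oone_def w_time_def)
  have gp: "g p = p" and gq: "g q = q"
    using g by (simp_all add: p q blinfun.scaleR_right blinfun.add_right blinfun.diff_right G2_apply_oone[OF g2] stab_iff)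
  define A where "A u = fst (snd (g (0, u, 0, 0)))" for u
  define B where "B v = fst (snd (snd (g (0, 0, v, 0))))" for v
  \<comment> \<open>The \<open>u\<close> components form the Peirce space of all \<open>x\<close>
    with \<open>omult p x = x\<close> and \<open>omult x p = 0\<close>, which \<open>g\<close>
    preserves together with \<open>p\<close>; similarly for \<open>v\<close> below.\<close>
  have gA: "g (0, u, 0, 0) = (0, A u, 0, 0)" for u
  proof -
    obtain a u' v' b where e: "g (0, u, 0, 0) = (a, u', v', b)" by (rule prod_cases4)
    have "omult p (0, u, 0, 0) = (0, u, 0, 0)" "omult (0, u, 0, 0) p = 0"
      by (simp_all add: p_def zero_prod_def)
    then have "omult p (a, u', v', b) = (a, u', v', b)" "omult (a, u', v', b) p = 0"
      using mult[of p "(0, u, 0, 0)"] mult[of "(0, u, 0, 0)" p] by (simp_all add: gp e blinfun.zero_right)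
    then show ?thesis by (simp add: p_def zero_prod_def A_def e)
  qed
  have gB: "g (0, 0, v, 0) = (0, 0, B v, 0)" for v
  proof -
    obtain a u' v' b where e: "g (0, 0, v, 0) = (a, u', v', b)" by (rule prod_cases4)
    have "omult (0, 0, v, 0) p = (0, 0, v, 0)" "omult p (0, 0, v, 0) = 0"
      by (simp_all add: p_def zero_prod_def)
    then have "omult (a, u', v', b) p = (a, u', v', b)" "omult p (a, u', v', b) = 0"
      using mult[of p "(0, 0, v, 0)"] mult[of "(0, 0, v, 0)" p] by (simp_all add: gp e blinfun.zero_right)
    then show ?thesis by (simp add: p_def zero_prod_def B_def e)
  qed
  define U where "U = upper_matrix g"
  have "linear A"
    unfolding A_def
  proof (rule linearI)
    fix x y :: "real^3" and c :: real
    have "(0, x + y, 0, 0) = (0, x, 0, 0) + ((0, y, 0, 0) :: oct)" "(0, c *\<^sub>R x, 0, 0) = c *\<^sub>R ((0, x, 0, 0) :: oct)"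
      by simp_all
    then show "fst (snd (g (0, x + y, 0, 0))) = fst (snd (g (0, x, 0, 0))) + fst (snd (g (0, y, 0, 0)))"
      "fst (snd (g (0, c *\<^sub>R x, 0, 0))) = c *\<^sub>R fst (snd (g (0, x, 0, 0)))"
      by (simp_all only: blinfun.add_right blinfun.scaleR_right fst_add snd_add fst_scaleR snd_scaleR)
  qed
  moreover have "U = matrix A"
    by (simp add: U_def upper_matrix_def A_def matrix_def)
  ultimately have AU: "A u = U *v u" for u by (simp add: matrix_works)
  have AB: "A u \<bullet> B v = u \<bullet> v" for u v
    using mult[of "(0, u, 0, 0)" "(0, 0, v, 0)"] arg_cong[OF gp, of "\<lambda>x. (u \<bullet> v) *\<^sub>R x"]
    by (simp add: gA gB p_def flip: blinfun.scaleR_right)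
  have BA: "B (cross3 u u') = cross3 (A u) (A u')" for u u'
    using mult[of "(0, u, 0, 0)" "(0, u', 0, 0)"] by (simp add: gA gB)
  \<comment> \<open>\<open>B\<close> is dual to \<open>A\<close> and also carries
    \<open>cross3\<close> of two vectors to \<open>cross3\<close> of their images, so
    \<open>A\<close> preserves the triple product.\<close>
  have "det U *\<^sub>R (u \<bullet> cross3 u' u'') = u \<bullet> cross3 u' u''" for u u' u''
  proof -
    have "(U *v u) \<bullet> (cof3 U *v cross3 u' u'') = u \<bullet> cross3 u' u''"
      by (metis AB AU BA cof3_cross)
    then show ?thesis by (simp add: cof3_inner)
  qed
  from this[of e1 "axis 2 1" "axis 3 1"] have "det U * (e1 \<bullet> cross3 (axis 2 1) (axis 3 1)) = e1 \<bullet> cross3 (axis 2 1) (axis 3 1)"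
    by simp
  moreover have "e1 \<bullet> cross3 (axis 2 1) (axis 3 1) = 1"
    by (simp add: cross3_def axis_def inner_vec_def sum_3 vector_3)
  ultimately have "det U = 1" by simp
  then show det: "det (upper_matrix g) = 1" by (simp only: U_def)
  have BU: "B v = cof3 U *v v" for v
  proof -
    have "invertible U" using det by (simp add: U_def invertible_det_nz)
    then obtain V where V: "U ** V = mat 1" unfolding invertible_def by blast
    have "x \<bullet> B v = x \<bullet> (cof3 U *v v)" for x
    proof -
      have x: "U *v (V *v x) = x" by (simp add: matrix_vector_mul_assoc V)
      have "x \<bullet> B v = (V *v x) \<bullet> v" using AB[of "V *v x" v] by (simp only: AU x)
      moreover have "x \<bullet> (cof3 U *v v) = (V *v x) \<bullet> v"
        using cof3_inner[of U "V *v x" v] det[folded U_def] by (simp add: x)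
      ultimately show ?thesis by simp
    qed
    then show ?thesis using vector_eq_ldot by blast
  qed
  show "sl3_op (upper_matrix g) = g"
  proof (rule blinfun_eqI)
    fix x :: oct
    obtain a u v b where x: "x = (a, u, v, b)" by (rule prod_cases4)
    have "x = a *\<^sub>R p + (0, u, 0, 0) + (0, 0, v, 0) + b *\<^sub>R q" by (simp add: x p_def q_def)
    then have "g x = a *\<^sub>R p + (0, A u, 0, 0) + (0, 0, B v, 0) + b *\<^sub>R q"
      by (simp only: blinfun.add_right blinfun.scaleR_right gp gq gA gB)
    then show "sl3_op (upper_matrix g) x = g x"
      by (simp add: x sl3_op_apply p_def q_def AU BU flip: U_def)
  qed
qed

lemma lie_group_iso_stab_w_time: "lie_group_iso (G2\<lparr>carrier := stab w_time\<rparr>) (SL :: (real^3^3) monoid)"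
  unfolding SL_def
proof (rule lie_group_isoI[where F = sl3_op and f = upper_matrix])
  show "sl3_op A \<in> stab w_time" if "A \<in> {A. det A = 1}" for A
    using that by (simp add: stab_iff sl3_op_G2 w_time_def sl3_op_apply)
  show "A ** B \<in> {A. det A = 1} \<and> sl3_op (A ** B) = sl3_op A o\<^sub>L sl3_op B"
    if "A \<in> {A. det A = 1}" "B \<in> {A. det A = 1}" for A B
    using that by (simp add: det_mul sl3_op_mult)
qed (simp_all add: upper_matrix_sl3_op stab_w_time continuous_on_sl3_op continuous_on_upper_matrix)

section \<open>The stabiliser of a spacelike vector\<close>

text \<open>Left multiplication by \<open>w_space\<close> is a complex structure; \<open>psi\<close> identifies the split octonions
  with \<open>\<complex> \<oplus> \<complex>\<^sup>3\<close>, where \<open>\<complex>\<close> is spanned by the unit and \<open>w_space\<close>.\<close>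

definition w_space :: oct where "w_space = (0, e1, - e1, 0)"

definition psi :: "complex \<Rightarrow> complex^3 \<Rightarrow> oct" where
  "psi z x = (Re z + Re (x$3),
     vector [Im z - Im (x$3), Re (x$1) + Re (x$2), Im (x$2) - Im (x$1)],
     vector [- Im z - Im (x$3), Re (x$2) - Re (x$1), Im (x$1) + Im (x$2)],
     Re z - Re (x$3))"

definition phi0 :: "oct \<Rightarrow> complex" where
  "phi0 = (\<lambda>(a, u, v, b). Complex ((a + b) / 2) ((u$1 - v$1) / 2))"

definition phi :: "oct \<Rightarrow> complex^3" where
  "phi = (\<lambda>(a, u, v, b). vector [Complex ((u$2 - v$2) / 2) ((v$3 - u$3) / 2),
     Complex ((u$2 + v$2) / 2) ((u$3 + v$3) / 2), Complex ((a - b) / 2) (- (u$1 + v$1) / 2)])"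

lemma psi_phi: "psi (phi0 y) (phi y) = y"
  by (cases y rule: prod_cases4)
    (simp add: psi_def phi0_def phi_def vec_eq_iff forall_3 vector_3 field_simps)

lemma phi_psi [simp]: "phi0 (psi z x) = z" "phi (psi z x) = x"
  by (simp_all add: psi_def phi0_def phi_def vec_eq_iff forall_3 vector_3 complex_eq_iff field_simps)

lemma psi_inject: "psi z x = psi z' x' \<longleftrightarrow> z = z' \<and> x = x'"
  by (metis phi_psi)

lemma psi_add: "psi (z + z') (x + x') = psi z x + psi z' x'"
  by (simp add: psi_def vec_eq_iff forall_3 vector_3)

lemma psi_scaleR: "psi (c *\<^sub>R z) (c *\<^sub>R x) = c *\<^sub>R psi z x"
  by (simp add: psi_def vec_eq_iff forall_3 vector_3 algebra_simps)

text \<open>In this form \<open>phi0\<close> is visibly invariant under automorphisms fixing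
  \<open>w_space\<close>.\<close>

lemma phi0_eq: "phi0 y = Complex (oinner y oone) (oinner y w_space)"
  by (cases y rule: prod_cases4)
    (simp add: phi0_def oone_def w_space_def inner_axis inner_axis' complex_eq_iff)

lemma linear_phi: "linear phi"
  by (rule linearI)
    (auto simp: phi_def vec_eq_iff forall_3 vector_3 complex_eq_iff field_simps)

lemma linear_phi0: "linear phi0"
  by (rule linearI) (auto simp: phi0_def complex_eq_iff field_simps)

lemma psi_scalar: "psi z 0 = Re z *\<^sub>R oone + Im z *\<^sub>R w_space"
  by (simp add: psi_def oone_def w_space_def vec_eq_iff forall_3 vector_3 axis_def)

section \<open>The octonion product in complex coordinates\<close>

definition herm :: "complex^3 \<Rightarrow> complex^3 \<Rightarrow> complex" where
  "herm x y = x$1 * cnj (y$1) - x$2 * cnj (y$2) - x$3 * cnj (y$3)"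

text \<open>The Hermitian cross product: \<open>herm z (ccross x y)\<close> is minus the determinant
  of \<open>z\<close>, \<open>x\<close>, \<open>y\<close>. This links it to special unitary
  matrices.\<close>

definition ccross :: "complex^3 \<Rightarrow> complex^3 \<Rightarrow> complex^3" where
  "ccross x y = vector [- cnj (x$2 * y$3 - x$3 * y$2), cnj (x$3 * y$1 - x$1 * y$3), cnj (x$1 * y$2 - x$2 * y$1)]"

lemma herm_zero [simp]: "herm 0 x = 0" "herm x 0 = 0"
  by (simp_all add: herm_def)

lemma ccross_zero [simp]: "ccross 0 x = 0" "ccross x 0 = 0"
  by (simp_all add: ccross_def vec_eq_iff forall_3 vector_3)

text \<open>The product of two vectors has scalar part \<open>- herm x x'\<close> and vector part
  \<open>ccross x x'\<close>; an automorphism fixing \<open>w_space\<close> respects the two parts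
  separately.\<close>

lemma omult_psi:
  "omult (psi z x) (psi z' x') = psi (z * z' - herm x x') (z *s x' + cnj z' *s x + ccross x x')"
  unfolding psi_def herm_def ccross_def
  apply (simp only: omult.simps prod.inject cross3_def inner_vec_def vec_eq_iff forall_3 sum_3 vector_3
      vector_add_component vector_minus_component vector_scaleR_component inner_real_def real_scaleR_def
      vector_smult_component plus_complex.simps minus_complex.simps times_complex.simps uminus_complex.simps
      complex_cnj)
  apply (simp add: algebra_simps)
  done

definition su_fun :: "complex^3^3 \<Rightarrow> oct \<Rightarrow> oct" where
  "su_fun A y = psi (phi0 y) (A *v phi y)"

definition su_op :: "complex^3^3 \<Rightarrow> octop" where
  "su_op A = Blinfun (su_fun A)"

lemma matrix_vector_mult_scaleR_complex: "A *v (c *\<^sub>R x) = c *\<^sub>R (A *v x)" for A :: "complex^3^3"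
  by (simp add: vec_eq_iff matrix_vector_mult_def scaleR_sum_right)

lemma matrix_vector_mult_axis: "A *v axis j 1 = column j A" for A :: "complex^3^3"
  using exhaust_3[of j] by (auto simp: vec_eq_iff matrix_vector_mult_def column_def axis_def sum_3)

lemma linear_su_fun: "linear (su_fun A)"
  unfolding su_fun_def
  by (rule linearI)
    (simp_all add: linear_add[OF linear_phi] linear_add[OF linear_phi0] linear_scale[OF linear_phi]
      linear_scale[OF linear_phi0] matrix_vector_right_distrib psi_add matrix_vector_mult_scaleR_complex psi_scaleR)

lemma su_op_apply: "su_op A (psi z x) = psi z (A *v x)"
  using linear_su_fun[of A] by (simp add: su_op_def bounded_linear_Blinfun_apply linear_conv_bounded_linear su_fun_def)

lemma octop_eq_psiI:
  assumes "\<And>z x. blinfun_apply g (psi z x) = blinfun_apply h (psi z x)"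
  shows "g = h"
proof (rule blinfun_eqI)
  show "blinfun_apply g y = blinfun_apply h y" for y
    using assms[of "phi0 y" "phi y"] by (simp add: psi_phi)
qed

lemma su_op_mult: "su_op (A ** B) = su_op A o\<^sub>L su_op B"
  by (rule octop_eq_psiI) (simp add: su_op_apply matrix_vector_mul_assoc)

definition signJ :: "complex^3^3" where
  "signJ = (\<chi> i j. if i = j then if i = 1 then 1 else - 1 else 0)"

definition su12 :: "(complex^3^3) set" where
  "su12 = {A. (\<chi> i j. cnj (A $ j $ i)) ** signJ ** A = signJ \<and> det A = 1}"

lemma SU12_eq: "SU12 = matrix_monoid su12"
  by (simp add: SU12_def su12_def signJ_def Let_def)

lemma su12_herm:
  "(\<chi> i j. cnj (A $ j $ i)) ** signJ ** A = signJ \<longleftrightarrow> (\<forall>i j. herm (column j A) (column i A) = signJ $ i $ j)"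
proof -
  have "((\<chi> i j. cnj (A $ j $ i)) ** signJ ** A) $ i $ j = herm (column j A) (column i A)" for i j
    by (simp add: matrix_matrix_mult_def signJ_def herm_def column_def sum_3)
  then show ?thesis by (simp add: vec_eq_iff)
qed

lemma herm_mult:
  assumes "A \<in> su12"
  shows "herm (A *v x) (A *v y) = herm x y"
proof -
  have "herm (A *v x) (A *v y) = (\<Sum>i\<in>UNIV. \<Sum>j\<in>UNIV. x$j * cnj (y$i) * herm (column j A) (column i A))"
    by (simp add: matrix_vector_mult_def herm_def column_def sum_3 algebra_simps)
  also have "\<dots> = herm x y"
  proof -
    have "herm (column j A) (column i A) = signJ $ i $ j" for i j
      using assms unfolding su12_def su12_herm by blast
    then show ?thesis by (simp only:) (simp add: signJ_def herm_def sum_3)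
  qed
  finally show ?thesis .
qed

text \<open>Two inverses of \<open>transpose A\<close> are compared: the cofactor matrix, because
  the determinant is 1, and the conjugate with the signs of \<open>signJ\<close>, because the
  columns are orthonormal for \<open>herm\<close>.\<close>

lemma cof3_su12:
  assumes "A \<in> su12"
  shows "cof3 A $ i $ j = signJ $ i $ i * signJ $ j $ j * cnj (A $ i $ j)"
proof -
  define B :: "complex^3^3" where "B = (\<chi> i j. signJ $ i $ i * signJ $ j $ j * cnj (A $ i $ j))"
  have h: "herm (column j A) (column i A) = signJ $ i $ j" for i j
    using assms unfolding su12_def su12_herm by blast
  have "(\<Sum>k\<in>UNIV. A $ k $ i * (signJ $ k $ k * signJ $ j $ j * cnj (A $ k $ j))) =
      signJ $ j $ j * herm (column i A) (column j A)" for i j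
    by (simp add: sum_3 herm_def column_def signJ_def algebra_simps)
  then have "transpose A ** B = mat 1"
    unfolding h by (simp add: matrix_matrix_mult_def transpose_def B_def mat_def vec_eq_iff signJ_def)
  moreover have C: "transpose A ** cof3 A = mat 1"
    using assms by (simp add: matrix_matrix_mult_def transpose_def vec_eq_iff cof3_transpose_mult mat_def su12_def)
  moreover have "cof3 A ** transpose A = mat 1" using C matrix_left_right_inverse by blast
  ultimately have "cof3 A = B" by (metis matrix_mul_assoc matrix_mul_lid matrix_mul_rid)
  then show ?thesis by (simp add: B_def)
qed

text \<open>Up to conjugation and signs \<open>ccross\<close> is the usual cross product, which
  transforms by the cofactor matrix; \<open>cof3_su12\<close> turns the cofactors back into entries
  of \<open>A\<close>.\<close>

lemma ccross_mult:
  assumes "A \<in> su12"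
  shows "ccross (A *v x) (A *v y) = A *v ccross x y"
proof -
  define d where "d = (vector [x$2 * y$3 - x$3 * y$2, x$3 * y$1 - x$1 * y$3, x$1 * y$2 - x$2 * y$1] :: complex^3)"
  have 1: "ccross x y = (\<chi> i. - signJ $ i $ i * cnj (d $ i))"
    by (simp add: ccross_def d_def vec_eq_iff forall_3 vector_3 signJ_def)
  have 2: "ccross (A *v x) (A *v y) = (\<chi> i. - signJ $ i $ i * cnj ((cof3 A *v d) $ i))"
    by (simp add: ccross_def d_def vec_eq_iff forall_3 vector_3 signJ_def matrix_vector_mult_def sum_3 cof3_def
        algebra_simps)
  show ?thesis
    unfolding 1 2
    by (simp add: matrix_vector_mult_def cof3_su12[OF assms] vec_eq_iff forall_3 sum_3 signJ_def algebra_simps)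
qed

lemma su_op_in_stab:
  assumes "A \<in> su12"
  shows "su_op A \<in> stab w_space"
proof -
  have "invertible A" using assms by (simp add: invertible_det_nz su12_def)
  then obtain B where B: "A ** B = mat 1" "B ** A = mat 1" unfolding invertible_def by blast
  have inv: "su_fun A (su_fun B x) = x" "su_fun B (su_fun A x) = x" for x
    by (simp_all add: su_fun_def matrix_vector_mul_assoc B psi_phi)
  have "su_fun A (omult x y) = omult (su_fun A x) (su_fun A y)" for x y
  proof -
    obtain z p z' p' where "x = psi z p" "y = psi z' p'"
      using that[OF psi_phi[symmetric] psi_phi[symmetric]] .
    then show ?thesis
      by (simp add: su_fun_def omult_psi herm_mult[OF assms] ccross_mult[OF assms] matrix_vector_right_distrib
          vector_scalar_commute)
  qed
  from G2_Blinfun(2)[OF linear_su_fun this inv] have "su_op A \<in> carrier G2" unfolding su_op_def .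
  moreover have "su_op A w_space = w_space"
    using su_op_apply[of A \<i> 0] psi_scalar[of \<i>] by simp
  ultimately show ?thesis by (simp add: stab_iff)
qed

definition su_matrix :: "octop \<Rightarrow> complex^3^3" where
  "su_matrix g = (\<chi> i j. phi (g (psi 0 (axis j 1))) $ i)"

lemma stab_w_space:
  assumes g: "g \<in> stab w_space"
  shows "su_matrix g \<in> su12" "su_op (su_matrix g) = g"
proof -
  note g2 = g[unfolded stab_iff, THEN conjunct1]
  define A where "A = su_matrix g"
  define G where "G x = phi (g (psi 0 x))" for x
  have g0: "g (psi z 0) = psi z 0" for z
    using g by (simp add: psi_scalar blinfun.add_right blinfun.scaleR_right G2_apply_oone[OF g2] stab_iff)
  have gG: "g (psi 0 x) = psi 0 (G x)" for x
  proof -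
    have "oinner (g y) oone = oinner y oone" "oinner (g y) w_space = oinner y w_space" for y
      using G2_oinner[OF g2, of y oone] G2_oinner[OF g2, of y w_space] g
      by (simp_all add: G2_apply_oone[OF g2] stab_iff)
    then have "phi0 (g (psi 0 x)) = phi0 (psi 0 x)" unfolding phi0_eq by simp
    then show ?thesis using psi_phi[of "g (psi 0 x)"] by (simp add: G_def)
  qed
  \<comment> \<open>Complex scalars act as left multiplication by \<open>psi z 0\<close>, and these
    elements are fixed by \<open>g\<close>; so \<open>G\<close> is complex linear.\<close>
  have mult: "G (z *s x) = z *s G x" for z x
  proof -
    have "psi 0 (z *s x) = omult (psi z 0) (psi 0 x)"
      by (simp add: omult_psi)
    moreover have "omult (psi z 0) (psi 0 (G x)) = psi 0 (z *s G x)"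
      by (simp add: omult_psi)
    ultimately have "g (psi 0 (z *s x)) = psi 0 (z *s G x)"
      by (simp add: G2_apply_omult[OF g2] g0 gG)
    then show ?thesis by (simp add: gG psi_inject)
  qed
  have add: "G (x + y) = G x + G y" for x y
  proof -
    have "psi 0 (x + y) = psi 0 x + psi 0 y" using psi_add[of 0 0 x y] by simp
    then show ?thesis by (simp add: G_def blinfun.add_right linear_add[OF linear_phi])
  qed
  have GA: "G x = A *v x" for x
  proof -
    have "x = x$1 *s axis 1 1 + x$2 *s axis 2 1 + x$3 *s axis 3 1"
      by (simp add: vec_eq_iff forall_3 axis_def)
    then have "G x = G (x$1 *s axis 1 1 + x$2 *s axis 2 1 + x$3 *s axis 3 1)"
      by (rule arg_cong)
    then have "G x = x$1 *s G (axis 1 1) + x$2 *s G (axis 2 1) + x$3 *s G (axis 3 1)"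
      by (simp only: add mult)
    then show ?thesis
      by (simp add: A_def su_matrix_def G_def vec_eq_iff matrix_vector_mult_def sum_3 mult.commute)
  qed
  have "herm (A *v x) (A *v y) = herm x y \<and> ccross (A *v x) (A *v y) = A *v ccross x y" for x y
  proof -
    have "psi (- herm x y) (ccross x y) = psi (- herm x y) 0 + psi 0 (ccross x y)"
      using psi_add[of "- herm x y" 0 0 "ccross x y"] by simp
    then have "g (omult (psi 0 x) (psi 0 y)) = psi (- herm x y) (A *v ccross x y)"
      using psi_add[of "- herm x y" 0 0 "A *v ccross x y"]
      by (simp add: omult_psi blinfun.add_right g0 gG GA)
    moreover have "omult (g (psi 0 x)) (g (psi 0 y)) = psi (- herm (A *v x) (A *v y)) (ccross (A *v x) (A *v y))"
      by (simp add: gG GA omult_psi)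
    ultimately show ?thesis by (simp add: G2_apply_omult[OF g2] psi_inject)
  qed
  then have herm: "herm (A *v x) (A *v y) = herm x y" and ccross: "ccross (A *v x) (A *v y) = A *v ccross x y"
    for x y by blast+
  have col: "A *v axis j 1 = column j A" for j
    by (rule matrix_vector_mult_axis)
  have hc: "herm (column j A) (column i A) = signJ $ i $ j" for i j
    unfolding col[symmetric] herm
    using exhaust_3[of i] exhaust_3[of j] by (auto simp: herm_def signJ_def axis_def)
  \<comment> \<open>For the columns of \<open>A\<close> this identity expresses the minors of the
    last two columns by conjugates of the first. Expanding the determinant along the first column
    then gives its \<open>herm\<close> square, which is 1.\<close>
  have "ccross (axis 2 1) (axis 3 1) = - axis 1 1"
    by (simp add: ccross_def vec_eq_iff forall_3 vector_3 axis_def)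
  then have cc: "ccross (column 2 A) (column 3 A) = - column 1 A"
    using ccross[of "axis 2 1" "axis 3 1"] matrix_vector_mult_scaleR_complex[of A "- 1" "axis 1 1"] by (simp add: col)
  have c': "cnj (A$2$2 * A$3$3 - A$3$2 * A$2$3) = A$1$1" "cnj (A$3$2 * A$1$3 - A$1$2 * A$3$3) = - A$2$1"
    "cnj (A$1$2 * A$2$3 - A$2$2 * A$1$3) = - A$3$1"
    using arg_cong[OF cc, of "\<lambda>v. - v $ 1"] arg_cong[OF cc, of "\<lambda>v. v $ 2"] arg_cong[OF cc, of "\<lambda>v. v $ 3"]
    by (simp_all only: ccross_def vector_3 column_def vec_lambda_beta vector_uminus_component minus_minus)
  have c: "A$2$2 * A$3$3 - A$3$2 * A$2$3 = cnj (A$1$1)" "A$3$2 * A$1$3 - A$1$2 * A$3$3 = - cnj (A$2$1)"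
    "A$1$2 * A$2$3 - A$2$2 * A$1$3 = - cnj (A$3$1)"
    unfolding complex_cnj_minus[symmetric] c'[symmetric] by (simp_all only: complex_cnj_cnj)
  have "det A = A$1$1 * (A$2$2 * A$3$3 - A$3$2 * A$2$3) + A$2$1 * (A$3$2 * A$1$3 - A$1$2 * A$3$3) +
      A$3$1 * (A$1$2 * A$2$3 - A$2$2 * A$1$3)"
    by (simp add: det_3 algebra_simps)
  also have "\<dots> = herm (column 1 A) (column 1 A)"
    unfolding c by (simp add: herm_def column_def)
  also have "\<dots> = 1" by (simp add: hc signJ_def)
  finally have "det A = 1" .
  then show "su_matrix g \<in> su12"
    using hc by (simp add: su12_def su12_herm flip: A_def)
  show "su_op (su_matrix g) = g"
  proof (rule octop_eq_psiI)
    fix z x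
    have "psi z x = psi z 0 + psi 0 x" "psi z (A *v x) = psi z 0 + psi 0 (A *v x)"
      using psi_add[of z 0 0 x] psi_add[of z 0 0 "A *v x"] by simp_all
    then show "su_op (su_matrix g) (psi z x) = g (psi z x)"
      by (simp add: su_op_apply blinfun.add_right g0 gG GA flip: A_def)
  qed
qed

lemma continuous_on_su_op: "continuous_on S su_op"
proof (rule continuous_on_blinfun_componentwise)
  fix y :: oct
  have "linear (psi 0)"
    using psi_add[of 0 0] psi_scaleR[of _ 0] by (intro linearI) simp_all
  then have "continuous_on UNIV (psi 0)" by (simp add: linear_continuous_on linear_conv_bounded_linear)
  moreover have "continuous_on S (\<lambda>A. A *v phi y)"
    unfolding matrix_vector_mult_def by (intro continuous_intros)
  ultimately have "continuous_on S (\<lambda>A. psi 0 (A *v phi y))"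
    by (rule continuous_on_compose2) simp
  then have "continuous_on S (\<lambda>A. psi (phi0 y) 0 + psi 0 (A *v phi y))"
    by (intro continuous_intros)
  moreover have "su_op A y = psi (phi0 y) 0 + psi 0 (A *v phi y)" for A
    using su_op_apply[of A "phi0 y" "phi y"] psi_add[of "phi0 y" 0 0 "A *v phi y"] by (simp add: psi_phi)
  ultimately show "continuous_on S (\<lambda>A. su_op A y)" by simp
qed

lemma continuous_on_su_matrix: "continuous_on S su_matrix"
  unfolding su_matrix_def
proof -
  have "continuous_on UNIV phi"
    using linear_phi by (simp add: linear_continuous_on linear_conv_bounded_linear)
  then have "continuous_on S (\<lambda>g. phi (blinfun_apply g x))" for x
    by (rule continuous_on_compose2) (auto intro: continuous_intros)
  then show "continuous_on S (\<lambda>g. \<chi> i j. phi (blinfun_apply g (psi 0 (axis j 1))) $ i)"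
    by (intro continuous_intros)
qed

lemma su12_mult_closed:
  assumes "A \<in> su12" "B \<in> su12"
  shows "A ** B \<in> su12"
proof -
  have "column j (A ** B) = A *v column j B" for j
    by (simp add: column_def matrix_matrix_mult_def matrix_vector_mult_def)
  then show ?thesis
    using assms by (simp add: su12_def su12_herm det_mul herm_mult[OF assms(1)])
qed

lemma lie_group_iso_stab_w_space: "lie_group_iso (G2\<lparr>carrier := stab w_space\<rparr>) SU12"
  unfolding SU12_eq
proof (rule lie_group_isoI[where F = su_op and f = su_matrix])
  show "su_matrix (su_op A) = A" for A
    by (simp add: su_matrix_def su_op_apply vec_eq_iff matrix_vector_mult_axis column_def)
qed (simp_all add: su_op_in_stab stab_w_space su12_mult_closed su_op_mult
    continuous_on_su_op continuous_on_su_matrix)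

declare split_paired_All [simp] split_paired_Ex [simp]

section \<open>Smooth functions and tangent vectors on a manifold\<close>

lemma smooth_atlas_chart:
  assumes "smooth_atlas A" "(U, \<phi>) \<in> A"
  shows "open U" "open (\<phi> ` U)" "homeomorphism U (\<phi> ` U) \<phi> (inv_into U \<phi>)"
    "continuous_on U \<phi>" "continuous_on (\<phi> ` U) (inv_into U \<phi>)"
    "\<And>x. x \<in> U \<Longrightarrow> inv_into U \<phi> (\<phi> x) = x" "\<And>y. y \<in> \<phi> ` U \<Longrightarrow> \<phi> (inv_into U \<phi> y) = y"
    "\<And>y. y \<in> \<phi> ` U \<Longrightarrow> inv_into U \<phi> y \<in> U"
proof -
  show *: "open U" "open (\<phi> ` U)" "homeomorphism U (\<phi> ` U) \<phi> (inv_into U \<phi>)"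
    using assms by (auto simp: smooth_atlas_def)
  show "continuous_on U \<phi>" "continuous_on (\<phi> ` U) (inv_into U \<phi>)"
    "\<And>x. x \<in> U \<Longrightarrow> inv_into U \<phi> (\<phi> x) = x" "\<And>y. y \<in> \<phi> ` U \<Longrightarrow> \<phi> (inv_into U \<phi> y) = y"
    using *(3) by (auto simp: homeomorphism_def)
  show "\<And>y. y \<in> \<phi> ` U \<Longrightarrow> inv_into U \<phi> y \<in> U"
    by (rule inv_into_into)
qed

lemma smooth_atlas_open_image:
  assumes "smooth_atlas A" "(U, \<phi>) \<in> A" "open W"
  shows "open (\<phi> ` (U \<inter> W))"
proof -
  have "openin (top_of_set (\<phi> ` U)) (\<phi> ` (U \<inter> W))"
    by (rule homeomorphism_imp_open_map[OF smooth_atlas_chart(3)[OF assms(1,2)]])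
      (use assms(3) in \<open>simp add: openin_open_Int\<close>)
  then show ?thesis
    using smooth_atlas_chart(2)[OF assms(1,2)] by (simp add: openin_open_eq)
qed

lemma smooth_atlas_cover:
  assumes "smooth_atlas A"
  obtains U \<phi> where "(U, \<phi>) \<in> A" "x \<in> U"
proof -
  have "x \<in> (\<Union>(U, \<phi>)\<in>A. U)" using assms unfolding smooth_atlas_def by blast
  then show thesis using that by auto
qed

lemma smooth_fun_chart: "smooth_fun_on A UNIV f \<Longrightarrow> (U, \<phi>) \<in> A \<Longrightarrow> smooth_on (\<phi> ` U) (f \<circ> inv_into U \<phi>)"
  by (auto simp: smooth_fun_on_def)

lemma smooth_fun_continuous:
  fixes A :: "('m::t2_space, 'e::euclidean_space) atlas"
  assumes "smooth_atlas A" "smooth_fun_on A UNIV f"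
  shows "continuous_on UNIV f"
proof (rule continuous_at_imp_continuous_on, rule ballI)
  fix x
  obtain U \<phi> where U: "(U, \<phi>) \<in> A" "x \<in> U" using smooth_atlas_cover[OF assms(1)] .
  note ch = smooth_atlas_chart[OF assms(1) U(1)]
  have "continuous_on U ((f \<circ> inv_into U \<phi>) \<circ> \<phi>)"
    by (rule continuous_on_compose[OF ch(4) smooth_on_imp_continuous_on[OF smooth_fun_chart[OF assms(2) U(1)]]])
  then have "continuous_on U f"
    by (rule continuous_on_eq) (simp add: ch(6))
  then show "isCont f x" using ch(1) U(2) by (simp add: continuous_on_eq_continuous_at)
qed

lemma Cinf_iff:
  "f \<in> Cinf A \<longleftrightarrow> (\<forall>(U, \<phi>)\<in>A. \<forall>k. Ck_on k (\<phi> ` U) (\<lambda>y. f (inv_into U \<phi> y)))"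
  by (simp add: Cinf_def smooth_fun_on_def smooth_on_def comp_def)

lemma Cinf_linear_combination:
  assumes "smooth_atlas A" "f \<in> Cinf A" "g \<in> Cinf A"
  shows "(\<lambda>x. a * f x + b * g x) \<in> Cinf A"
  using assms(2,3) smooth_atlas_chart(2)[OF assms(1)] unfolding Cinf_iff
  by (fast intro: Ck_on_add Ck_on_linear[OF _ bounded_linear_mult_right])

lemma Cinf_mult:
  assumes "smooth_atlas A" "f \<in> Cinf A" "g \<in> Cinf A"
  shows "(\<lambda>x. f x * g x) \<in> Cinf A"
  using assms(2,3) smooth_atlas_chart(2)[OF assms(1)] unfolding Cinf_iff
  by (fast intro: Ck_on_bilinear[OF bounded_bilinear_mult])

lemma Cinf_inner:
  assumes "smooth_atlas A" "smooth_fun_on A UNIV t"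
  shows "(\<lambda>x. t x \<bullet> b) \<in> Cinf A"
  using assms(2) smooth_atlas_chart(2)[OF assms(1)]
  unfolding Cinf_iff smooth_fun_on_def smooth_on_def comp_def Int_UNIV_right
  by (fast intro: Ck_on_linear[OF _ bounded_linear_inner_left])

lemma zero_in_tangent: "0 \<in> tangent A p"
  by (simp add: tangent_def)

lemma scaleR_in_tangent: "v \<in> tangent A p \<Longrightarrow> c *\<^sub>R v \<in> tangent A p"
  unfolding tangent_def scaleR_fun_def by (auto simp: algebra_simps)

text \<open>Differentiability tested on smooth functions, which is what makes
  \<open>velocity\<close> a derivation: \<open>deriv\<close> carries no information where the
  derivative does not exist.\<close>

definition Cinf_differentiable :: "('m, 'e::euclidean_space) atlas \<Rightarrow> (real \<Rightarrow> 'm) \<Rightarrow> real \<Rightarrow> bool" where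
  "Cinf_differentiable A c s \<longleftrightarrow> (\<forall>f\<in>Cinf A. (\<lambda>t. f (c t)) field_differentiable at s)"

lemma Cinf_differentiableD:
  assumes "Cinf_differentiable A c s" "f \<in> Cinf A"
  shows "((\<lambda>t. f (c t)) has_real_derivative velocity A c s f) (at s)"
  using assms by (auto simp: Cinf_differentiable_def velocity_def comp_def DERIV_deriv_iff_field_differentiable)

lemma velocity_in_tangent:
  assumes "smooth_atlas A" "Cinf_differentiable A c s"
  shows "velocity A c s \<in> tangent A (c s)"
  unfolding tangent_def
proof (intro CollectI conjI ballI allI)
  note d = Cinf_differentiableD[OF assms(2)]
  fix f g a b assume fg: "f \<in> Cinf A" "g \<in> Cinf A"
  show "velocity A c s (\<lambda>x. a * f x + b * g x) = a * velocity A c s f + b * velocity A c s g"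
    by (rule DERIV_unique[OF d[OF Cinf_linear_combination[OF assms(1) fg]]])
      (auto intro!: derivative_eq_intros d fg)
  show "velocity A c s (\<lambda>x. f x * g x) = f (c s) * velocity A c s g + g (c s) * velocity A c s f"
    by (rule DERIV_unique[OF d[OF Cinf_mult[OF assms(1) fg]]])
      (auto intro!: derivative_eq_intros d fg)
qed (auto simp: velocity_def)

lemma velocity_vec_deriv:
  assumes "smooth_atlas A" "Cinf_differentiable A c s" "smooth_fun_on A UNIV t"
  shows "((\<lambda>r. t (c r)) has_vector_derivative vec_deriv (velocity A c s) t) (at s)"
proof -
  have "((\<lambda>r. t (c r) \<bullet> b) has_derivative (\<lambda>h. (h *\<^sub>R vec_deriv (velocity A c s) t) \<bullet> b)) (at s)"
    if "b \<in> Basis" for b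
    using Cinf_differentiableD[OF assms(2) Cinf_inner[OF assms(1,3), of b]] that
    by (simp add: vec_deriv_def inner_sum_left inner_Basis if_distrib sum.delta has_field_derivative_def
        mult_commute_abs cong: if_cong)
  then show ?thesis
    unfolding has_vector_derivative_def by (subst has_derivative_componentwise_within) blast
qed

lemma Cinf_differentiable_cong:
  assumes "Cinf_differentiable A c s" "eventually (\<lambda>r. c r = c' r) (nhds s)"
  shows "Cinf_differentiable A c' s"
  unfolding Cinf_differentiable_def
proof
  fix f assume "f \<in> Cinf A"
  from Cinf_differentiableD[OF assms(1) this]
  have "((\<lambda>t. f (c' t)) has_real_derivative velocity A c s f) (at s)"
    by (rule DERIV_cong_ev[THEN iffD1, rotated -1]) (use assms(2) in \<open>auto elim: eventually_mono\<close>)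
  then show "(\<lambda>t. f (c' t)) field_differentiable at s"
    by (auto simp: field_differentiable_def)
qed

lemma smooth_map_on_Cinf_differentiable:
  assumes A: "smooth_atlas A" and c: "smooth_map_on real_line A W c" and "open W" "s \<in> W"
  shows "Cinf_differentiable A c s"
  unfolding Cinf_differentiable_def
proof
  fix f assume f: "f \<in> Cinf A"
  obtain V \<psi> where V: "(V, \<psi>) \<in> A" "c s \<in> V" using smooth_atlas_cover[OF A] .
  note ch = smooth_atlas_chart[OF A V(1)]
  define S where "S = W \<inter> c -` V"
  have "open S"
    unfolding S_def using c assms(3) ch(1) by (intro continuous_open_preimage) (auto simp: smooth_map_on_def)
  have s: "s \<in> S" using assms(4) V(2) by (simp add: S_def)
  have id: "inv_into UNIV (\<lambda>x::real. x) = (\<lambda>x. x)"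
    by (rule inv_equality[unfolded]) simp_all
  have "smooth_on S (\<psi> \<circ> c)"
    using c V(1) by (fastforce simp: smooth_map_on_def real_line_def id S_def comp_def)
  from smooth_on_has_derivative[OF \<open>open S\<close> this s]
  have 1: "(\<psi> \<circ> c has_derivative frechet_derivative (\<psi> \<circ> c) (at s)) (at s)" .
  have "smooth_on (\<psi> ` V) (f \<circ> inv_into V \<psi>)"
    using f V(1) by (intro smooth_fun_chart) (simp add: Cinf_def)
  from smooth_on_has_derivative[OF ch(2) this, of "\<psi> (c s)"] V(2)
  have 2: "(f \<circ> inv_into V \<psi> has_derivative frechet_derivative (f \<circ> inv_into V \<psi>) (at (\<psi> (c s)))) (at ((\<psi> \<circ> c) s))"
    by simp
  have "((\<lambda>t. f (c t)) has_derivative (frechet_derivative (f \<circ> inv_into V \<psi>) (at (\<psi> (c s))) \<circ>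
      frechet_derivative (\<psi> \<circ> c) (at s))) (at s)"
    by (rule has_derivative_transform_within_open[OF diff_chain_at[OF 1 2] \<open>open S\<close> s])
      (simp add: S_def ch(6))
  then show "(\<lambda>t. f (c t)) field_differentiable at s"
    using differentiable_def real_differentiable_def by (metis field_differentiable_def)
qed

subsection \<open>Coordinate vector fields\<close>

definition chart_vec :: "('m, 'e::euclidean_space) atlas \<Rightarrow> 'm set \<Rightarrow> ('m \<Rightarrow> 'e) \<Rightarrow> 'e \<Rightarrow> 'm \<Rightarrow> 'm tvec" where
  "chart_vec A U \<phi> e q = velocity A (\<lambda>s. inv_into U \<phi> (\<phi> q + s *\<^sub>R e)) 0"

lemma chart_curve_has_derivative:
  fixes f :: "'m::topological_space \<Rightarrow> 'v::real_normed_vector"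
  assumes A: "smooth_atlas A" "(U, \<phi>) \<in> A" and q: "q \<in> U" and f: "smooth_fun_on A UNIV f"
  shows "((\<lambda>s. f (inv_into U \<phi> (\<phi> q + s *\<^sub>R e))) has_vector_derivative
    frechet_derivative (f \<circ> inv_into U \<phi>) (at (\<phi> q)) e) (at 0)"
proof -
  let ?D = "frechet_derivative (f \<circ> inv_into U \<phi>) (at (\<phi> q))"
  have 2: "(f \<circ> inv_into U \<phi> has_derivative ?D) (at (\<phi> q + 0 *\<^sub>R e))"
    using smooth_on_has_derivative[OF smooth_atlas_chart(2)[OF A] smooth_fun_chart[OF f A(2)]] q by simp
  have 1: "((\<lambda>s. \<phi> q + s *\<^sub>R e) has_derivative (\<lambda>s. s *\<^sub>R e)) (at 0)"
    by (auto intro!: derivative_eq_intros)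
  have "linear ?D" using has_derivative_linear[OF 2] .
  then show ?thesis
    using has_derivative_compose[OF 1 2]
    by (simp add: has_vector_derivative_def comp_def linear_scale)
qed

lemma chart_Cinf_differentiable:
  assumes "smooth_atlas A" "(U, \<phi>) \<in> A" "q \<in> U"
  shows "Cinf_differentiable A (\<lambda>s. inv_into U \<phi> (\<phi> q + s *\<^sub>R e)) 0"
  unfolding Cinf_differentiable_def field_differentiable_def
  using chart_curve_has_derivative[OF assms]
  by (auto simp: Cinf_def has_real_derivative_iff_has_vector_derivative)

lemma chart_vec_eq:
  assumes "smooth_atlas A" "(U, \<phi>) \<in> A" "q \<in> U" "f \<in> Cinf A"
  shows "chart_vec A U \<phi> e q f = frechet_derivative (f \<circ> inv_into U \<phi>) (at (\<phi> q)) e"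
  unfolding chart_vec_def
proof (rule vector_derivative_unique_at)
  show "((\<lambda>s. f (inv_into U \<phi> (\<phi> q + s *\<^sub>R e))) has_vector_derivative
      velocity A (\<lambda>s. inv_into U \<phi> (\<phi> q + s *\<^sub>R e)) 0 f) (at 0)"
    using Cinf_differentiableD[OF chart_Cinf_differentiable[OF assms(1-3)] assms(4)]
    by (simp add: has_real_derivative_iff_has_vector_derivative)
  show "((\<lambda>s. f (inv_into U \<phi> (\<phi> q + s *\<^sub>R e))) has_vector_derivative
      frechet_derivative (f \<circ> inv_into U \<phi>) (at (\<phi> q)) e) (at 0)"
    using chart_curve_has_derivative[OF assms(1-3), of f e] assms(4) by (simp add: Cinf_def)
qed

lemma chart_vec_in_tangent:
  assumes "smooth_atlas A" "(U, \<phi>) \<in> A" "q \<in> U"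
  shows "chart_vec A U \<phi> e q \<in> tangent A q"
  using velocity_in_tangent[OF assms(1) chart_Cinf_differentiable[OF assms, of e]]
    smooth_atlas_chart(6)[OF assms] by (simp add: chart_vec_def)

lemma vec_deriv_chart_vec:
  assumes "smooth_atlas A" "(U, \<phi>) \<in> A" "q \<in> U" "smooth_fun_on A UNIV t"
  shows "vec_deriv (chart_vec A U \<phi> e q) t = frechet_derivative (t \<circ> inv_into U \<phi>) (at (\<phi> q)) e"
  unfolding chart_vec_def
  by (rule vector_derivative_unique_at[OF velocity_vec_deriv[OF assms(1) chart_Cinf_differentiable[OF assms(1-3)] assms(4)]
        chart_curve_has_derivative[OF assms]])

definition bump_field ::
  "('m, 'e::euclidean_space) atlas \<Rightarrow> 'm set \<Rightarrow> ('m \<Rightarrow> 'e) \<Rightarrow> 'e \<Rightarrow> real \<Rightarrow> 'e \<Rightarrow> 'm \<Rightarrow> 'm tvec" where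
  "bump_field A U \<phi> c r e q = (if q \<in> U then bump c r (\<phi> q) *\<^sub>R chart_vec A U \<phi> e q else 0)"

text \<open>Near points of \<open>U\<close> smoothness is read off in the chart through the
  transition map. Near other points the field vanishes identically: its support lies in the compact
  set \<open>K\<close> inside \<open>U\<close>, which is closed since the space is
  Hausdorff.\<close>

lemma bump_field_in_vfields:
  fixes A :: "('m::t2_space, 'e::euclidean_space) atlas"
  assumes A: "smooth_atlas A" and U: "(U, \<phi>) \<in> A" and r: "r > 0" "cball c r \<subseteq> \<phi> ` U"
  shows "bump_field A U \<phi> c r e \<in> vfields A"
  unfolding vfields_def
proof (intro CollectI conjI allI ballI)
  note ch = smooth_atlas_chart[OF A U]
  show "bump_field A U \<phi> c r e q \<in> tangent A q" for q
    by (simp add: bump_field_def zero_in_tangent scaleR_in_tangent chart_vec_in_tangent[OF A U])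
  fix f assume f: "f \<in> Cinf A"
  define F where "F y = bump c r y * frechet_derivative (f \<circ> inv_into U \<phi>) (at y) e" for y
  have fU: "smooth_on (\<phi> ` U) (f \<circ> inv_into U \<phi>)"
    using f U by (intro smooth_fun_chart) (simp add: Cinf_def)
  have F: "Ck_on k (\<phi> ` U) F" for k
    unfolding F_def
    using smooth_on_frechet_derivative[OF fU, of e]
    by (intro Ck_on_bilinear[OF bounded_bilinear_mult] ch(2) Ck_on_subset[OF Ck_on_bump])
      (auto simp: smooth_on_def)
  have eq: "bump_field A U \<phi> c r e q f = F (\<phi> q)" if "q \<in> U" for q
    using that f by (simp add: bump_field_def scaleR_fun_def F_def chart_vec_eq[OF A U])
  define K where "K = inv_into U \<phi> ` cball c r"
  have "compact K"
    unfolding K_def using r(2) by (intro compact_continuous_image continuous_on_subset[OF ch(5)]) auto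
  then have "closed K" by (rule compact_imp_closed)
  have KU: "K \<subseteq> U" using r(2) ch(8) by (auto simp: K_def)
  have eq0: "bump_field A U \<phi> c r e q f = 0" if "q \<notin> K" for q
  proof (cases "q \<in> U")
    case True
    then have "\<phi> q \<notin> cball c r" using that ch(6) by (force simp: K_def)
    then have "bump c r (\<phi> q) = 0" using r(1) by (intro bump_zero) (simp add: dist_commute)
    then show ?thesis by (simp add: eq True F_def)
  qed (simp add: bump_field_def)
  show "(\<lambda>q. bump_field A U \<phi> c r e q f) \<in> Cinf A"
    unfolding Cinf_def smooth_fun_on_def smooth_on_def
  proof (intro CollectI ballI, clarsimp)
    fix V \<psi> k
    assume V: "(V, \<psi>) \<in> A"
    note cV = smooth_atlas_chart[OF A V]
    show "Ck_on k (\<psi> ` V) ((\<lambda>q. bump_field A U \<phi> c r e q f) \<circ> inv_into V \<psi>)"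
    proof (rule Ck_on_local[OF cV(2)])
      fix y assume "y \<in> \<psi> ` V"
      then obtain q where q: "q \<in> V" "y = \<psi> q" by blast
      show "\<exists>T. open T \<and> y \<in> T \<and> Ck_on k T ((\<lambda>q. bump_field A U \<phi> c r e q f) \<circ> inv_into V \<psi>)"
      proof (cases "q \<in> U")
        case True
        define T where "T = \<psi> ` (V \<inter> U)"
        have T: "open T" unfolding T_def by (rule smooth_atlas_open_image[OF A V ch(1)])
        have "smooth_on T (\<phi> \<circ> inv_into V \<psi>)"
          using A U V unfolding smooth_atlas_def T_def by blast
        then have "Ck_on k T (\<phi> \<circ> inv_into V \<psi>)" unfolding smooth_on_def by blast
        moreover have "(\<phi> \<circ> inv_into V \<psi>) ` T \<subseteq> \<phi> ` U" by (auto simp: T_def cV(6))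
        ultimately have "Ck_on k T (\<lambda>y. F ((\<phi> \<circ> inv_into V \<psi>) y))"
          using Ck_on_compose[OF T ch(2) _ F] by blast
        then have "Ck_on k T ((\<lambda>q. bump_field A U \<phi> c r e q f) \<circ> inv_into V \<psi>)"
          by (rule Ck_on_cong[OF T, rotated]) (auto simp: T_def cV(6) eq)
        then show ?thesis using T q True by (auto simp: T_def)
      next
        case False
        define T where "T = \<psi> ` (V \<inter> - K)"
        have T: "open T" unfolding T_def by (rule smooth_atlas_open_image[OF A V]) (use \<open>closed K\<close> in auto)
        have "Ck_on k T (\<lambda>y. 0 :: real)" by (rule Ck_on_const)
        then have "Ck_on k T ((\<lambda>q. bump_field A U \<phi> c r e q f) \<circ> inv_into V \<psi>)"
          by (rule Ck_on_cong[OF T, rotated]) (auto simp: T_def cV(6) eq0)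
        then show ?thesis using T q False KU by (auto simp: T_def)
      qed
    qed
  qed
qed

section \<open>Parallel tractors\<close>

lemma cartan_form_in_der:
  "cartan_connection l C \<Longrightarrow> v \<in> tangent (total C) u \<Longrightarrow> form C u v \<in> der"
  unfolding cartan_connection_def g2_eq_der by (blast dest: bij_betwE)

lemma cartan_form_scaleR:
  assumes "cartan_connection l C" "v \<in> tangent (total C) u"
  shows "form C u (a *\<^sub>R v) = a *\<^sub>R form C u v"
proof -
  have "form C u (a *\<^sub>R v + 0 *\<^sub>R v) = a *\<^sub>R form C u v + 0 *\<^sub>R form C u v"
    using assms unfolding cartan_connection_def by blast
  then show ?thesis by simp
qed

lemma parallel_tractor_vec_deriv:
  assumes "cartan_connection l C" "parallel_tractor C t" "v \<in> tangent (total C) u"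
  shows "vec_deriv v t = - form C u v (t u)"
proof -
  have bij: "bij_betw (form C u) (tangent (total C) u) g2"
    using assms(1) by (simp add: cartan_connection_def)
  have "const_field C (form C u v) u = v"
    unfolding const_field_def using bij assms(3) by (simp add: bij_betw_def)
  moreover have "form C u v \<in> g2" using bij assms(3) by (blast dest: bij_betwE)
  ultimately show ?thesis
    using assms(2) unfolding parallel_tractor_def tractor_nabla_def
    by (metis eq_neg_iff_add_eq_0)
qed

text \<open>The connection form is only known to be smooth on globally defined vector fields; the coordinate
  fields of a chart are therefore cut off by a bump function.\<close>

lemma form_locally_bounded:
  fixes C :: "('m::topological_space, 'g::t2_space) cartan_geometry"
  assumes A: "smooth_atlas (total C)" and C: "cartan_connection l C"
    and U: "(U, \<phi>) \<in> total C" "u \<in> U"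
  obtains N K where "open N" "u \<in> N" "N \<subseteq> U" "K \<ge> 0"
    "\<And>q e. q \<in> N \<Longrightarrow> e \<in> Basis \<Longrightarrow> norm (form C q (chart_vec (total C) U \<phi> e q)) \<le> K"
proof -
  note ch = smooth_atlas_chart[OF A U(1)]
  obtain r where r: "r > 0" "cball (\<phi> u) r \<subseteq> \<phi> ` U"
    using open_contains_cball[of "\<phi> ` U"] ch(2) U(2) by blast
  define X where "X e = bump_field (total C) U \<phi> (\<phi> u) r e" for e
  define \<beta> where "\<beta> q = bump (\<phi> u) r (\<phi> q)" for q
  define G where "G q = (\<Sum>e\<in>Basis. norm (form C q (X e q)))" for q
  have \<beta>u: "\<beta> u > 0" using r(1) by (simp add: \<beta>_def bump_pos)
  have cont_\<beta>: "continuous_on U \<beta>"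
    unfolding \<beta>_def
    by (rule continuous_on_compose2[OF Ck_on_imp_continuous_on[OF Ck_on_bump] ch(4)]) simp
  have "continuous_on UNIV (\<lambda>q. form C q (X e q))" for e
  proof (rule smooth_fun_continuous[OF A])
    have "X e \<in> vfields (total C)" unfolding X_def by (rule bump_field_in_vfields[OF A U(1) r])
    then show "smooth_fun_on (total C) UNIV (\<lambda>q. form C q (X e q))"
      using C unfolding cartan_connection_def by blast
  qed
  then have cont_G: "continuous_on UNIV G"
    unfolding G_def by (intro continuous_intros)
  \<comment> \<open>On \<open>N\<close> the cut-off exceeds half its value at \<open>u\<close>, so
    dividing it out again costs only a bounded factor.\<close>
  define N where "N = (U \<inter> \<beta> -` {\<beta> u / 2<..}) \<inter> (UNIV \<inter> G -` {..<G u + 1})"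
  show thesis
  proof
    show "open N"
      unfolding N_def
      by (intro open_Int continuous_open_preimage[OF cont_\<beta> ch(1)] continuous_open_preimage[OF cont_G]) auto
    show "u \<in> N" "N \<subseteq> U" using U(2) \<beta>u by (auto simp: N_def)
    have G0: "G u \<ge> 0" unfolding G_def by (rule sum_nonneg) simp
    then show "(G u + 1) / (\<beta> u / 2) \<ge> 0" using \<beta>u by simp
    fix q e assume q: "q \<in> N" and e: "(e :: real^14) \<in> Basis"
    have "q \<in> U" and b: "\<beta> q > \<beta> u / 2" and "G q < G u + 1" using q by (auto simp: N_def)
    have "norm (form C q (X e q)) \<le> G q"
      unfolding G_def by (rule member_le_sum) (use e in auto)
    moreover have "form C q (X e q) = \<beta> q *\<^sub>R form C q (chart_vec (total C) U \<phi> e q)"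
      using cartan_form_scaleR[OF C chart_vec_in_tangent[OF A U(1) \<open>q \<in> U\<close>]] \<open>q \<in> U\<close>
      by (simp add: X_def bump_field_def \<beta>_def)
    ultimately have *: "\<beta> q * norm (form C q (chart_vec (total C) U \<phi> e q)) \<le> G u + 1"
      using \<open>G q < G u + 1\<close> b \<beta>u by simp
    have "(\<beta> u / 2) * norm (form C q (chart_vec (total C) U \<phi> e q)) \<le>
        \<beta> q * norm (form C q (chart_vec (total C) U \<phi> e q))"
      using b by (intro mult_right_mono) auto
    with * have "(\<beta> u / 2) * norm (form C q (chart_vec (total C) U \<phi> e q)) \<le> G u + 1" by linarith
    then show "norm (form C q (chart_vec (total C) U \<phi> e q)) \<le> (G u + 1) / (\<beta> u / 2)"
      using \<beta>u by (simp add: pos_le_divide_eq mult.commute)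
  qed
qed

text \<open>A Gronwall argument without integration: at a maximum point \<open>z\<close> of the
  norm, the mean value inequality gives \<open>norm (F z) \<le> (L * r) * norm (F z)\<close>, and
  the factor is at most one half.\<close>

lemma zero_of_derivative_bound:
  fixes F :: "'a::euclidean_space \<Rightarrow> 'b::real_normed_vector"
  assumes r: "r > 0" and L: "L \<ge> 0" "L * r \<le> 1 / 2" and F0: "F c = 0"
    and deriv: "\<And>y. y \<in> cball c r \<Longrightarrow> (F has_derivative F' y) (at y)"
    and bound: "\<And>y v. y \<in> cball c r \<Longrightarrow> norm (F' y v) \<le> L * norm (F y) * norm v"
    and y: "y \<in> cball c r"
  shows "F y = 0"
proof -
  have cont: "continuous_on (cball c r) (\<lambda>y. norm (F y))"
    by (intro continuous_on_norm continuous_at_imp_continuous_on ballI has_derivative_continuous[OF deriv])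
  obtain z where z: "z \<in> cball c r" "\<And>y. y \<in> cball c r \<Longrightarrow> norm (F y) \<le> norm (F z)"
    using continuous_attains_sup[OF compact_cball _ cont] r by auto
  have "norm (F z - F c) \<le> (L * norm (F z)) * norm (z - c)"
  proof (rule differentiable_bound[OF convex_cball[of c r]])
    fix y assume y: "y \<in> cball c r"
    show "(F has_derivative F' y) (at y within cball c r)"
      by (rule has_derivative_at_withinI[OF deriv[OF y]])
    show "onorm (F' y) \<le> L * norm (F z)"
    proof (rule onorm_le)
      fix v :: 'a
      have "L * norm (F y) * norm v \<le> L * norm (F z) * norm v"
        using z(2)[OF y] L(1) by (intro mult_right_mono mult_left_mono) auto
      then show "norm (F' y v) \<le> L * norm (F z) * norm v"
        using bound[OF y, of v] by linarith
    qed
  qed (use z r in auto)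
  also have "\<dots> \<le> (L * norm (F z)) * r"
    using z(1) L(1) by (intro mult_left_mono) (auto simp: dist_norm norm_minus_commute)
  also have "\<dots> = (L * r) * norm (F z)" by simp
  also have "\<dots> \<le> (1 / 2) * norm (F z)"
    using L(2) by (rule mult_right_mono) simp
  finally have "norm (F z) = 0" by (simp add: F0)
  then show ?thesis using z(2)[OF y] by simp
qed

text \<open>In a chart, being parallel is a linear first order system whose coefficients, the values
  of the connection form on the coordinate fields, are bounded near \<open>u\<close>. A zero
  therefore spreads to a ball.\<close>

lemma parallel_tractor_zero_open:
  fixes C :: "('m::topological_space, 'g::t2_space) cartan_geometry"
  assumes A: "smooth_atlas (total C)" and C: "cartan_connection l C"
    and t: "smooth_fun_on (total C) UNIV t" "parallel_tractor C t" and u: "t u = 0"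
  shows "\<exists>N. open N \<and> u \<in> N \<and> N \<subseteq> {q. t q = 0}"
proof -
  obtain U \<phi> where U: "(U, \<phi>) \<in> total C" "u \<in> U" using smooth_atlas_cover[OF A] .
  note ch = smooth_atlas_chart[OF A U(1)]
  obtain N K where N: "open N" "u \<in> N" "N \<subseteq> U" and K: "K \<ge> 0"
    "\<And>q e. q \<in> N \<Longrightarrow> e \<in> Basis \<Longrightarrow> norm (form C q (chart_vec (total C) U \<phi> e q)) \<le> K"
    using form_locally_bounded[OF A C U] by blast
  define F where "F = t \<circ> inv_into U \<phi>"
  \<comment> \<open>Each coordinate direction contributes at most \<open>K\<close> to the bound on
    the full derivative.\<close>
  define L where "L = real DIM(real^14) * K"
  have L: "L \<ge> 0" using K(1) by (simp add: L_def)
  have "open (\<phi> ` (U \<inter> N))" by (rule smooth_atlas_open_image[OF A U(1) N(1)])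
  then obtain r0 where r0: "r0 > 0" "cball (\<phi> u) r0 \<subseteq> \<phi> ` (U \<inter> N)"
    using open_contains_cball[of "\<phi> ` (U \<inter> N)"] N(2) U(2) by blast
  \<comment> \<open>The second bound gives \<open>L * r \<le> 1 / 2\<close>; adding 1 to
    \<open>L\<close> keeps it positive when \<open>L\<close> is zero.\<close>
  define r where "r = min r0 (1 / (2 * (L + 1)))"
  have r: "r > 0" "cball (\<phi> u) r \<subseteq> \<phi> ` (U \<inter> N)" using r0 L by (auto simp: r_def)
  have "L * r \<le> L * (1 / (2 * (L + 1)))" using L by (intro mult_left_mono) (simp_all add: r_def)
  also have "\<dots> \<le> 1 / 2" using L by (simp add: field_simps)
  finally have Lr: "L * r \<le> 1 / 2" .
  have zero: "F y = 0" if "y \<in> cball (\<phi> u) r" for y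
  proof (rule zero_of_derivative_bound[OF r(1) L Lr _ _ _ that])
    show "F (\<phi> u) = 0" by (simp add: F_def ch(6) U(2) u)
    fix y assume "y \<in> cball (\<phi> u) r"
    then obtain q where q: "q \<in> U" "q \<in> N" "y = \<phi> q" using r(2) by blast
    let ?D = "frechet_derivative F (at y)"
    show d: "(F has_derivative ?D) (at y)"
      unfolding F_def
      by (rule smooth_on_has_derivative[OF ch(2) smooth_fun_chart[OF t(1) U(1)]]) (use q in blast)
    fix v :: "real^14"
    have "?D e = - form C q (chart_vec (total C) U \<phi> e q) (F y)" for e
      using vec_deriv_chart_vec[OF A U(1) q(1) t(1), of e]
        parallel_tractor_vec_deriv[OF C t(2) chart_vec_in_tangent[OF A U(1) q(1), of e]]
      by (simp add: F_def q(3) ch(6)[OF q(1)])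
    then have De: "norm (?D e) \<le> K * norm (F y)" if "e \<in> Basis" for e
      using norm_blinfun[of "form C q (chart_vec (total C) U \<phi> e q)" "F y"] K(2)[OF q(2) that]
      by (smt (verit) mult_right_mono norm_ge_zero norm_minus_cancel)
    have lin: "linear ?D" by (rule has_derivative_linear[OF d])
    have "?D v = ?D (\<Sum>e\<in>Basis. (v \<bullet> e) *\<^sub>R e)" by (simp only: euclidean_representation)
    also have "\<dots> = (\<Sum>e\<in>Basis. (v \<bullet> e) *\<^sub>R ?D e)"
      by (simp add: linear_sum[OF lin] linear_scale[OF lin])
    also have "norm \<dots> \<le> (\<Sum>e\<in>(Basis :: (real^14) set). norm v * (K * norm (F y)))"
    proof (rule sum_norm_le)
      fix e :: "real^14" assume e: "e \<in> Basis"
      show "norm ((v \<bullet> e) *\<^sub>R ?D e) \<le> norm v * (K * norm (F y))"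
        using De[OF e] Basis_le_norm[OF e, of v] by (simp add: mult_mono)
    qed
    also have "\<dots> = L * norm (F y) * norm v" by (simp add: L_def)
    finally show "norm (?D v) \<le> L * norm (F y) * norm v" .
  qed
  show ?thesis
  proof (intro exI conjI)
    show "open (U \<inter> \<phi> -` ball (\<phi> u) r)" by (rule continuous_open_preimage[OF ch(4,1)]) simp
    show "u \<in> U \<inter> \<phi> -` ball (\<phi> u) r" using U(2) r(1) by simp
    show "U \<inter> \<phi> -` ball (\<phi> u) r \<subseteq> {q. t q = 0}"
    proof
      fix q assume "q \<in> U \<inter> \<phi> -` ball (\<phi> u) r"
      then show "q \<in> {q. t q = 0}" using zero[of "\<phi> q"] by (simp add: F_def ch(6))
    qed
  qed
qed

section \<open>The zero set of a parallel tractor on the base\<close>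

lemma principal_bundle_local_section:
  assumes "principal_bundle l C"
  obtains U s where "open U" "x \<in> U" "continuous_on U s" "\<forall>y\<in>U. proj C (s y) = y"
    "\<forall>u. proj C u \<in> U \<longrightarrow> (\<exists>p\<in>Par l. u = act C (s (proj C u)) p)"
proof -
  obtain U s \<Phi> where U: "open U" "x \<in> U" "smooth_map_on (base C) (total C) U s" "\<forall>y\<in>U. proj C (s y) = y"
    "\<forall>u\<in>proj C -` U. \<Phi> u \<in> Par l \<and> u = act C (s (proj C u)) (\<Phi> u)"
    using assms unfolding principal_bundle_def by meson
  show thesis
  proof (rule that[OF U(1,2)])
    show "continuous_on U s" using U(3) by (simp add: smooth_map_on_def)
    show "\<forall>y\<in>U. proj C (s y) = y" by (rule U(4))
    show "\<forall>u. proj C u \<in> U \<longrightarrow> (\<exists>p\<in>Par l. u = act C (s (proj C u)) p)"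
      using U(5) by blast
  qed
qed

lemma Par_subset_G2: "p \<in> Par l \<Longrightarrow> p \<in> carrier G2"
  by (simp add: Par_def)

lemma G2_apply_eq_0_iff: "g \<in> carrier G2 \<Longrightarrow> g x = 0 \<longleftrightarrow> x = 0"
  by (metis G2_inv_apply(1) blinfun.zero_right)

lemma tractor_zero_fibre:
  assumes C: "principal_bundle l C" and t: "t \<in> tractor_sections l C" and uv: "proj C u = proj C v"
  shows "t u = 0 \<longleftrightarrow> t v = 0"
proof -
  obtain U s where U: "proj C u \<in> U"
    "\<forall>u. proj C u \<in> U \<longrightarrow> (\<exists>p\<in>Par l. u = act C (s (proj C u)) p)"
    by (rule principal_bundle_local_section[OF C, of "proj C u"])
  have "t w = 0 \<longleftrightarrow> t (s (proj C u)) = 0" if w: "proj C w = proj C u" for w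
  proof -
    obtain p where p: "p \<in> Par l" "w = act C (s (proj C u)) p" using U w by metis
    then have "t w = (inv\<^bsub>G2\<^esub> p) (t (s (proj C u)))"
      using t unfolding tractor_sections_def by blast
    then show ?thesis
      using G2_apply_eq_0_iff[OF G2.inv_closed[OF Par_subset_G2[OF p(1)]]] by simp
  qed
  from this[of u] this[of v] uv show ?thesis by simp
qed

lemma parallel_tractor_nonvanishing:
  fixes C :: "('m::topological_space, 'g::t2_space) cartan_geometry"
  assumes conn: "connected (UNIV :: 'm set)"
    and C: "principal_bundle l C" "cartan_connection l C"
    and t: "t \<in> tractor_sections l C" "parallel_tractor C t" "t u1 \<noteq> 0"
  shows "t u \<noteq> 0"
proof
  assume u: "t u = 0"
  have A: "smooth_atlas (total C)" using C(1) by (simp add: principal_bundle_def)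
  have st: "smooth_fun_on (total C) UNIV t" using t(1) by (simp add: tractor_sections_def)
  define Z where "Z = proj C ` {u. t u = 0}"
  define W where "W = proj C ` {u. t u \<noteq> 0}"
  \<comment> \<open>Saturation under fibres allows the given point to be replaced by the value of a
    local section over the same base point; preimages under the section are open in the
    base.\<close>
  have openI: "open (proj C ` S)"
    if S: "\<And>u. u \<in> S \<Longrightarrow> \<exists>N. open N \<and> u \<in> N \<and> N \<subseteq> S"
      and fibre: "\<And>u v. proj C u = proj C v \<Longrightarrow> u \<in> S \<Longrightarrow> v \<in> S" for S
  proof (subst open_subopen, intro ballI)
    fix x assume "x \<in> proj C ` S"
    then obtain v where v: "v \<in> S" "proj C v = x" by blast
    obtain U s where U: "open U" "x \<in> U" "continuous_on U s" "\<forall>y\<in>U. proj C (s y) = y"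
      by (rule principal_bundle_local_section[OF C(1), of x])
    have "s x \<in> S" using fibre[of v "s x"] v U(2,4) by simp
    then obtain N where N: "open N" "s x \<in> N" "N \<subseteq> S" using S by blast
    have "open (U \<inter> s -` N)" by (rule continuous_open_preimage[OF U(3,1) N(1)])
    moreover have "U \<inter> s -` N \<subseteq> proj C ` S"
    proof
      fix y assume "y \<in> U \<inter> s -` N"
      then have "s y \<in> S" "y = proj C (s y)" using N(3) U(4) by auto
      then show "y \<in> proj C ` S" by blast
    qed
    ultimately show "\<exists>T. open T \<and> x \<in> T \<and> T \<subseteq> proj C ` S" using U(2) N(2) by blast
  qed
  have "open Z"
    unfolding Z_def
  proof (rule openI)
    show "\<exists>N. open N \<and> u \<in> N \<and> N \<subseteq> {u. t u = 0}" if "u \<in> {u. t u = 0}" for u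
      using parallel_tractor_zero_open[OF A C(2) st t(2), of u] that by simp
    show "v \<in> {u. t u = 0}" if "proj C u = proj C v" "u \<in> {u. t u = 0}" for u v
      using tractor_zero_fibre[OF C(1) t(1) that(1)] that(2) by simp
  qed
  moreover have "open W"
    unfolding W_def
  proof (rule openI)
    have "{u. t u \<noteq> 0} = UNIV \<inter> t -` (- {0})" by blast
    then have "open {u. t u \<noteq> 0}"
      using continuous_open_preimage[OF smooth_fun_continuous[OF A st] open_UNIV open_Compl[OF closed_singleton[of 0]]]
      by simp
    then show "\<exists>N. open N \<and> u \<in> N \<and> N \<subseteq> {u. t u \<noteq> 0}" if "u \<in> {u. t u \<noteq> 0}" for u using that by blast
    show "v \<in> {u. t u \<noteq> 0}" if "proj C u = proj C v" "u \<in> {u. t u \<noteq> 0}" for u v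
      using tractor_zero_fibre[OF C(1) t(1) that(1)] that(2) by simp
  qed
  moreover have "Z \<inter> W = {}"
  proof (rule ccontr)
    assume "Z \<inter> W \<noteq> {}"
    then obtain u v where "proj C u = proj C v" "t u = 0" "t v \<noteq> 0" unfolding Z_def W_def by blast
    then show False using tractor_zero_fibre[OF C(1) t(1)] by blast
  qed
  moreover have "Z \<union> W = UNIV"
  proof -
    have "x \<in> Z \<union> W" for x
    proof -
      obtain U s where "x \<in> U" "\<forall>y\<in>U. proj C (s y) = y"
        by (rule principal_bundle_local_section[OF C(1), of x])
      then have s: "proj C (s x) = x" by blast
      show ?thesis
      proof (cases "t (s x) = 0")
        case True
        then have "proj C (s x) \<in> Z" unfolding Z_def by blast
        then show ?thesis by (simp add: s)
      next
        case False
        then have "proj C (s x) \<in> W" unfolding W_def by blast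
        then show ?thesis by (simp add: s)
      qed
    qed
    then show ?thesis by blast
  qed
  moreover have "Z \<noteq> {}" "W \<noteq> {}" using u t(3) by (auto simp: Z_def W_def)
  ultimately show False
    using connectedD[OF conn, of Z W] by blast
qed

section \<open>Parallel transport along piecewise smooth curves and the holonomy group\<close>

lemma partition_interval:
  fixes \<tau> :: "nat \<Rightarrow> real"
  assumes "\<tau> 0 < s" "s < \<tau> n" "s \<notin> \<tau> ` {..n}"
  obtains i where "i < n" "\<tau> i < s" "s < \<tau> (Suc i)"
proof -
  have "\<exists>i<n. \<tau> i < s \<and> s < \<tau> (Suc i)"
    using assms
  proof (induction n)
    case (Suc n)
    show ?case
    proof (cases "s < \<tau> n")
      case True
      moreover have "s \<notin> \<tau> ` {..n}" using Suc.prems(3) by auto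
      ultimately have "\<exists>i<n. \<tau> i < s \<and> s < \<tau> (Suc i)" using Suc.IH Suc.prems(1) by blast
      then show ?thesis using less_Suc_eq by blast
    next
      case False
      moreover have "s \<noteq> \<tau> n" using Suc.prems(3) by auto
      ultimately have "\<tau> n < s" by linarith
      then show ?thesis using Suc.prems(2) by blast
    qed
  qed simp
  then show thesis using that by blast
qed

lemma piecewise_smooth_curve_Cinf_differentiable:
  assumes A: "smooth_atlas A" and c: "piecewise_smooth_curve A c"
  obtains K where "finite K" "\<And>s. s \<in> {0<..<1} - K \<Longrightarrow> Cinf_differentiable A c s"
proof -
  obtain n \<tau> where \<tau>: "\<tau> 0 = 0" "\<tau> n = (1::real)"
    and pieces: "\<And>i. i < n \<Longrightarrow> \<exists>\<epsilon>>0. \<exists>c'. smooth_map_on real_line A {\<tau> i - \<epsilon><..<\<tau> (Suc i) + \<epsilon>} c' \<and>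
              (\<forall>t\<in>{\<tau> i..\<tau> (Suc i)}. c t = c' t)"
    using c unfolding piecewise_smooth_curve_def by blast
  show thesis
  proof
    show "finite (\<tau> ` {..n})" by simp
    fix s assume s: "s \<in> {0<..<1} - \<tau> ` {..n}"
    obtain i where i: "i < n" "\<tau> i < s" "s < \<tau> (Suc i)"
      using partition_interval[of \<tau> s n] s \<tau> by auto
    obtain \<epsilon> c' where c': "\<epsilon> > 0" "smooth_map_on real_line A {\<tau> i - \<epsilon><..<\<tau> (Suc i) + \<epsilon>} c'"
      "\<forall>t\<in>{\<tau> i..\<tau> (Suc i)}. c t = c' t" using pieces[OF i(1)] by blast
    have "Cinf_differentiable A c' s"
      by (rule smooth_map_on_Cinf_differentiable[OF A c'(2)]) (use i c'(1) in auto)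
    moreover have "eventually (\<lambda>r. c' r = c r) (nhds s)"
      unfolding eventually_nhds using i c'(3) by (intro exI[of _ "{\<tau> i<..<\<tau> (Suc i)}"]) auto
    ultimately show "Cinf_differentiable A c s" by (rule Cinf_differentiable_cong)
  qed
qed

lemma holonomy_subset_stab:
  fixes C :: "('m::topological_space, 'g::t2_space) cartan_geometry"
  assumes A: "smooth_atlas (total C)" and C: "cartan_connection l C"
    and t: "t \<in> tractor_sections l C" "parallel_tractor C t"
  shows "holonomy l C u \<subseteq> stab (t u)"
proof
  fix g assume "g \<in> holonomy l C u"
  then obtain p c h where g: "g = p o\<^sub>L h 1" and p: "p \<in> Par l"
    and c: "piecewise_smooth_curve (total C) c" "c 0 = u" "c 1 = act C u p"
    and h: "tractor_transport C c h"
    unfolding holonomy_def by blast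
  have st: "smooth_fun_on (total C) UNIV t" using t(1) by (simp add: tractor_sections_def)
  obtain K1 where K1: "finite K1" "\<And>s. s \<in> {0<..<1} - K1 \<Longrightarrow> Cinf_differentiable (total C) c s"
    using piecewise_smooth_curve_Cinf_differentiable[OF A c(1)] by blast
  obtain K2 where K2: "finite K2" "\<And>s. s \<in> {0<..<1} - K2 \<Longrightarrow>
        (h has_vector_derivative - (form C (c s) (velocity (total C) c s) o\<^sub>L h s)) (at s)"
    using h unfolding tractor_transport_def by blast
  have h0: "h 0 = id_blinfun" "continuous_on {0..1} h" using h by (auto simp: tractor_transport_def)
  define K where "K = K1 \<union> K2"
  \<comment> \<open>By \<open>parallel_tractor_vec_deriv\<close> the parallel tractor along the
    curve obeys the same equation, with the same sign, as the transport \<open>h\<close>.\<close>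
  define B where "B s = - form C (c s) (velocity (total C) c s)" for s
  have fin: "finite K" using K1(1) K2(1) by (simp add: K_def)
  have tangent: "velocity (total C) c s \<in> tangent (total C) (c s)" if "s \<in> {0<..<1} - K" for s
    using velocity_in_tangent[OF A K1(2)] that by (simp add: K_def)
  have der: "B s \<in> der" if "s \<in> {0<..<1} - K" for s
    unfolding B_def using cartan_form_in_der[OF C tangent[OF that]] subspace_neg[OF subspace_der] by blast
  have th: "transported K 0 1 B (\<lambda>s. h s x)" for x
    unfolding transported_def
  proof (intro conjI ballI)
    show "continuous_on {0..1} (\<lambda>s. h s x)" using h0(2) by (intro continuous_intros)
    fix s assume "s \<in> {0<..<1} - K"
    then have "(h has_vector_derivative - (form C (c s) (velocity (total C) c s) o\<^sub>L h s)) (at s)"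
      by (intro K2(2)) (simp add: K_def)
    from bounded_linear.has_vector_derivative[OF blinfun.bounded_linear_left this, of x]
    show "((\<lambda>s. h s x) has_vector_derivative B s (h s x)) (at s)"
      by (simp add: B_def blinfun.minus_left)
  qed
  have tt: "transported K 0 1 B (\<lambda>s. t (c s))"
    unfolding transported_def
  proof (intro conjI ballI)
    show "continuous_on {0..1} (\<lambda>s. t (c s))"
      using c(1) smooth_fun_continuous[OF A st]
      by (intro continuous_on_compose2[of UNIV t "{0..1}" c]) (auto simp: piecewise_smooth_curve_def)
    fix s assume s: "s \<in> {0<..<1} - K"
    then have "((\<lambda>s. t (c s)) has_vector_derivative vec_deriv (velocity (total C) c s) t) (at s)"
      by (intro velocity_vec_deriv[OF A K1(2) st]) (simp add: K_def)
    then show "((\<lambda>s. t (c s)) has_vector_derivative B s (t (c s))) (at s)"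
      using parallel_tractor_vec_deriv[OF C t(2) tangent[OF s]] by (simp add: B_def blinfun.minus_left)
  qed
  have h1: "h 1 \<in> carrier G2" and "t (c 1) = h 1 (t (c 0))"
    using transport_G2[OF zero_le_one fin der th h0(1)] tt by blast+
  \<comment> \<open>Equivariance rewrites the value of \<open>t\<close> at the end point
    \<open>act C u p\<close>; applying \<open>p\<close> then shows that the holonomy element fixes
    \<open>t u\<close>.\<close>
  then have "(inv\<^bsub>G2\<^esub> p) (t u) = h 1 (t u)"
    using t(1) p unfolding tractor_sections_def c(2,3) by auto
  then have "p (h 1 (t u)) = t u"
    using G2_inv_apply(2)[OF Par_subset_G2[OF p]] by metis
  moreover have "p o\<^sub>L h 1 \<in> carrier G2"
    using G2.m_closed[OF Par_subset_G2[OF p] h1] by simp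
  ultimately show "g \<in> stab (t u)" by (simp add: stab_iff g)
qed

section \<open>The filtration defined by an isotropic vector\<close>

definition l0 :: oct where "l0 = (0, e1, 0, 0)"

definition p2 :: oct where "p2 = (0, axis 2 1, 0, 0)"
definition p3 :: oct where "p3 = (0, axis 3 1, 0, 0)"
definition q1 :: oct where "q1 = (0, 0, axis 1 1, 0)"
definition q2 :: oct where "q2 = (0, 0, axis 2 1, 0)"
definition q3 :: oct where "q3 = (0, 0, axis 3 1, 0)"

lemmas basis_defs = l0_def p2_def p3_def q1_def q2_def q3_def w_time_def

text \<open>The vectors \<open>q1\<close>; \<open>p2\<close>, \<open>p3\<close>; \<open>w_time\<close>; \<open>q2\<close>, \<open>q3\<close>; \<open>l0\<close> have the degrees \<open>-2, -1, 0, 1, 2\<close>.\<close>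

definition filt :: "int \<Rightarrow> oct set" where
  "filt i = {(a, u, v, b). a + b = 0 \<and> (- 2 < i \<longrightarrow> v$1 = 0) \<and> (- 1 < i \<longrightarrow> u$2 = 0 \<and> u$3 = 0) \<and>
     (0 < i \<longrightarrow> a = 0) \<and> (1 < i \<longrightarrow> v$2 = 0 \<and> v$3 = 0) \<and> (2 < i \<longrightarrow> u$1 = 0)}"

lemma subspace_filt: "subspace (filt i)"
  unfolding subspace_def filt_def by (auto simp: zero_prod_def algebra_simps simp flip: distrib_left)

lemma filt_antimono: "i \<le> j \<Longrightarrow> filt j \<subseteq> filt i"
  unfolding filt_def by auto

lemma filt_imag: "i \<le> - 2 \<Longrightarrow> filt i = imag_oct"
  unfolding filt_def imag_oct_def by auto

lemma filt_subset_imag: "filt i \<subseteq> imag_oct"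
  unfolding filt_def imag_oct_def by auto

lemma filt_zero: "2 < i \<Longrightarrow> filt i = {0}"
  unfolding filt_def zero_prod_def by (auto simp: vec_eq_iff forall_3)

lemma oinner_basis:
  "oinner (a, u, v, b) l0 = - (v$1) / 2" "oinner (a, u, v, b) q2 = - (u$2) / 2"
  "oinner (a, u, v, b) q3 = - (u$3) / 2" "oinner (a, u, v, b) w_time = (b - a) / 2"
  "oinner (a, u, v, b) oone = (a + b) / 2"
  by (simp_all add: basis_defs oone_def inner_axis inner_axis')

text \<open>Within the imaginary octonions \<open>filt (- 1)\<close> is the orthogonal complement of
  \<open>filt 2\<close>, and \<open>filt 0\<close> that of \<open>filt 1\<close>. This duality
  transfers statements from the upper degrees to the lower ones.\<close>

lemma filt_m1_iff: "y \<in> filt (- 1) \<longleftrightarrow> oinner y oone = 0 \<and> oinner y l0 = 0"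
  by (cases y rule: prod_cases4) (auto simp: filt_def oinner_basis)

lemma filt_0_iff: "y \<in> filt 0 \<longleftrightarrow> y \<in> filt (- 1) \<and> oinner y q2 = 0 \<and> oinner y q3 = 0"
  by (cases y rule: prod_cases4) (auto simp: filt_def oinner_basis)

lemma filt_1_iff: "y \<in> filt 1 \<longleftrightarrow> y \<in> filt 0 \<and> oinner y w_time = 0"
  by (cases y rule: prod_cases4) (auto simp: filt_def oinner_basis)

lemma filt_2_iff: "y \<in> filt 2 \<longleftrightarrow> (\<exists>c. y = c *\<^sub>R l0)"
  by (cases y rule: prod_cases4) (auto simp: filt_def basis_defs vec_eq_iff forall_3 axis_def)

text \<open>A description by the product with \<open>l0\<close> alone, hence stable under
  automorphisms fixing \<open>l0\<close> and derivations scaling it.\<close>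

lemma filt_1_omult_iff: "y \<in> filt 1 \<longleftrightarrow> y \<in> imag_oct \<and> omult l0 y = 0"
  by (cases y rule: prod_cases4)
    (auto simp: filt_def basis_defs imag_oct_def vec_eq_iff forall_3 axis_def inner_vec_def sum_3 cross3_def vector_3 zero_prod_def)

lemma filt_1E:
  assumes "y \<in> filt 1"
  obtains b c r where "y = b *\<^sub>R q2 + c *\<^sub>R q3 + r *\<^sub>R l0"
proof (cases y rule: prod_cases4)
  fix a u v b
  assume "y = (a, u, v, b)"
  then have "y = (v$2) *\<^sub>R q2 + (v$3) *\<^sub>R q3 + (u$1) *\<^sub>R l0"
    using assms by (simp add: filt_def basis_defs vec_eq_iff forall_3 axis_def)
  then show thesis by (rule that)
qed

lemma basis_in_filt: "l0 \<in> filt 2" "q2 \<in> filt 1" "q3 \<in> filt 1" "w_time \<in> filt 0" "p2 \<in> filt (- 1)" "p3 \<in> filt (- 1)"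
  "q1 \<in> filt (- 2)"
  by (simp_all add: filt_def basis_defs axis_def)

text \<open>The filtration consists of imaginary octonions; the condition at the unit makes such an
  operator determined by what it does to them.\<close>

definition shifts :: "int \<Rightarrow> octop set" where
  "shifts k = {N::octop. N oone = 0 \<and> (\<forall>i. \<forall>x\<in>filt i. N x \<in> filt (i + k))}"

lemma shiftsD: "N \<in> shifts k \<Longrightarrow> x \<in> filt i \<Longrightarrow> N x \<in> filt (i + k)"
  unfolding shifts_def by blast

lemma shiftsI:
  fixes N :: octop
  assumes one: "N oone = 0" and l: "N l0 \<in> filt (2 + k)" and q: "N q2 \<in> filt (1 + k)" "N q3 \<in> filt (1 + k)"
    and w: "N w_time \<in> filt k" and p: "N p2 \<in> filt (k - 1)" "N p3 \<in> filt (k - 1)" and q1: "N q1 \<in> filt (k - 2)"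
  shows "N \<in> shifts k"
  unfolding shifts_def
proof (intro CollectI conjI allI ballI)
  show "N oone = 0" by (rule one)
  fix i x assume x: "x \<in> filt i"
  obtain a u v b where e: "x = (a, u, v, b)" by (rule prod_cases4)
  note x' = x[unfolded e filt_def, simplified]
  have step: "c *\<^sub>R y \<in> filt (i + k)" if "y \<in> filt j" "i + k \<le> j \<or> c = 0" for c y j
  proof (cases "c = 0")
    case False
    then have "filt j \<subseteq> filt (i + k)" using that(2) by (intro filt_antimono) simp
    then show ?thesis using subspace_scale[OF subspace_filt that(1)] by blast
  qed (simp add: subspace_0[OF subspace_filt])
  have "x = a *\<^sub>R w_time + (u$1) *\<^sub>R l0 + (u$2) *\<^sub>R p2 + (u$3) *\<^sub>R p3 + (v$1) *\<^sub>R q1 + (v$2) *\<^sub>R q2 + (v$3) *\<^sub>R q3"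
    using x' by (simp add: e basis_defs vec_eq_iff forall_3 axis_def)
  then have "N x = a *\<^sub>R N w_time + (u$1) *\<^sub>R N l0 + (u$2) *\<^sub>R N p2 + (u$3) *\<^sub>R N p3 + (v$1) *\<^sub>R N q1 +
      (v$2) *\<^sub>R N q2 + (v$3) *\<^sub>R N q3"
    by (simp only: blinfun.add_right blinfun.scaleR_right)
  also have "\<dots> \<in> filt (i + k)"
    by (intro subspace_add[OF subspace_filt] step[OF w] step[OF l] step[OF p(1)] step[OF p(2)] step[OF q1]
        step[OF q(1)] step[OF q(2)]) (use x' in linarith)+
  finally show "N x \<in> filt (i + k)" .
qed

lemma subspace_shifts: "subspace (shifts k)"
  unfolding subspace_def shifts_def
  by (simp add: blinfun.add_left blinfun.scaleR_left subspace_0[OF subspace_filt] subspace_add[OF subspace_filt]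
      subspace_scale[OF subspace_filt])

lemma shifts_compose:
  assumes "A \<in> shifts j" "B \<in> shifts k"
  shows "A o\<^sub>L B \<in> shifts (j + k)"
proof -
  have "A (B x) \<in> filt (i + (j + k))" if "x \<in> filt i" for i x
    using shiftsD[OF assms(1) shiftsD[OF assms(2) that]] by (simp add: ac_simps)
  moreover have "A oone = 0" "B oone = 0" using assms by (simp_all add: shifts_def)
  ultimately show ?thesis by (simp add: shifts_def blinfun.zero_right)
qed

lemma shifts_comm: "A \<in> shifts j \<Longrightarrow> B \<in> shifts k \<Longrightarrow> comm A B \<in> shifts (j + k)"
  unfolding comm_def
  using subspace_diff[OF subspace_shifts] shifts_compose[of A j B k] shifts_compose[of B k A j] by (simp add: add.commute)

lemma shifts_antimono:
  assumes "j \<le> k"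
  shows "shifts k \<subseteq> shifts j"
proof
  fix N assume N: "N \<in> shifts k"
  have "N x \<in> filt (i + j)" if "x \<in> filt i" for i x
    using shiftsD[OF N that] filt_antimono[of "i + j" "i + k"] assms by auto
  with N show "N \<in> shifts j" by (simp add: shifts_def)
qed

lemma oct_imag_decomposition: "\<exists>y\<in>imag_oct. x = oinner x oone *\<^sub>R oone + y"
  by (rule bexI[of _ "x - oinner x oone *\<^sub>R oone"])
    (simp_all add: imag_oct_iff oinner.diff_left oinner.scaleR_left)

text \<open>Degrees range from -2 to 2, so a shift by more than 4 leaves the filtration.\<close>

lemma shifts_zero: "4 < k \<Longrightarrow> shifts k = {0}"
proof (intro subset_antisym subsetI)
  fix N assume k: "4 < k" and N: "N \<in> shifts k"
  have "N = 0"
  proof (rule blinfun_eqI)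
    fix x :: oct
    obtain y where y: "y \<in> imag_oct" "x = oinner x oone *\<^sub>R oone + y" using oct_imag_decomposition[of x] by blast
    have "N y \<in> filt (- 2 + k)" using N y(1) by (intro shiftsD) (simp_all add: filt_imag)
    then have "N y = 0" using k by (simp add: filt_zero)
    moreover have "N oone = 0" using N by (simp add: shifts_def)
    ultimately show "N x = blinfun_apply 0 x"
      by (subst y(2)) (simp add: blinfun.add_right blinfun.scaleR_right)
  qed
  then show "N \<in> {0}" by simp
qed (simp add: subspace_0[OF subspace_shifts])

section \<open>The nilradical of the parabolic subalgebra\<close>

lemma oinner_l0 [simp]: "oinner l0 l0 = 0" "oinner q2 l0 = 0" "oinner q3 l0 = 0" "oinner w_time l0 = 0"
  "oinner p2 l0 = 0" "oinner p3 l0 = 0" "oinner q1 l0 = - 1 / 2"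
  by (simp_all add: basis_defs inner_axis_axis)

lemma w_time_filt_1: "y \<in> filt 1 \<Longrightarrow> oinner w_time y = 0"
  unfolding filt_1_iff using oinner_commute by simp

lemma der_oinner_oone: "X \<in> der \<Longrightarrow> oinner (X x) oone = 0"
  using der_imag_oct imag_oct_iff by blast

text \<open>Degrees 2 and 1 are clear, \<open>filt 1\<close> being the annihilator of
  \<open>l0\<close>; skewness and duality give degrees 0 and -1.\<close>

lemma par_l0_shifts:
  fixes X :: octop
  assumes X: "X \<in> der" "X l0 = r *\<^sub>R l0"
  shows "X \<in> shifts 0"
proof (rule shiftsI)
  have l: "oinner (X y) l0 = - r * oinner y l0" for y
    using der_skew[OF X(1), of y l0] by (simp add: X(2) oinner.scaleR_right)
  have q: "X y \<in> filt 1" if "y \<in> filt 1" for y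
  proof -
    have "omult l0 (X y) = X (omult l0 y) - omult (X l0) y" by (simp add: der_omult[OF X(1)])
    then show ?thesis
      using that der_imag_oct[OF X(1)]
      by (simp add: filt_1_omult_iff X(2) omult.scaleR_left blinfun.zero_right)
  qed
  have w: "oinner (X w_time) y = 0" if "y \<in> filt 1" for y
    using der_skew[OF X(1), of w_time y] w_time_filt_1[OF q[OF that]] by simp
  show "X oone = 0" by (rule der_oone[OF X(1)])
  show "X l0 \<in> filt (2 + 0)" by (simp add: X(2) subspace_scale[OF subspace_filt] basis_in_filt)
  show "X q2 \<in> filt (1 + 0)" "X q3 \<in> filt (1 + 0)" using q basis_in_filt by auto
  show "X w_time \<in> filt 0"
    using w basis_in_filt by (simp add: filt_0_iff filt_m1_iff der_oinner_oone[OF X(1)] l)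
  show "X p2 \<in> filt (0 - 1)" "X p3 \<in> filt (0 - 1)"
    by (simp_all add: filt_m1_iff der_oinner_oone[OF X(1)] l)
  show "X q1 \<in> filt (0 - 2)" by (simp add: filt_imag der_imag_oct[OF X(1)])
qed

text \<open>Only degrees 2 and 1 are assumed. Skewness gives the lower ones, where in degree 0 it
  also makes \<open>X w_time\<close> orthogonal to \<open>w_time\<close>.\<close>

lemma nilpotent_shifts:
  fixes X :: octop
  assumes X: "X \<in> der" "X l0 = 0" "X q2 \<in> filt 2" "X q3 \<in> filt 2"
  shows "X \<in> shifts 1"
proof (rule shiftsI)
  have l: "oinner (X y) l0 = 0" for y
    using der_skew[OF X(1), of y l0] by (simp add: X(2) oinner.zero_right)
  have q: "oinner (X y) q2 = 0" "oinner (X y) q3 = 0" if "y \<in> filt (- 1)" for y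
  proof -
    have "oinner y z = 0" if "z \<in> filt 2" for z
      using that \<open>y \<in> filt (- 1)\<close> by (auto simp: filt_2_iff filt_m1_iff oinner.scaleR_right)
    then show "oinner (X y) q2 = 0" "oinner (X y) q3 = 0"
      using der_skew[OF X(1)] X(3,4) by simp_all
  qed
  have w: "oinner (X w_time) w_time = 0"
    using der_skew[OF X(1), of w_time w_time] oinner_commute[of w_time "X w_time"] by simp
  show "X oone = 0" by (rule der_oone[OF X(1)])
  show "X l0 \<in> filt (2 + 1)" by (simp add: X(2) subspace_0[OF subspace_filt])
  show "X q2 \<in> filt (1 + 1)" "X q3 \<in> filt (1 + 1)" using X(3,4) by simp_all
  have wm1: "w_time \<in> filt (- 1)" using basis_in_filt(4) filt_antimono[of "- 1" 0] by auto
  show "X w_time \<in> filt 1"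
    using q[OF wm1] w by (simp add: filt_1_iff filt_0_iff filt_m1_iff der_oinner_oone[OF X(1)] l)
  show "X p2 \<in> filt (1 - 1)" "X p3 \<in> filt (1 - 1)"
    using q basis_in_filt by (simp_all add: filt_0_iff filt_m1_iff der_oinner_oone[OF X(1)] l)
  show "X q1 \<in> filt (1 - 2)" by (simp add: filt_m1_iff der_oinner_oone[OF X(1)] l)
qed

definition nil0 :: "octop set" where "nil0 = der \<inter> shifts 1"

lemma shifts_1_l0: "X \<in> shifts 1 \<Longrightarrow> X l0 = 0"
  using shiftsD[OF _ basis_in_filt(1), of X 1] filt_zero[of 3] by simp

lemma l0_nonzero: "l0 \<noteq> 0"
  by (simp add: basis_defs zero_prod_def axis_eq_0_iff)

lemma par_l0: "par l0 = {X \<in> der. \<exists>r. X l0 = r *\<^sub>R l0}"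
  by (rule par_eq[OF l0_nonzero])

text \<open>Degrees add under brackets, so the series climbs until \<open>shifts_zero\<close> ends
  it.\<close>

lemma lower_central_nil0: "lower_central nil0 n \<subseteq> shifts (1 + int n)"
proof (induction n)
  case 0
  then show ?case by (simp add: nil0_def)
next
  case (Suc n)
  have "comm X Y \<in> shifts (1 + int (Suc n))" if "X \<in> nil0" "Y \<in> lower_central nil0 n" for X Y
    using shifts_comm[of X 1 Y "1 + int n"] that Suc by (auto simp: nil0_def add.assoc)
  then show ?case
    unfolding lower_central.simps by (intro span_minimal subspace_shifts) blast
qed

lemma nilpotent_ideal_nil0: "nilpotent_ideal (par l0) nil0"
  unfolding nilpotent_ideal_def
proof (intro conjI ballI)
  show "subspace nil0" unfolding nil0_def by (intro subspace_inter subspace_der subspace_shifts)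
  show "nil0 \<subseteq> par l0" unfolding par_l0 nil0_def using shifts_1_l0 by (auto intro!: exI[of _ 0])
  show "comm X Y \<in> nil0" if "X \<in> par l0" "Y \<in> nil0" for X Y
    using that par_l0_shifts shifts_comm[of X 0 Y 1] comm_der by (auto simp: par_l0 nil0_def)
  have "lower_central nil0 4 \<subseteq> {0}" using lower_central_nil0[of 4] shifts_zero[of 5] by simp
  moreover have "0 \<in> lower_central nil0 4" by (simp add: numeral_eq_Suc span_zero)
  ultimately show "\<exists>n. lower_central nil0 n = {0}" by blast
qed

section \<open>Trace-free matrices as derivations, and nilpotent 2 by 2 matrices\<close>

definition dsl_fun :: "real^3^3 \<Rightarrow> oct \<Rightarrow> oct" where
  "dsl_fun S = (\<lambda>(a, u, v, b). (0, S *v u, - (transpose S *v v), 0))"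

definition dsl :: "real^3^3 \<Rightarrow> octop" where
  "dsl S = Blinfun (dsl_fun S)"

lemma dsl_apply: "dsl S (a, u, v, b) = (0, S *v u, - (transpose S *v v), 0)"
proof -
  have "linear (dsl_fun S)"
    by (rule linearI) (auto simp: dsl_fun_def matrix_vector_right_distrib matrix_vector_mult_scaleR
        simp del: transpose_matrix_vector)
  then show ?thesis
    by (simp add: dsl_def bounded_linear_Blinfun_apply linear_conv_bounded_linear[symmetric] dsl_fun_def)
qed

text \<open>The infinitesimal version of \<open>sl3_op_G2\<close>: at the identity the cofactor
  matrix varies by minus the transpose, provided that the trace is zero.\<close>

lemma dsl_der:
  assumes tr: "S$1$1 + S$2$2 + S$3$3 = 0"
  shows "dsl S \<in> der"
  unfolding der_def
proof (intro CollectI allI)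
  fix x y :: oct
  obtain a u v b where x: "x = (a, u, v, b)" by (rule prod_cases4)
  obtain a' u' v' b' where y: "y = (a', u', v', b')" by (rule prod_cases4)
  have t: "S$3$3 = - S$1$1 - S$2$2" using tr by simp
  have 1: "(S *v u) \<bullet> v' = u \<bullet> (transpose S *v v')" for u v'
    by (simp add: matrix_vector_mult_def transpose_def inner_vec_def sum_3 algebra_simps)
  have 4: "v' \<bullet> (S *v u) = u \<bullet> (transpose S *v v')" for u v'
    using 1[of u v'] by (simp only: inner_commute)
  have 2: "S *v cross3 v v' = - cross3 (transpose S *v v) v' - cross3 v (transpose S *v v')" for v v'
    by (simp add: matrix_vector_mult_def transpose_def cross3_def vec_eq_iff forall_3 sum_3 vector_3 t)
      (simp add: algebra_simps)
  have 3: "transpose S *v cross3 v v' = - cross3 (S *v v) v' - cross3 v (S *v v')" for v v'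
    by (simp add: matrix_vector_mult_def transpose_def cross3_def vec_eq_iff forall_3 sum_3 vector_3 t)
      (simp add: algebra_simps)
  show "dsl S (omult x y) = omult (dsl S x) y + omult x (dsl S y)"
    by (simp add: x y dsl_apply 1 4 2 3 matrix_vector_right_distrib matrix_vector_mult_diff_distrib
        matrix_vector_mult_scaleR inner_commute cross_minus_left cross_minus_right
        del: transpose_matrix_vector)
qed

text \<open>A nonzero determinant would make all powers injective. With determinant zero, the
  Cayley-Hamilton identity says that \<open>f\<close> acts on its image as multiplication by the
  trace, so nilpotency forces the trace to vanish.\<close>

lemma nilpotent_pair_map:
  fixes a b c d :: real
  defines "f \<equiv> \<lambda>(x, y). (a * x + b * y, c * x + d * y)"
  assumes f0: "\<And>z. (f ^^ k) z = 0"
  shows "a + d = 0" "a * d - b * c = 0"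
proof -
  show det: "a * d - b * c = 0"
  proof (rule ccontr)
    assume nz: "\<not> ?thesis"
    have "z = 0" if "f z = 0" for z
    proof (cases z)
      case (Pair x y)
      then have "a * x + b * y = 0" "c * x + d * y = 0"
        using that by (simp_all add: f_def zero_prod_def)
      then have "(a * d - b * c) * x = 0" "(a * d - b * c) * y = 0" by algebra+
      then show ?thesis using nz by (simp add: Pair zero_prod_def)
    qed
    then have "z = 0" if "(f ^^ n) z = 0" for n z
      using that by (induction n) auto
    from this[OF f0[of "(1, 0)"]] show False by (simp add: zero_prod_def)
  qed
  have ff: "f (f z) = (a + d) *\<^sub>R f z" for z
  proof (cases z)
    case (Pair x y)
    have bc: "b * c = a * d" using det by simp
    show ?thesis
      unfolding Pair f_def using bc by (simp, algebra)
  qed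
  have scale: "f (r *\<^sub>R z) = r *\<^sub>R f z" for r z
    by (cases z) (simp add: f_def algebra_simps)
  have "(f ^^ Suc n) z = (a + d) ^ n *\<^sub>R f z" for n z
    by (induction n) (simp_all add: scale ff)
  moreover have "f 0 = 0" by (simp add: f_def zero_prod_def)
  then have "(f ^^ Suc k) z = 0" for z using f0 by simp
  ultimately have "(a + d) ^ k *\<^sub>R f z = 0" for z by metis
  from this[of "(1, 0)"] this[of "(0, 1)"] show "a + d = 0"
    by (auto simp: f_def zero_prod_def)
qed

text \<open>On \<open>filt 1\<close> the coordinates 2 and 3 are those with respect to \<open>q2\<close>, \<open>q3\<close> modulo \<open>filt 2\<close>.\<close>

definition vcoord :: "3 \<Rightarrow> oct \<Rightarrow> real" where
  "vcoord i x = fst (snd (snd x)) $ i"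

lemma vcoord_linear [simp]:
  "vcoord i (x + y) = vcoord i x + vcoord i y" "vcoord i (x - y) = vcoord i x - vcoord i y"
  "vcoord i (c *\<^sub>R x) = c * vcoord i x" "vcoord i (- x) = - vcoord i x" "vcoord i 0 = 0"
  by (simp_all add: vcoord_def)

lemma vcoord_basis [simp]:
  "vcoord i l0 = 0" "vcoord 1 q1 = 1" "vcoord 2 q1 = 0" "vcoord 3 q1 = 0" "vcoord 1 q2 = 0" "vcoord 2 q2 = 1"
  "vcoord 3 q2 = 0" "vcoord 1 q3 = 0" "vcoord 2 q3 = 0" "vcoord 3 q3 = 1"
  by (simp_all add: vcoord_def basis_defs axis_def)

lemma vcoord_filt_1: "y \<in> filt 1 \<Longrightarrow> \<exists>c. y = vcoord 2 y *\<^sub>R q2 + vcoord 3 y *\<^sub>R q3 + c *\<^sub>R l0"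
  by (rule filt_1E, assumption) auto

lemma vcoord_filt_2: "y \<in> filt 2 \<Longrightarrow> vcoord i y = 0"
  by (auto simp: filt_2_iff)

lemma filt_2_vcoord: "y \<in> filt 1 \<Longrightarrow> vcoord 2 y = 0 \<Longrightarrow> vcoord 3 y = 0 \<Longrightarrow> y \<in> filt 2"
  using vcoord_filt_1[of y] by (auto simp: filt_2_iff)

lemma vcoord_shift_0:
  assumes "X \<in> shifts 0" "y \<in> filt 1"
  shows "vcoord i (X y) = vcoord 2 y * vcoord i (X q2) + vcoord 3 y * vcoord i (X q3)"
proof -
  obtain c where "y = vcoord 2 y *\<^sub>R q2 + vcoord 3 y *\<^sub>R q3 + c *\<^sub>R l0"
    using vcoord_filt_1[OF assms(2)] by blast
  then have "X y = X (vcoord 2 y *\<^sub>R q2 + vcoord 3 y *\<^sub>R q3 + c *\<^sub>R l0)"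
    by (rule arg_cong)
  then have "X y = vcoord 2 y *\<^sub>R X q2 + vcoord 3 y *\<^sub>R X q3 + c *\<^sub>R X l0"
    by (simp only: blinfun.add_right blinfun.scaleR_right)
  moreover have "vcoord i (X l0) = 0"
    using shiftsD[OF assms(1) basis_in_filt(1)] by (intro vcoord_filt_2) simp
  ultimately show ?thesis by simp
qed

lemma omult_q [simp]: "omult q2 q3 = - l0" "omult q3 q2 = l0" "omult q2 q2 = 0" "omult q3 q3 = 0"
  "omult l0 q2 = 0" "omult l0 q3 = 0" "omult q2 l0 = 0" "omult q3 l0 = 0"
  by (simp_all add: basis_defs zero_prod_def cross_basis inner_axis_axis)

text \<open>Since \<open>q2\<close> and \<open>q3\<close> multiply to \<open>- l0\<close>, a
  derivation scales \<open>l0\<close> by the trace of its action on them.\<close>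

lemma par_l0_eigenvalue:
  assumes X: "X \<in> der" "X l0 = r *\<^sub>R l0"
  shows "r = vcoord 2 (X q2) + vcoord 3 (X q3)"
proof -
  have s: "X \<in> shifts 0" by (rule par_l0_shifts[OF X])
  have in1: "X q2 \<in> filt 1" "X q3 \<in> filt 1" using shiftsD[OF s] basis_in_filt(2,3) by (metis add_0_right)+
  obtain c d where c: "X q2 = vcoord 2 (X q2) *\<^sub>R q2 + vcoord 3 (X q2) *\<^sub>R q3 + c *\<^sub>R l0"
    and d: "X q3 = vcoord 2 (X q3) *\<^sub>R q2 + vcoord 3 (X q3) *\<^sub>R q3 + d *\<^sub>R l0"
    using in1[THEN vcoord_filt_1] by blast
  have "omult (X q2) q3 = - (vcoord 2 (X q2) *\<^sub>R l0)"
    by (subst c) (simp add: omult.add_left omult.scaleR_left)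
  moreover have "omult q2 (X q3) = - (vcoord 3 (X q3) *\<^sub>R l0)"
    by (subst d) (simp add: omult.add_right omult.scaleR_right)
  moreover have "X (- l0) = omult (X q2) q3 + omult q2 (X q3)"
    using der_omult[OF X(1), of q2 q3] by (simp)
  ultimately have "- (r *\<^sub>R l0) = - ((vcoord 2 (X q2) + vcoord 3 (X q3)) *\<^sub>R l0)"
    by (simp add: X(2) blinfun.minus_right scaleR_add_left)
  then have "r *\<^sub>R l0 = (vcoord 2 (X q2) + vcoord 3 (X q3)) *\<^sub>R l0"
    by (simp only: neg_equal_iff_equal)
  then show ?thesis using l0_nonzero by simp
qed

text \<open>\<open>q1\<close> is dual to \<open>l0\<close>, so skewness gives it the opposite
  eigenvalue modulo the complement of \<open>l0\<close>.\<close>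

lemma par_l0_q1:
  assumes X: "X \<in> der" "X l0 = r *\<^sub>R l0"
  shows "\<exists>y\<in>filt (- 1). X q1 = - r *\<^sub>R q1 + y"
proof
  have "oinner (X q1) l0 = r / 2"
    using der_skew[OF X(1), of q1 l0] by (simp add: X(2) oinner.scaleR_right)
  then show "X q1 + r *\<^sub>R q1 \<in> filt (- 1)"
    using basis_in_filt(7) by (simp add: filt_m1_iff filt_imag imag_oct_iff oinner.add_left oinner.scaleR_left
        der_oinner_oone[OF X(1)])
qed simp

text \<open>Derivations of the top degree 3, parametrised by the image
  \<open>x *\<^sub>R q2 + y *\<^sub>R q3\<close> of \<open>q1\<close>.\<close>

definition sigma :: "real \<Rightarrow> real \<Rightarrow> octop" where
  "sigma x y = dsl (vector [vector [0, - x, - y], 0, 0])"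

lemma sigma_apply: "sigma x y (a, u, v, b) = (0, vector [- x * u$2 - y * u$3, 0, 0], vector [0, x * v$1, y * v$1], 0)"
proof -
  let ?S = "vector [vector [0, - x, - y], 0, 0] :: real^3^3"
  have "?S *v u = vector [- x * u$2 - y * u$3, 0, 0]"
    by (simp add: matrix_vector_mult_def sum_3 vec_eq_iff forall_3 vector_3)
  moreover have "- (transpose ?S *v v) = vector [0, x * v$1, y * v$1]"
    unfolding matrix_vector_mult_def transpose_def
    by (simp add: sum_3 vec_eq_iff forall_3 vector_3)
  ultimately show ?thesis by (simp only: sigma_def dsl_apply)
qed

lemma sigma_q1: "sigma x y q1 = x *\<^sub>R q2 + y *\<^sub>R q3"
  unfolding q1_def q2_def q3_def sigma_apply by (simp add: vec_eq_iff forall_3 vector_3 axis_def)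

lemma sigma_der: "sigma x y \<in> der"
  unfolding sigma_def by (rule dsl_der) (simp add: vector_3)

lemma sigma_shifts: "sigma x y \<in> shifts 3"
  by (rule shiftsI; unfold basis_defs oone_def sigma_apply filt_def)
    (simp_all add: zero_prod_def vec_eq_iff forall_3 vector_3 axis_def)

text \<open>If \<open>B\<close> is the matrix of \<open>X\<close> on \<open>filt 1 / filt 2\<close>, then the bracket with \<open>X\<close> acts on the \<open>sigma x y\<close>, which form an
  ideal, as \<open>B + tr B\<close>. This matrix is nilpotent, so its trace \<open>3 tr B\<close> and its determinant vanish.\<close>

lemma nilpotent_ideal_trace_det:
  assumes I: "nilpotent_ideal (par l0) I" and X: "X \<in> I"
  shows "X l0 = 0" "vcoord 2 (X q2) + vcoord 3 (X q3) = 0"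
    "vcoord 2 (X q2) * vcoord 3 (X q3) - vcoord 2 (X q3) * vcoord 3 (X q2) = 0"
proof -
  obtain k where k: "lower_central I k = {0}" using I unfolding nilpotent_ideal_def by blast
  have Xp: "X \<in> par l0" using I X unfolding nilpotent_ideal_def by blast
  then obtain r where der: "X \<in> der" and r: "X l0 = r *\<^sub>R l0" unfolding par_l0 by blast
  have s: "X \<in> shifts 0" by (rule par_l0_shifts[OF der r])
  obtain y1 where y1: "y1 \<in> filt (- 1)" "X q1 = - r *\<^sub>R q1 + y1" using par_l0_q1[OF der r] by blast
  \<comment> \<open>The bracket also subtracts the action on \<open>q1\<close>, which is
    \<open>- r\<close> modulo \<open>filt (- 1)\<close>; this adds \<open>r\<close> on the
    diagonal.\<close>
  define a b c d where "a = vcoord 2 (X q2) + r" and "b = vcoord 2 (X q3)"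
    and "c = vcoord 3 (X q2)" and "d = vcoord 3 (X q3) + r"
  define f where "f = (\<lambda>(x, y). (a * x + b * y, c * x + d * y))"
  have f0: "(f ^^ Suc k) z = 0" for z
  proof -
    define Y where "Y n = ((\<lambda>Y. comm X Y) ^^ n) (sigma (fst z) (snd z))" for n
    have Ys: "Y n \<in> shifts 3" for n
      by (induction n) (use sigma_shifts shifts_comm[OF s, of _ 3] in \<open>auto simp: Y_def\<close>)
    have Yf: "(vcoord 2 (Y n q1), vcoord 3 (Y n q1)) = (f ^^ n) z" for n
    proof (induction n)
      case 0
      then show ?case by (simp add: Y_def sigma_q1)
    next
      case (Suc n)
      have in1: "Y n q1 \<in> filt 1" using shiftsD[OF Ys basis_in_filt(7), of n] by simp
      have "Y n y1 \<in> filt 2" using shiftsD[OF Ys y1(1), of n] by simp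
      then have "vcoord i (Y n (X q1)) = - r * vcoord i (Y n q1)" for i
        by (simp add: y1(2) blinfun.add_right blinfun.diff_right blinfun.scaleR_right blinfun.minus_right vcoord_filt_2)
      moreover have "Y (Suc n) q1 = X (Y n q1) - Y n (X q1)" by (simp add: Y_def comm_apply)
      ultimately have "vcoord i (Y (Suc n) q1) =
          vcoord 2 (Y n q1) * vcoord i (X q2) + vcoord 3 (Y n q1) * vcoord i (X q3) + r * vcoord i (Y n q1)" for i
        by (simp add: vcoord_shift_0[OF s in1])
      then have "(vcoord 2 (Y (Suc n) q1), vcoord 3 (Y (Suc n) q1)) = f (vcoord 2 (Y n q1), vcoord 3 (Y n q1))"
        by (simp add: f_def a_def b_def c_def d_def algebra_simps)
      then show ?case by (simp add: Suc)
    qed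
    \<comment> \<open>The index is shifted because \<open>sigma\<close> need not lie in
      \<open>I\<close>: only after the first bracket with \<open>X\<close> is one inside the
      ideal.\<close>
    have "Y (Suc n) \<in> lower_central I n" for n
    proof (induction n)
      case 0
      have "comm (sigma (fst z) (snd z)) X \<in> I"
      proof -
        have "sigma (fst z) (snd z) l0 = 0"
          using shiftsD[OF sigma_shifts basis_in_filt(1), of "fst z" "snd z"] by (simp add: filt_zero)
        then have "sigma (fst z) (snd z) \<in> par l0" using sigma_der unfolding par_l0 by (auto intro: exI[of _ 0])
        then show ?thesis using I X unfolding nilpotent_ideal_def by blast
      qed
      moreover have "comm X (sigma (fst z) (snd z)) = - comm (sigma (fst z) (snd z)) X" by (simp add: comm_def)
      moreover have "subspace I" using I unfolding nilpotent_ideal_def by blast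
      ultimately show ?case by (simp add: Y_def subspace_neg)
    next
      case (Suc n)
      have "Y (Suc (Suc n)) = comm X (Y (Suc n))" by (simp add: Y_def)
      then show ?case using X Suc by (auto intro!: span_base)
    qed
    then have "Y (Suc k) = 0" using k by blast
    then have "vcoord i (Y (Suc k) q1) = 0" for i by simp
    then show ?thesis unfolding Yf[of "Suc k", symmetric] by (simp only: zero_prod_def)
  qed
  have *: "a + d = 0" "a * d - b * c = 0"
    using nilpotent_pair_map[where k = "Suc k" and a = a and b = b and c = c and d = d] f0 unfolding f_def by blast+
  have "r = vcoord 2 (X q2) + vcoord 3 (X q3)" by (rule par_l0_eigenvalue[OF der r])
  then have "r = 0" using *(1) by (simp add: a_def d_def)
  then show "X l0 = 0" "vcoord 2 (X q2) + vcoord 3 (X q3) = 0"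
    "vcoord 2 (X q2) * vcoord 3 (X q3) - vcoord 2 (X q3) * vcoord 3 (X q2) = 0"
    using r * by (simp_all add: a_def b_def c_def d_def)
qed

text \<open>The two nilpotent generators of sl(2, R) acting on the span of \<open>q2\<close> and
  \<open>q3\<close>.\<close>

definition dE :: octop where "dE = dsl (vector [0, vector [0, 0, 1], 0])"
definition dF :: octop where "dF = dsl (vector [0, 0, vector [0, 1, 0]])"

lemma dE_dF_apply: "dE (a, u, v, b) = (0, vector [0, u$3, 0], vector [0, 0, - v$2], 0)"
  "dF (a, u, v, b) = (0, vector [0, 0, u$2], vector [0, - v$3, 0], 0)"
proof -
  let ?E = "vector [0, vector [0, 0, 1], 0] :: real^3^3" and ?F = "vector [0, 0, vector [0, 1, 0]] :: real^3^3"
  have "?E *v u = vector [0, u$3, 0]" "?F *v u = vector [0, 0, u$2]"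
    by (simp_all add: matrix_vector_mult_def sum_3 vec_eq_iff forall_3 vector_3)
  moreover have "- (transpose ?E *v v) = vector [0, 0, - v$2]" "- (transpose ?F *v v) = vector [0, - v$3, 0]"
    unfolding matrix_vector_mult_def transpose_def
    by (simp_all add: sum_3 vec_eq_iff forall_3 vector_3)
  ultimately show "dE (a, u, v, b) = (0, vector [0, u$3, 0], vector [0, 0, - v$2], 0)"
    "dF (a, u, v, b) = (0, vector [0, 0, u$2], vector [0, - v$3, 0], 0)"
    by (simp_all only: dE_def dF_def dsl_apply)
qed

lemma dE_dF_par: "dE \<in> par l0" "dF \<in> par l0"
proof -
  have "dE \<in> der" "dF \<in> der"
    unfolding dE_def dF_def by (rule dsl_der, simp add: vector_3)+
  moreover have "dE l0 = 0 *\<^sub>R l0" "dF l0 = 0 *\<^sub>R l0"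
    unfolding l0_def dE_dF_apply by (simp_all add: zero_prod_def vec_eq_iff forall_3 vector_3 axis_def)
  ultimately show "dE \<in> par l0" "dF \<in> par l0" unfolding par_l0 by blast+
qed

lemma dE_dF_q: "dE q2 = - q3" "dE q3 = 0" "dF q2 = 0" "dF q3 = - q2"
  unfolding q2_def q3_def dE_dF_apply by (simp_all add: zero_prod_def vec_eq_iff forall_3 vector_3 axis_def)

text \<open>The brackets of \<open>X\<close> with \<open>dE\<close> and \<open>dF\<close> stay in
  the ideal, and their induced matrices have determinants \<open>- b * b\<close> and
  \<open>- c * c\<close>. So the off-diagonal entries of \<open>X\<close> vanish, after which trace
  and determinant zero leave nothing on the diagonal.\<close>

lemma nilpotent_ideal_subset_nil0:
  assumes I: "nilpotent_ideal (par l0) I"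
  shows "I \<subseteq> nil0"
proof
  fix X assume X: "X \<in> I"
  have "X \<in> par l0" using I X unfolding nilpotent_ideal_def by blast
  then have der: "X \<in> der" unfolding par_l0 by blast
  have l: "X l0 = 0 *\<^sub>R l0" using nilpotent_ideal_trace_det(1)[OF I X] by simp
  have s: "X \<in> shifts 0" by (rule par_l0_shifts[OF der l])
  have sE: "dE \<in> shifts 0" "dF \<in> shifts 0"
    using dE_dF_par par_l0_shifts unfolding par_l0 by blast+
  have in1: "X q2 \<in> filt 1" "X q3 \<in> filt 1" using shiftsD[OF s] basis_in_filt(2,3) by (metis add_0_right)+
  define a b c d where "a = vcoord 2 (X q2)" and "b = vcoord 2 (X q3)" and "c = vcoord 3 (X q2)" and "d = vcoord 3 (X q3)"
  have tr: "a + d = 0" and det: "a * d - b * c = 0"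
    using nilpotent_ideal_trace_det[OF I X] by (simp_all add: a_def b_def c_def d_def)
  have EI: "comm dE X \<in> I" "comm dF X \<in> I" using I X dE_dF_par unfolding nilpotent_ideal_def by blast+
  have Eq: "vcoord i (comm dE X q2) = a * vcoord i (- q3) + vcoord i (X q3)"
    "vcoord i (comm dE X q3) = b * vcoord i (- q3)"
    "vcoord i (comm dF X q2) = c * vcoord i (- q2)"
    "vcoord i (comm dF X q3) = d * vcoord i (- q2) + vcoord i (X q2)" for i
    by (simp_all add: comm_apply dE_dF_q vcoord_shift_0[OF sE(1) in1(1)] vcoord_shift_0[OF sE(1) in1(2)]
        vcoord_shift_0[OF sE(2) in1(1)] vcoord_shift_0[OF sE(2) in1(2)] blinfun.minus_right blinfun.zero_right
        a_def b_def c_def d_def)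
  have "b = 0"
    using nilpotent_ideal_trace_det(3)[OF I EI(1)] unfolding Eq
    by (simp flip: a_def b_def c_def d_def)
  moreover have "c = 0"
    using nilpotent_ideal_trace_det(3)[OF I EI(2)] unfolding Eq
    by (simp flip: a_def b_def c_def d_def)
  ultimately have "a = 0" "d = 0" using tr det by (auto simp: add_eq_0_iff)
  with \<open>b = 0\<close> \<open>c = 0\<close> have "X q2 \<in> filt 2" "X q3 \<in> filt 2"
    using filt_2_vcoord[OF in1(1)] filt_2_vcoord[OF in1(2)] by (simp_all add: a_def b_def c_def d_def)
  then have "X \<in> shifts 1" using nilpotent_shifts[OF der] l by simp
  with der show "X \<in> nil0" by (simp add: nil0_def)
qed

lemma par_plus_l0: "par_plus l0 = nil0"
proof
  have "subspace nil0" using nilpotent_ideal_nil0 unfolding nilpotent_ideal_def by blast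
  then show "par_plus l0 \<subseteq> nil0"
    unfolding par_plus_def nilradical_def using nilpotent_ideal_subset_nil0 by (intro span_minimal) blast+
  show "nil0 \<subseteq> par_plus l0"
    unfolding par_plus_def nilradical_def
    by (rule subset_trans[OF _ span_superset], rule Union_upper) (simp add: nilpotent_ideal_nil0)
qed

section \<open>The unipotent group\<close>

definition uni0 :: "octop set" where
  "uni0 = {g \<in> carrier G2. g - id_blinfun \<in> shifts 1}"

text \<open>The group version of \<open>nilpotent_shifts\<close>, with skewness replaced by the
  identity \<open>iso\<close>.\<close>

lemma unipotent_shifts:
  fixes g :: octop
  assumes g: "g \<in> carrier G2" "g l0 = l0" "g q2 - q2 \<in> filt 2" "g q3 - q3 \<in> filt 2"
  shows "g \<in> uni0"
proof -
  have iso: "oinner (g x - x) y = oinner (g x) (y - g y)" for x y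
    using G2_oinner[OF g(1), of x y] by (simp add: oinner.diff_left oinner.diff_right)
  have l: "oinner (g x - x) l0 = 0" for x
    by (simp add: iso g(2) oinner.zero_right)
  have q: "oinner (g x - x) q2 = 0" "oinner (g x - x) q3 = 0" if "x \<in> filt (- 1)" for x
  proof -
    have "oinner (g x) l0 = 0"
      using l[of x] that by (simp add: oinner.diff_left filt_m1_iff)
    moreover have "y - g y = - (g y - y)" for y by simp
    ultimately have "oinner (g x) (y - g y) = 0" if "g y - y \<in> filt 2" for y
      using that by (auto simp only: filt_2_iff oinner.scaleR_right oinner.minus_right scaleR_zero_right neg_equal_0_iff_equal)
    then show "oinner (g x - x) q2 = 0" "oinner (g x - x) q3 = 0"
      using g(3,4) by (simp_all only: iso)
  qed
  have one: "oinner (g x - x) oone = 0" for x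
    using G2_oinner[OF g(1), of x oone] by (simp add: G2_apply_oone[OF g(1)] oinner.diff_left)
  have wm1: "w_time \<in> filt (- 1)" using basis_in_filt(4) filt_antimono[of "- 1" 0] by auto
  have w0: "g w_time - w_time \<in> filt 0"
    using q[OF wm1] by (simp add: filt_0_iff filt_m1_iff one l)
  \<comment> \<open>The relation \<open>omult w_time q2 = - q2\<close> survives under
    \<open>g\<close> and determines the diagonal entries of \<open>g w_time\<close>.\<close>
  have w1: "g w_time - w_time \<in> filt 1"
  proof -
    obtain c where c: "g q2 = q2 + c *\<^sub>R l0" using g(3) by (auto simp: filt_2_iff algebra_simps)
    obtain a u v b where e: "g w_time = (a, u, v, b)" by (rule prod_cases4)
    have w0': "(a, u, v, b) - w_time \<in> filt 0" using w0 unfolding e .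
    then have uv: "u$2 = 0" "u$3 = 0" "v$1 = 0"
      by (simp_all add: basis_defs filt_def)
    have "omult w_time q2 = - q2" by (simp add: basis_defs)
    then have "omult (g w_time) (g q2) = - g q2"
      using G2_apply_omult[OF g(1), of w_time q2] by (simp add: blinfun.minus_right)
    then have "vcoord 2 (omult (g w_time) (g q2)) = - 1" by (simp add: c)
    moreover have gq: "g q2 = (0, c *\<^sub>R e1, axis 2 1, 0)" unfolding c by (simp add: basis_defs)
    ultimately have "vcoord 2 (omult (a, u, v, b) (0, c *\<^sub>R e1, axis 2 1, 0)) = - 1" by (simp only: e gq)
    then have "b = - 1"
      by (simp add: vcoord_def cross3_def vector_3 uv axis_def)
    moreover have "a + b = 0" using w0' by (simp add: basis_defs filt_def)
    ultimately have "(a, u, v, b) - w_time \<in> filt 1" using uv by (simp add: basis_defs filt_def)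
    then show ?thesis unfolding e .
  qed
  have "g - id_blinfun \<in> shifts 1"
    using q basis_in_filt g(2-4) w1 filt_subset_imag
    by (intro shiftsI) (simp_all add: blinfun.diff_left G2_apply_oone[OF g(1)] subspace_0[OF subspace_filt]
        filt_0_iff filt_m1_iff one l)
  with g(1) show ?thesis by (simp add: uni0_def)
qed

lemma uni0_iff:
  "g \<in> uni0 \<longleftrightarrow> g \<in> carrier G2 \<and> g l0 = l0 \<and> g q2 - q2 \<in> filt 2 \<and> g q3 - q3 \<in> filt 2"
proof
  assume g: "g \<in> uni0"
  then have N: "g - id_blinfun \<in> shifts 1" by (simp add: uni0_def)
  show "g \<in> carrier G2 \<and> g l0 = l0 \<and> g q2 - q2 \<in> filt 2 \<and> g q3 - q3 \<in> filt 2"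
    using shifts_1_l0[OF N] shiftsD[OF N basis_in_filt(2)] shiftsD[OF N basis_in_filt(3)] g
    by (simp add: blinfun.diff_left uni0_def)
qed (use unipotent_shifts in blast)

lemma op_exp_nil0:
  assumes X: "X \<in> nil0"
  shows "op_exp X \<in> uni0"
proof -
  have der: "X \<in> der" and s: "X \<in> shifts 1" using X by (auto simp: nil0_def)
  have l: "X l0 = 0" by (rule shifts_1_l0[OF s])
  have q: "op_exp X y - y \<in> filt 2" if y: "y \<in> filt 1" for y
  proof -
    have Xy: "X y \<in> filt 2" using shiftsD[OF s y] by simp
    then have XX: "X (X y) = 0" by (auto simp: filt_2_iff blinfun.scaleR_right l)
    \<comment> \<open>As \<open>X\<close> maps \<open>filt 1\<close> into the line of
      \<open>l0\<close>, which it kills, the exponential is affine in time there.\<close>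
    have "transported {} 0 1 (\<lambda>_. X) (\<lambda>t. y + t *\<^sub>R X y)"
      unfolding transported_def
    proof (intro conjI ballI)
      show "continuous_on {0..1} (\<lambda>t. y + t *\<^sub>R X y)" by (intro continuous_intros)
      show "((\<lambda>t. y + t *\<^sub>R X y) has_vector_derivative X (y + t *\<^sub>R X y)) (at t)" for t
        by (auto intro!: derivative_eq_intros simp: has_vector_derivative_def blinfun.add_right blinfun.scaleR_right XX)
    qed
    from op_exp_unique[OF der this] have "op_exp X y = y + X y" by simp
    then show ?thesis using Xy by simp
  qed
  have "op_exp X l0 = l0" using op_exp_eigenvector[OF der, of l0 0] l by simp
  then show ?thesis using op_exp_in_G2[OF der] q basis_in_filt unfolding uni0_iff by blast
qed

section \<open>Exponentials and logarithms of unipotent operators\<close>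

lemma shifts_1_power_5:
  assumes "N \<in> shifts 1"
  shows "N (N (N (N (N x)))) = 0"
proof -
  have "N o\<^sub>L (N o\<^sub>L (N o\<^sub>L (N o\<^sub>L N))) \<in> shifts (1 + (1 + (1 + (1 + 1))))"
    by (intro shifts_compose assms)
  then have "N o\<^sub>L (N o\<^sub>L (N o\<^sub>L (N o\<^sub>L N))) = 0" using shifts_zero[of 5] by simp
  from arg_cong[OF this, of "\<lambda>A. blinfun_apply A x"] show ?thesis by simp
qed

lemma op_exp_shifts_1:
  assumes "X \<in> shifts 1"
  shows "op_exp X x = x + X x + (1/2) *\<^sub>R X (X x) + (1/6) *\<^sub>R X (X (X x)) + (1/24) *\<^sub>R X (X (X (X x)))"
proof -
  have "(blinfun_apply X ^^ n) x = 0" if "n \<notin> {..<5}" for n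
  proof -
    obtain m where "n = m + 5" using \<open>n \<notin> {..<5}\<close> by (metis add.commute le_Suc_ex lessThan_iff not_le)
    moreover have "(blinfun_apply X ^^ 5) x = 0"
      using shifts_1_power_5[OF assms, of x] by (simp add: eval_nat_numeral)
    moreover have "(blinfun_apply X ^^ m) 0 = 0" by (induction m) (simp_all add: blinfun.zero_right)
    ultimately show ?thesis by (simp only: funpow_add comp_def)
  qed
  then have "(\<lambda>n. (1 / fact n) *\<^sub>R (blinfun_apply X ^^ n) x) sums (\<Sum>n<5. (1 / fact n) *\<^sub>R (blinfun_apply X ^^ n) x)"
    by (intro sums_finite) auto
  then have "op_exp X x = (\<Sum>n<5. (1 / fact n) *\<^sub>R (blinfun_apply X ^^ n) x)"
    using op_exp_apply_sums[of X x] sums_unique2 by blast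
  then show ?thesis by (simp add: eval_nat_numeral)
qed

text \<open>The linear coefficient of \<open>binpoly k\<close> is the coefficient of \<open>N\<^sup>k\<close> in the logarithm of \<open>1 + N\<close>.\<close>

definition binpoly :: "nat \<Rightarrow> real poly" where
  "binpoly k = smult (1 / fact k) (\<Prod>i<k. [:- real i, 1:])"

lemma poly_binpoly: "poly (binpoly k) (real m) = real (m choose k)"
  by (simp add: binpoly_def poly_prod binomial_gbinomial gbinomial_prod_rev atLeast0LessThan)

lemma coeff_binpoly_0: "coeff (binpoly k) 0 = (if k = 0 then 1 else 0)"
  by (simp add: binpoly_def poly_0_coeff_0[symmetric] poly_prod)

lemma coeff_binpoly_1: "coeff (binpoly 0) 1 = 0" "coeff (binpoly 1) 1 = 1" "coeff (binpoly 2) 1 = - 1 / 2"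
  "coeff (binpoly 3) 1 = 1 / 3" "coeff (binpoly 4) 1 = - 1 / 4"
  by (simp_all add: binpoly_def eval_nat_numeral)

text \<open>The logarithm of the identity plus \<open>N\<close>, broken off at the fourth power
  because the fifth is zero on \<open>shifts 1\<close>.\<close>

definition unilog :: "octop \<Rightarrow> octop" where
  "unilog N = N - (1/2) *\<^sub>R (N o\<^sub>L N) + (1/3) *\<^sub>R (N o\<^sub>L N o\<^sub>L N) - (1/4) *\<^sub>R (N o\<^sub>L N o\<^sub>L N o\<^sub>L N)"

lemma unilog_apply:
  "unilog N x = N x - (1/2) *\<^sub>R N (N x) + (1/3) *\<^sub>R N (N (N x)) - (1/4) *\<^sub>R N (N (N (N x)))"
  by (simp add: unilog_def blinfun.add_left blinfun.diff_left blinfun.scaleR_left)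

lemma unilog_eq_sum: "unilog N x = (\<Sum>k<5. coeff (binpoly k) 1 *\<^sub>R (blinfun_apply N ^^ k) x)"
proof -
  have "{..<5} = {0, 1, 2, 3, 4 :: nat}" by auto
  then have "(\<Sum>k<5. coeff (binpoly k) 1 *\<^sub>R (blinfun_apply N ^^ k) x) =
    coeff (binpoly 0) 1 *\<^sub>R (blinfun_apply N ^^ 0) x + coeff (binpoly 1) 1 *\<^sub>R (blinfun_apply N ^^ 1) x +
    coeff (binpoly 2) 1 *\<^sub>R (blinfun_apply N ^^ 2) x + coeff (binpoly 3) 1 *\<^sub>R (blinfun_apply N ^^ 3) x +
    coeff (binpoly 4) 1 *\<^sub>R (blinfun_apply N ^^ 4) x"
    by simp
  then show ?thesis
    unfolding coeff_binpoly_1 unilog_apply by (simp add: eval_nat_numeral)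
qed

lemma unilog_shifts: "N \<in> shifts 1 \<Longrightarrow> unilog N \<in> shifts 1"
proof -
  assume N: "N \<in> shifts 1"
  have "N o\<^sub>L N \<in> shifts 2" using shifts_compose[OF N N] by simp
  moreover from this have "N o\<^sub>L N o\<^sub>L N \<in> shifts 3" using shifts_compose[OF _ N, of _ 2] by simp
  moreover from this have "N o\<^sub>L N o\<^sub>L N o\<^sub>L N \<in> shifts 4" using shifts_compose[OF _ N, of _ 3] by simp
  ultimately show ?thesis
    using N shifts_antimono[of 1 2] shifts_antimono[of 1 3] shifts_antimono[of 1 4] unfolding unilog_def
    by (intro subspace_add[OF subspace_shifts] subspace_diff[OF subspace_shifts] subspace_scale[OF subspace_shifts]) auto
qed

lemma op_exp_unilog:
  assumes N: "N \<in> shifts 1"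
  shows "op_exp (unilog N) = id_blinfun + N"
proof (rule blinfun_eqI)
  fix x :: oct
  \<comment> \<open>Recording only the coefficients of the powers of \<open>N\<close> reduces the
    identity to rational arithmetic.\<close>
  define V where "V a b c d = a *\<^sub>R N x + b *\<^sub>R N (N x) + c *\<^sub>R N (N (N x)) + d *\<^sub>R N (N (N (N x)))" for a b c d
  have add: "V a b c d + V a' b' c' d' = V (a + a') (b + b') (c + c') (d + d')" for a b c d a' b' c' d'
    by (simp add: V_def algebra_simps)
  have scale: "r *\<^sub>R V a b c d = V (r * a) (r * b) (r * c) (r * d)" for r a b c d
    by (simp add: V_def algebra_simps)
  have NV: "N (V a b c d) = V 0 a b c" for a b c d
    by (simp add: V_def blinfun.add_right blinfun.scaleR_right shifts_1_power_5[OF N])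
  have X: "unilog N x = V 1 (- 1 / 2) (1 / 3) (- 1 / 4)"
    by (simp add: unilog_apply V_def)
  have "unilog N (V a b c d) = V 0 a (b - a / 2) (c - b / 2 + a / 3)" for a b c d
  proof -
    have "unilog N (V a b c d) = V 0 a b c + (- 1/2) *\<^sub>R V 0 0 a b + (1/3) *\<^sub>R V 0 0 0 a + (- 1/4) *\<^sub>R V 0 0 0 0"
      by (simp add: unilog_apply NV)
    then show ?thesis by (simp add: add scale)
  qed
  then have "op_exp (unilog N) x = x + V 1 0 0 0"
    unfolding op_exp_shifts_1[OF unilog_shifts[OF N]] by (simp add: X add scale add.assoc)
  then show "op_exp (unilog N) x = (id_blinfun + N) x" by (simp add: V_def blinfun.add_left)
qed

lemma unipotent_power:
  assumes N: "N \<in> shifts 1" and g: "g = id_blinfun + N"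
  shows "(blinfun_apply g ^^ m) x = (\<Sum>k<5. real (m choose k) *\<^sub>R (blinfun_apply N ^^ k) x)"
proof (induction m)
  case 0
  then show ?case by (simp add: eval_nat_numeral)
next
  case (Suc m)
  have "(blinfun_apply g ^^ Suc m) x = (\<Sum>k<5. real (m choose k) *\<^sub>R (blinfun_apply N ^^ k) x) +
      N (\<Sum>k<5. real (m choose k) *\<^sub>R (blinfun_apply N ^^ k) x)"
    by (simp add: Suc) (simp add: g blinfun.add_left)
  also have "\<dots> = (\<Sum>k<5. real (Suc m choose k) *\<^sub>R (blinfun_apply N ^^ k) x)"
    by (simp add: eval_nat_numeral blinfun.add_right blinfun.scaleR_right shifts_1_power_5[OF N] scaleR_add_left)
  finally show ?case .
qed

lemma G2_power_omult:
  "g \<in> carrier G2 \<Longrightarrow> (blinfun_apply g ^^ m) (omult x y) = omult ((blinfun_apply g ^^ m) x) ((blinfun_apply g ^^ m) y)"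
  by (induction m) (simp_all add: G2_apply_omult)

text \<open>The powers \<open>g\<^sup>m\<close> are automorphisms and polynomial in \<open>m\<close>; comparing linear coefficients shows
  that the logarithm is a derivation.\<close>

lemma unilog_der:
  assumes g: "g \<in> carrier G2" and N: "N \<in> shifts 1" "g = id_blinfun + N"
  shows "unilog N \<in> der"
  unfolding der_def
proof (intro CollectI allI)
  fix x y
  let ?n = "\<lambda>k x. (blinfun_apply N ^^ k) x"
  show "unilog N (omult x y) = omult (unilog N x) y + omult x (unilog N y)"
  proof (rule euclidean_eqI)
    fix b :: oct
    \<comment> \<open>The \<open>b\<close> component of the defect of multiplicativity of the
      \<open>m\<close>-th power of \<open>g\<close>, as a polynomial in \<open>m\<close>; it
      vanishes at all natural numbers and so identically.\<close>
    define Q where "Q = (\<Sum>k<5. smult (?n k (omult x y) \<bullet> b) (binpoly k)) -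
      (\<Sum>i<5. \<Sum>j<5. smult (omult (?n i x) (?n j y) \<bullet> b) (binpoly i * binpoly j))"
    have "poly Q (real m) = 0" for m
    proof -
      have 1: "(blinfun_apply g ^^ m) z = (\<Sum>k<5. poly (binpoly k) (real m) *\<^sub>R ?n k z)" for z
        using unipotent_power[OF N] by (simp add: poly_binpoly)
      have "omult ((blinfun_apply g ^^ m) x) ((blinfun_apply g ^^ m) y) \<bullet> b =
          (\<Sum>i<5. \<Sum>j<5. poly (binpoly i) (real m) * (poly (binpoly j) (real m) * (omult (?n i x) (?n j y) \<bullet> b)))"
        unfolding 1
        by (simp add: omult.sum_left omult.sum_right omult.scaleR_left omult.scaleR_right inner_sum_left sum_distrib_left)
          (subst sum.swap, simp add: mult_ac)
      moreover have "(blinfun_apply g ^^ m) (omult x y) \<bullet> b = (\<Sum>k<5. poly (binpoly k) (real m) * (?n k (omult x y) \<bullet> b))"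
        unfolding 1 by (simp add: inner_sum_left)
      ultimately show ?thesis
        using G2_power_omult[OF g, of m x y] by (simp add: Q_def poly_sum mult_ac)
    qed
    then have "range real \<subseteq> {t. poly Q t = 0}" by auto
    moreover have "infinite (range real)" by (simp add: finite_image_iff inj_on_def)
    ultimately have "infinite {t. poly Q t = 0}" using finite_subset by blast
    then have "Q = 0" using poly_roots_finite by blast
    then have "coeff Q 1 = 0" by simp
    \<comment> \<open>Only products with one factor of index 0 have a linear term; what remains is
      the Leibniz rule.\<close>
    moreover have "coeff (binpoly i * binpoly j) 1 =
        (if i = 0 then coeff (binpoly j) 1 else 0) + (if j = 0 then coeff (binpoly i) 1 else 0)" for i j
      by (simp add: coeff_mult coeff_binpoly_0)
    ultimately have "(\<Sum>k<5. (?n k (omult x y) \<bullet> b) * coeff (binpoly k) 1) =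
      (\<Sum>i<5. \<Sum>j<5. (omult (?n i x) (?n j y) \<bullet> b) *
        ((if i = 0 then coeff (binpoly j) 1 else 0) + (if j = 0 then coeff (binpoly i) 1 else 0)))"
      by (simp add: Q_def coeff_sum)
    also have "\<dots> = (\<Sum>j<5. (omult x (?n j y) \<bullet> b) * coeff (binpoly j) 1) + (\<Sum>i<5. (omult (?n i x) y \<bullet> b) * coeff (binpoly i) 1)"
      by (simp add: distrib_left sum.distrib if_distrib[of "\<lambda>t. _ * t"] sum.delta' sum.swap[of _ "{..<5}" "{..<5}"] cong: if_cong)
    finally show "unilog N (omult x y) \<bullet> b = (omult (unilog N x) y + omult x (unilog N y)) \<bullet> b"
      by (simp add: unilog_eq_sum inner_sum_left inner_add_left omult.sum_left omult.sum_right omult.scaleR_left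
          omult.scaleR_right mult.commute add.commute)
  qed
qed

lemma op_exp_nil0_eq: "op_exp ` nil0 = uni0"
proof
  show "op_exp ` nil0 \<subseteq> uni0" using op_exp_nil0 by blast
  show "uni0 \<subseteq> op_exp ` nil0"
  proof
    fix g assume "g \<in> uni0"
    then have g: "g \<in> carrier G2" and N: "g - id_blinfun \<in> shifts 1" by (auto simp: uni0_def)
    have "unilog (g - id_blinfun) \<in> nil0"
      unfolding nil0_def using unilog_shifts[OF N] unilog_der[OF g N] by simp
    moreover have "op_exp (unilog (g - id_blinfun)) = g" using op_exp_unilog[OF N] by simp
    ultimately show "g \<in> op_exp ` nil0" by (metis imageI)
  qed
qed

section \<open>The stabiliser of an isotropic vector\<close>

lemma uni0_subset_stab: "uni0 \<subseteq> stab l0"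
  by (auto simp: uni0_iff stab_iff)

lemma uni0_filt_1:
  assumes "g \<in> uni0" "y \<in> filt 1"
  shows "g y - y \<in> filt 2"
  using shiftsD[of "g - id_blinfun" 1 y 1] assms by (simp add: uni0_def blinfun.diff_left)

lemma stab_l0_filt:
  assumes "h \<in> stab l0"
  shows "y \<in> filt 1 \<Longrightarrow> h y \<in> filt 1" "y \<in> filt 2 \<Longrightarrow> h y \<in> filt 2"
proof -
  have h: "h \<in> carrier G2" "h l0 = l0" using assms by (auto simp: stab_iff)
  show "y \<in> filt 1 \<Longrightarrow> h y \<in> filt 1"
    using G2_apply_omult[OF h(1), of l0 y] by (simp add: filt_1_omult_iff h blinfun.zero_right G2_imag_oct)
  show "y \<in> filt 2 \<Longrightarrow> h y \<in> filt 2"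
    by (auto simp: filt_2_iff blinfun.scaleR_right h)
qed

lemma stab_inv: "h \<in> stab w \<Longrightarrow> inv\<^bsub>G2\<^esub> h \<in> stab w"
  using subgroup.m_inv_closed[OF subgroup_stab] .

lemma uni0_conj:
  assumes h: "h \<in> stab l0" and g: "g \<in> uni0"
  shows "h o\<^sub>L g o\<^sub>L inv\<^bsub>G2\<^esub> h \<in> uni0"
proof -
  have hG: "h \<in> carrier G2" and gG: "g \<in> carrier G2" using h g by (auto simp: stab_iff uni0_def)
  have "(h o\<^sub>L g o\<^sub>L inv\<^bsub>G2\<^esub> h) y - y \<in> filt 2" if "y \<in> filt 1" for y
  proof -
    define z where "z = (inv\<^bsub>G2\<^esub> h) y"
    have z: "h z = y" using hG by (simp add: z_def)
    have "z \<in> filt 1" unfolding z_def using stab_l0_filt(1)[OF stab_inv[OF h] that] .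
    then have "h (g z - z) \<in> filt 2" using stab_l0_filt(2)[OF h] uni0_filt_1[OF g] by blast
    moreover have "(h o\<^sub>L g o\<^sub>L inv\<^bsub>G2\<^esub> h) y - y = h (g z - z)"
      by (simp add: blinfun.diff_right z) (simp add: z_def)
    ultimately show ?thesis by simp
  qed
  moreover have "h o\<^sub>L g o\<^sub>L inv\<^bsub>G2\<^esub> h \<in> stab l0"
    using subgroup.m_closed[OF subgroup_stab subgroup.m_closed[OF subgroup_stab h] stab_inv[OF h]] uni0_subset_stab g
    by auto
  ultimately show ?thesis
    unfolding uni0_iff stab_iff using basis_in_filt by blast
qed

lemma subgroup_uni0: "subgroup uni0 G2"
proof (rule G2.subgroupI)
  have "id_blinfun \<in> uni0" using G2.one_closed by (simp add: uni0_def subspace_0[OF subspace_shifts])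
  then show "uni0 \<noteq> {}" by blast
  show "uni0 \<subseteq> carrier G2" by (auto simp: uni0_def)
  fix g assume g: "g \<in> uni0"
  have gG: "g \<in> carrier G2" and gl: "g l0 = l0" using g by (auto simp: uni0_iff)
  have il: "(inv\<^bsub>G2\<^esub> g) l0 = l0" using G2_inv_apply(1)[OF gG, of l0] by (simp add: gl)
  have "(inv\<^bsub>G2\<^esub> g) y - y \<in> filt 2" if y: "y \<in> filt 1" for y
  proof -
    obtain c where "g y - y = c *\<^sub>R l0" using uni0_filt_1[OF g y] by (auto simp: filt_2_iff)
    then have "(inv\<^bsub>G2\<^esub> g) (g y - y) = c *\<^sub>R l0" by (simp add: blinfun.scaleR_right il)
    then have "(inv\<^bsub>G2\<^esub> g) y - y = (- c) *\<^sub>R l0"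
      by (simp add: blinfun.diff_right gG algebra_simps)
    then show ?thesis unfolding filt_2_iff by blast
  qed
  then show "inv\<^bsub>G2\<^esub> g \<in> uni0"
    using basis_in_filt il G2.inv_closed[OF gG] unfolding uni0_iff by blast
  fix h assume h: "h \<in> uni0"
  have "(g o\<^sub>L h) y - y \<in> filt 2" if y: "y \<in> filt 1" for y
  proof -
    have "(g o\<^sub>L h) y - y = g (h y - y) + (g y - y)" by (simp add: blinfun.diff_right)
    moreover have "g (h y - y) \<in> filt 2"
      using stab_l0_filt(2)[of g "h y - y"] uni0_subset_stab g uni0_filt_1[OF h y] by blast
    ultimately show ?thesis using uni0_filt_1[OF g y] subspace_add[OF subspace_filt] by metis
  qed
  moreover have "g o\<^sub>L h \<in> carrier G2" "(g o\<^sub>L h) l0 = l0"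
    using G2.m_closed[OF gG, of h] h gl by (auto simp: uni0_iff)
  ultimately show "g \<otimes>\<^bsub>G2\<^esub> h \<in> uni0"
    using basis_in_filt unfolding uni0_iff G2_mult by blast
qed

section \<open>The Levi factor SL(2, R) and the decomposition of the stabiliser\<close>

definition blk :: "real^2^2 \<Rightarrow> real^3^3" where
  "blk B = vector [vector [1, 0, 0], vector [0, B$1$1, B$1$2], vector [0, B$2$1, B$2$2]]"

definition levi :: "real^2^2 \<Rightarrow> octop" where
  "levi B = sl3_op (blk B)"

lemma det_blk: "det (blk B) = det B"
  by (simp add: blk_def det_3 det_2 vector_3)

lemma blk_mult: "blk (A ** B) = blk A ** blk B"
  by (simp add: blk_def matrix_matrix_mult_def vec_eq_iff forall_3 sum_3 sum_2 vector_3)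

lemma levi_mult: "levi (A ** B) = levi A o\<^sub>L levi B"
  by (simp add: levi_def blk_mult sl3_op_mult)

lemma levi_apply: "levi B l0 = l0" "levi B q2 = B$2$2 *\<^sub>R q2 - B$1$2 *\<^sub>R q3" "levi B q3 = - B$2$1 *\<^sub>R q2 + B$1$1 *\<^sub>R q3"
  unfolding basis_defs levi_def sl3_op_apply
  by (simp_all add: blk_def cof3_def matrix_vector_mult_def vec_eq_iff forall_3 sum_3 vector_3 axis_def)

lemma levi_stab: "det B = 1 \<Longrightarrow> levi B \<in> stab l0"
  using sl3_op_G2[of "blk B"] levi_apply(1)[of B] by (simp add: stab_iff det_blk levi_def)

lemma levi_uni0:
  assumes "levi B \<in> uni0"
  shows "levi B = id_blinfun"
proof -
  have "vcoord i (levi B q2 - q2) = 0" "vcoord i (levi B q3 - q3) = 0" for i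
    using assms vcoord_filt_2 unfolding uni0_iff by blast+
  from this[of 2] this[of 3] have "B$2$2 = 1" "B$1$2 = 0" "B$2$1 = 0" "B$1$1 = 1"
    by (simp_all add: levi_apply)
  then have "blk B = mat 1" by (simp add: blk_def mat_def vec_eq_iff forall_3 vector_3)
  then show ?thesis by (simp add: levi_def sl3_op_one)
qed

lemma stab_l0_decomposition:
  assumes h: "h \<in> stab l0"
  shows "\<exists>B. det B = 1 \<and> (\<exists>g\<in>uni0. h = levi B o\<^sub>L g)"
proof -
  have hG: "h \<in> carrier G2" and hl: "h l0 = l0" using h by (auto simp: stab_iff)
  define a b c d where "a = vcoord 2 (h q2)" and "b = vcoord 2 (h q3)" and "c = vcoord 3 (h q2)" and "d = vcoord 3 (h q3)"
  obtain x y where x: "h q2 = a *\<^sub>R q2 + c *\<^sub>R q3 + x *\<^sub>R l0" and y: "h q3 = b *\<^sub>R q2 + d *\<^sub>R q3 + y *\<^sub>R l0"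
    using vcoord_filt_1[OF stab_l0_filt(1)[OF h basis_in_filt(2)]] vcoord_filt_1[OF stab_l0_filt(1)[OF h basis_in_filt(3)]]
    unfolding a_def b_def c_def d_def by blast
  \<comment> \<open>Preserving the relation \<open>omult q2 q3 = - l0\<close> forces the induced 2
    by 2 matrix to have determinant 1.\<close>
  have "omult l0 l0 = 0" by (simp add: l0_def zero_prod_def)
  then have "omult (h q2) (h q3) = - ((a * d - b * c) *\<^sub>R l0)"
    unfolding x y by (simp add: omult.add_left omult.add_right omult.scaleR_left omult.scaleR_right algebra_simps)
  moreover have "omult (h q2) (h q3) = - l0"
    using G2_apply_omult[OF hG, of q2 q3] by (simp add: blinfun.minus_right hl)
  ultimately have "(a * d - b * c) *\<^sub>R l0 = 1 *\<^sub>R l0" by simp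
  then have det: "a * d - b * c = 1" using l0_nonzero by (simp only: scaleR_cancel_right) simp
  \<comment> \<open>\<open>levi B\<close> acts on \<open>q2\<close> and \<open>q3\<close> through
    the cofactors of \<open>B\<close>; these entries make it agree with \<open>h\<close> modulo
    \<open>l0\<close>.\<close>
  define B :: "real^2^2" where "B = vector [vector [d, - c], vector [- b, a]]"
  have B: "B$1$1 = d" "B$1$2 = - c" "B$2$1 = - b" "B$2$2 = a" by (simp_all add: B_def)
  have dB: "det B = 1" using det by (simp add: det_2 B mult.commute)
  have lB: "levi B \<in> stab l0" by (rule levi_stab[OF dB])
  define g where "g = inv\<^bsub>G2\<^esub> (levi B) o\<^sub>L h"
  have lG: "levi B \<in> carrier G2" using lB by (simp add: stab_iff)
  have gs: "g \<in> stab l0"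
    unfolding g_def using subgroup.m_closed[OF subgroup_stab stab_inv[OF lB] h] by simp
  have inv_eq: "g z = z' " if "h z = levi B z'" for z z'
    using lG by (simp add: g_def that)
  have "g q2 = q2 + x *\<^sub>R l0" "g q3 = q3 + y *\<^sub>R l0"
    by (rule inv_eq, simp add: x y blinfun.add_right blinfun.scaleR_right levi_apply B)+
  then have "g \<in> uni0"
    using gs unfolding uni0_iff stab_iff filt_2_iff by (metis add_diff_cancel_left')
  moreover have "h = levi B o\<^sub>L g"
    by (rule blinfun_eqI) (simp add: g_def lG)
  ultimately show ?thesis using dB by blast
qed

section \<open>Conjugation, carrying the results at \<open>l0\<close> to every isotropic
  vector\<close>

definition gconj :: "octop \<Rightarrow> octop \<Rightarrow> octop" where
  "gconj g A = g o\<^sub>L A o\<^sub>L inv\<^bsub>G2\<^esub> g"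

lemma gconj_apply: "gconj g A x = g (A ((inv\<^bsub>G2\<^esub> g) x))"
  by (simp add: gconj_def)

context
  fixes g :: octop
  assumes g: "g \<in> carrier G2"
begin

lemma gconj_inv [simp]: "gconj (inv\<^bsub>G2\<^esub> g) (gconj g A) = A" "gconj g (gconj (inv\<^bsub>G2\<^esub> g) A) = A"
  using g by (auto intro!: blinfun_eqI simp: gconj_apply)

lemma gconj_compose: "gconj g (A o\<^sub>L B) = gconj g A o\<^sub>L gconj g B"
  using g by (auto intro!: blinfun_eqI simp: gconj_apply)

lemma gconj_linear: "linear (gconj g)"
  by (rule linearI) (auto intro!: blinfun_eqI simp: gconj_apply blinfun.add_left blinfun.add_right
      blinfun.scaleR_left blinfun.scaleR_right)

lemma gconj_comm: "gconj g (comm A B) = comm (gconj g A) (gconj g B)"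
  by (simp add: comm_def gconj_compose linear_diff[OF gconj_linear])

lemma gconj_G2: "gconj g A \<in> carrier G2 \<longleftrightarrow> A \<in> carrier G2"
proof
  have closed: "gconj h B \<in> carrier G2" if "h \<in> carrier G2" "B \<in> carrier G2" for h B
    using G2.m_closed[OF G2.m_closed[OF that] G2.inv_closed[OF that(1)]] by (simp add: gconj_def)
  show "A \<in> carrier G2" if "gconj g A \<in> carrier G2"
    using closed[OF G2.inv_closed[OF g] that] by simp
  show "gconj g A \<in> carrier G2" if "A \<in> carrier G2"
    using closed[OF g that] .
qed

lemma gconj_id: "gconj g id_blinfun = id_blinfun"
  using g by (auto intro!: blinfun_eqI simp: gconj_apply)

lemma in_gconj_image: "A \<in> gconj g ` S \<longleftrightarrow> gconj (inv\<^bsub>G2\<^esub> g) A \<in> S"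
proof
  show "gconj (inv\<^bsub>G2\<^esub> g) A \<in> S" if "A \<in> gconj g ` S" using that by (auto simp only: gconj_inv)
  show "A \<in> gconj g ` S" if "gconj (inv\<^bsub>G2\<^esub> g) A \<in> S"
    by (rule image_eqI[OF _ that]) (simp only: gconj_inv)
qed

lemma gconj_inv_apply: "gconj (inv\<^bsub>G2\<^esub> g) A x = (inv\<^bsub>G2\<^esub> g) (A (g x))"
  using g by (simp add: gconj_apply)

lemma op_exp_gconj: "op_exp (gconj g A) = gconj g (op_exp A)"
proof (rule blinfun_eqI)
  fix x :: oct
  have "(blinfun_apply (gconj g A) ^^ n) x = g ((blinfun_apply A ^^ n) ((inv\<^bsub>G2\<^esub> g) x))" for n
    by (induction n) (simp_all add: gconj_apply g)
  then have "(\<lambda>n. g ((1 / fact n) *\<^sub>R (blinfun_apply A ^^ n) ((inv\<^bsub>G2\<^esub> g) x))) sums op_exp (gconj g A) x"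
    using op_exp_apply_sums[of "gconj g A" x] by (simp add: blinfun.scaleR_right)
  moreover have "(\<lambda>n. g ((1 / fact n) *\<^sub>R (blinfun_apply A ^^ n) ((inv\<^bsub>G2\<^esub> g) x))) sums gconj g (op_exp A) x"
    unfolding gconj_apply by (rule bounded_linear.sums[OF blinfun.bounded_linear_right op_exp_apply_sums])
  ultimately show "op_exp (gconj g A) x = gconj g (op_exp A) x" by (rule sums_unique2)
qed

end

lemma G2_inv_eq_iff: "g \<in> carrier G2 \<Longrightarrow> (inv\<^bsub>G2\<^esub> g) z = x \<longleftrightarrow> z = g x"
  using G2_inv_apply(1)[of g x] G2_inv_apply(2)[of g z] by auto

lemma stab_gconj:
  assumes g: "g \<in> carrier G2"
  shows "stab (g l) = gconj g ` stab l"
  by (rule Set.set_eqI) (simp only: in_gconj_image[OF g] stab_iff gconj_inv_apply[OF g] gconj_G2[OF G2.inv_closed[OF g]]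
      G2_inv_eq_iff[OF g])

lemma par_gconj:
  assumes g: "g \<in> carrier G2" and l: "l \<noteq> 0"
  shows "par (g l) = gconj g ` par l"
proof -
  have Par: "Par (g l) = gconj g ` Par l"
    by (rule Set.set_eqI) (simp only: in_gconj_image[OF g] Par_def mem_Collect_eq gconj_inv_apply[OF g]
        gconj_G2[OF G2.inv_closed[OF g]] G2_inv_eq_iff[OF g] blinfun.scaleR_right)
  have ig: "inv\<^bsub>G2\<^esub> g \<in> carrier G2" using g by (rule G2.inv_closed)
  have "A \<in> par (g l) \<longleftrightarrow> A \<in> gconj g ` par l" for A
    unfolding in_gconj_image[OF g] lie_algebra_def Par
    by (simp add: in_gconj_image[OF g] linear_scale[OF gconj_linear[OF ig], symmetric] op_exp_gconj[OF ig])
  then show ?thesis by blast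
qed

lemma nilpotent_ideal_gconj:
  assumes g: "g \<in> carrier G2" and I: "nilpotent_ideal q I"
  shows "nilpotent_ideal (gconj g ` q) (gconj g ` I)"
proof -
  have lc: "lower_central (gconj g ` I) n = gconj g ` lower_central I n" for n
  proof (induction n)
    case (Suc n)
    have "{comm X Y | X Y. X \<in> gconj g ` I \<and> Y \<in> gconj g ` lower_central I n} =
        gconj g ` {comm X Y | X Y. X \<in> I \<and> Y \<in> lower_central I n}"
    proof (intro subset_antisym subsetI)
      fix A assume "A \<in> {comm X Y | X Y. X \<in> gconj g ` I \<and> Y \<in> gconj g ` lower_central I n}"
      then obtain X Y where "X \<in> I" "Y \<in> lower_central I n" "A = comm (gconj g X) (gconj g Y)" by blast
      then show "A \<in> gconj g ` {comm X Y | X Y. X \<in> I \<and> Y \<in> lower_central I n}"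
        unfolding gconj_comm[OF g, symmetric] by blast
    next
      fix A assume "A \<in> gconj g ` {comm X Y | X Y. X \<in> I \<and> Y \<in> lower_central I n}"
      then obtain X Y where "X \<in> I" "Y \<in> lower_central I n" "A = gconj g (comm X Y)" by blast
      then show "A \<in> {comm X Y | X Y. X \<in> gconj g ` I \<and> Y \<in> gconj g ` lower_central I n}"
        unfolding gconj_comm[OF g] by blast
    qed
    then show ?case
      by (simp add: Suc linear_span_image[OF gconj_linear[OF g]])
  qed simp
  obtain n where n: "lower_central I n = {0}" using I unfolding nilpotent_ideal_def by blast
  have "lower_central (gconj g ` I) n = {0}" by (simp add: lc n linear_0[OF gconj_linear[OF g]])
  moreover have "comm X Y \<in> gconj g ` I" if XY: "X \<in> gconj g ` q" "Y \<in> gconj g ` I" for X Y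
  proof -
    obtain X' Y' where "X' \<in> q" "X = gconj g X'" "Y' \<in> I" "Y = gconj g Y'" using XY by blast
    moreover from this have "comm X' Y' \<in> I" using I unfolding nilpotent_ideal_def by blast
    ultimately show ?thesis by (simp add: gconj_comm[OF g, symmetric])
  qed
  moreover have "subspace I" "I \<subseteq> q" using I unfolding nilpotent_ideal_def by blast+
  note linear_subspace_image[OF gconj_linear[OF g] this(1)] image_mono[OF this(2), of "gconj g"]
  ultimately show ?thesis unfolding nilpotent_ideal_def by (intro conjI ballI exI)
qed

lemma nilradical_gconj:
  assumes g: "g \<in> carrier G2"
  shows "nilradical (gconj g ` q) = gconj g ` nilradical q"
proof -
  have ig: "inv\<^bsub>G2\<^esub> g \<in> carrier G2" using g by (rule G2.inv_closed)
  have "{I. nilpotent_ideal (gconj g ` q) I} = (\<lambda>I. gconj g ` I) ` {I. nilpotent_ideal q I}"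
  proof (intro subset_antisym subsetI)
    fix I assume "I \<in> {I. nilpotent_ideal (gconj g ` q) I}"
    then have "nilpotent_ideal (gconj (inv\<^bsub>G2\<^esub> g) ` gconj g ` q) (gconj (inv\<^bsub>G2\<^esub> g) ` I)"
      using nilpotent_ideal_gconj[OF ig] by blast
    then have "gconj (inv\<^bsub>G2\<^esub> g) ` I \<in> {I. nilpotent_ideal q I}"
      by (simp add: image_comp comp_def gconj_inv[OF g])
    moreover have "I = gconj g ` gconj (inv\<^bsub>G2\<^esub> g) ` I" by (simp add: image_comp comp_def gconj_inv[OF g])
    ultimately show "I \<in> (\<lambda>I. gconj g ` I) ` {I. nilpotent_ideal q I}"
      by (rule rev_image_eqI)
  qed (use nilpotent_ideal_gconj[OF g] in blast)
  then have "\<Union> {I. nilpotent_ideal (gconj g ` q) I} = gconj g ` \<Union> {I. nilpotent_ideal q I}"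
    by blast
  then show ?thesis
    unfolding nilradical_def by (simp only: linear_span_image[OF gconj_linear[OF g]])
qed

lemma Par_plus_gconj:
  assumes g: "g \<in> carrier G2"
  shows "Par_plus (g l0) = gconj g ` uni0"
proof -
  have "par_plus (g l0) = gconj g ` nil0"
    unfolding par_plus_l0[symmetric] par_plus_def
    by (simp only: par_gconj[OF g l0_nonzero] nilradical_gconj[OF g])
  then show ?thesis
    unfolding Par_plus_def op_exp_nil0_eq[symmetric] by (simp add: image_comp comp_def op_exp_gconj[OF g])
qed

lemma subgroup_gconj:
  assumes g: "g \<in> carrier G2" and S: "subgroup S G2"
  shows "subgroup (gconj g ` S) G2"
proof -
  have "gconj g \<in> hom G2 G2" by (auto simp: hom_def gconj_G2[OF g] gconj_compose[OF g])
  then have "group_hom G2 G2 (gconj g)"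
    using group_G2 by (simp add: group_hom_def group_hom_axioms_def)
  then show ?thesis using S by (rule group_hom.subgroup_img_is_subgroup)
qed

section \<open>The conjugated Levi factor as a Lie group, and the semidirect product\<close>

definition levi_matrix :: "octop \<Rightarrow> real^2^2" where
  "levi_matrix g = vector [vector [upper_matrix g $ 2 $ 2, upper_matrix g $ 2 $ 3],
     vector [upper_matrix g $ 3 $ 2, upper_matrix g $ 3 $ 3]]"

lemma levi_matrix_levi: "levi_matrix (levi B) = B"
  by (simp add: levi_matrix_def levi_def upper_matrix_sl3_op blk_def vec_eq_iff forall_2 vector_3)

definition SL2set :: "(real^2^2) set" where "SL2set = {B. det B = 1}"

lemma continuous_on_gconj: "continuous_on S f \<Longrightarrow> continuous_on S (\<lambda>x. gconj g (f x))"
  unfolding gconj_def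
  by (intro bounded_bilinear.continuous_on[OF bounded_bilinear_blinfun_compose] continuous_on_const)

lemma continuous_on_levi: "continuous_on S levi"
proof -
  have "continuous_on S blk" unfolding blk_def
    by (intro continuous_on_vector_3 continuous_on_component continuous_on_const continuous_on_id)
  then show ?thesis
    unfolding levi_def by (rule continuous_on_compose2[OF continuous_on_sl3_op[of UNIV]]) simp
qed

lemma continuous_on_vector_2:
  assumes "continuous_on S f" "continuous_on S g"
  shows "continuous_on S (\<lambda>x. vector [f x, g x] :: ('a::real_normed_vector)^2)"
proof -
  have "(vector [f x, g x] :: 'a^2) = (\<chi> i. if i = 1 then f x else g x)" for x
    by (simp add: vec_eq_iff forall_2)
  moreover have "continuous_on S (\<lambda>x. if i = 1 then f x else g x)" for i :: 2
    using assms by (cases "i = 1") simp_all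
  ultimately show ?thesis by (simp add: continuous_on_vec_lambda)
qed

lemma continuous_on_levi_matrix: "continuous_on S levi_matrix"
  unfolding levi_matrix_def
  by (intro continuous_on_vector_2 continuous_on_component continuous_on_upper_matrix)

lemma lie_group_iso_gconj_levi:
  assumes g: "g \<in> carrier G2"
  shows "lie_group_iso (G2\<lparr>carrier := gconj g ` levi ` SL2set\<rparr>) (SL :: (real^2^2) monoid)"
  unfolding SL_def SL2set_def[symmetric]
proof (rule lie_group_isoI[where F = "\<lambda>B. gconj g (levi B)" and f = "\<lambda>A. levi_matrix (gconj (inv\<^bsub>G2\<^esub> g) A)"])
  show "A ** B \<in> SL2set \<and> gconj g (levi (A ** B)) = gconj g (levi A) o\<^sub>L gconj g (levi B)"
    if "A \<in> SL2set" "B \<in> SL2set" for A B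
    using that by (simp add: SL2set_def det_mul levi_mult gconj_compose[OF g])
  show "continuous_on (gconj g ` levi ` SL2set) (\<lambda>A. levi_matrix (gconj (inv\<^bsub>G2\<^esub> g) A))"
    by (rule continuous_on_compose2[OF continuous_on_levi_matrix[of UNIV]])
      (auto intro: continuous_on_gconj continuous_on_id)
  show "continuous_on SL2set (\<lambda>B. gconj g (levi B))"
    by (intro continuous_on_gconj continuous_on_levi)
  show "levi_matrix (gconj (inv\<^bsub>G2\<^esub> g) A) \<in> SL2set" "gconj g (levi (levi_matrix (gconj (inv\<^bsub>G2\<^esub> g) A))) = A"
    if "A \<in> gconj g ` levi ` SL2set" for A
    using that by (blast | clarsimp simp: gconj_inv[OF g] levi_matrix_levi)+
qed (simp_all add: gconj_inv[OF g] levi_matrix_levi)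

lemma subgroup_levi: "subgroup (levi ` SL2set) G2"
proof (rule G2.subgroupI)
  show "levi ` SL2set \<subseteq> carrier G2" using levi_stab by (auto simp: stab_iff SL2set_def)
  have "mat 1 \<in> SL2set" by (simp add: SL2set_def)
  then show "levi ` SL2set \<noteq> {}" by blast
  have one: "levi (mat 1) = id_blinfun"
  proof -
    have "blk (mat 1) = mat 1" by (simp add: blk_def mat_def vec_eq_iff forall_3 vector_3)
    then show ?thesis by (simp add: levi_def sl3_op_one)
  qed
  fix a assume "a \<in> levi ` SL2set"
  then obtain B where B: "det B = 1" "a = levi B" unfolding SL2set_def by blast
  have aG: "a \<in> carrier G2" using levi_stab[OF B(1)] B(2) by (simp add: stab_iff)
  have "invertible B" using B(1) by (simp add: invertible_det_nz)
  then obtain B' where B': "B ** B' = mat 1" unfolding invertible_def by blast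
  have "det (B ** B') = 1" by (simp add: B')
  then have dB': "det B' = 1" by (simp add: det_mul B(1))
  moreover have "inv\<^bsub>G2\<^esub> a = levi B'"
  proof (rule G2.inv_equality[OF _ aG])
    have "B' ** B = mat 1" using B' matrix_left_right_inverse by blast
    then show "levi B' \<otimes>\<^bsub>G2\<^esub> a = \<one>\<^bsub>G2\<^esub>" by (simp add: B(2) one flip: levi_mult)
    show "levi B' \<in> carrier G2" using levi_stab[OF dB'] by (simp add: stab_iff)
  qed
  ultimately show "inv\<^bsub>G2\<^esub> a \<in> levi ` SL2set" by (simp add: SL2set_def)
  fix b assume "b \<in> levi ` SL2set"
  then obtain D where D: "det D = 1" "b = levi D" unfolding SL2set_def by blast
  show "a \<otimes>\<^bsub>G2\<^esub> b \<in> levi ` SL2set"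
  proof (rule image_eqI)
    show "a \<otimes>\<^bsub>G2\<^esub> b = levi (B ** D)" by (simp add: B D levi_mult)
    show "B ** D \<in> SL2set" using B D by (simp add: SL2set_def det_mul)
  qed
qed

theorem SL2_semidirect_stab:
  assumes "isotropic_vector l"
  shows "SL2_semidirect_Par_plus l (stab l)"
proof -
  have "G2_equiv l0 l"
    using assms l0_nonzero unfolding isotropic_vector_def
    by (intro G2_equiv_iff) (auto simp: filt_subset_imag[THEN subsetD, OF basis_in_filt(1)])
  then obtain g where g: "g \<in> carrier G2" and l: "g l0 = l" unfolding G2_equiv_def by blast
  define P where "P = gconj g ` uni0"
  define L where "L = gconj g ` levi ` SL2set"
  have Pp: "Par_plus l = P" using Par_plus_gconj[OF g] by (simp add: l P_def)
  have st: "stab l = gconj g ` stab l0" using stab_gconj[OF g, of l0] by (simp add: l)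
  have sP: "subgroup P G2" unfolding P_def by (rule subgroup_gconj[OF g subgroup_uni0])
  have sL: "subgroup L G2" unfolding L_def by (rule subgroup_gconj[OF g subgroup_levi])
  have PH: "P \<subseteq> stab l" unfolding P_def st using uni0_subset_stab by blast
  have LH: "L \<subseteq> stab l" unfolding L_def st SL2set_def using levi_stab by blast
  let ?H = "G2\<lparr>carrier := stab l\<rparr>"
  interpret H: group ?H by (rule G2.subgroup_imp_group[OF subgroup_stab])
  have "P \<lhd> ?H"
    unfolding H.normal_inv_iff
  proof (intro conjI ballI)
    show "subgroup P ?H" by (rule G2.subgroup_incl[OF sP subgroup_stab PH])
    fix h p assume "h \<in> carrier ?H" and p: "p \<in> P"
    then have h: "h \<in> stab l" by simp
    obtain h' where h': "h' \<in> stab l0" "h = gconj g h'" using h unfolding st by blast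
    obtain p' where p': "p' \<in> uni0" "p = gconj g p'" using p unfolding P_def by blast
    have hG: "h' \<in> carrier G2" using h'(1) by (simp add: stab_iff)
    have inv: "inv\<^bsub>G2\<^esub> h = gconj g (inv\<^bsub>G2\<^esub> h')"
    proof (rule G2.inv_equality)
      show "gconj g (inv\<^bsub>G2\<^esub> h') \<otimes>\<^bsub>G2\<^esub> h = \<one>\<^bsub>G2\<^esub>"
        using G2.l_inv[OF hG] by (simp add: h'(2) gconj_id[OF g] flip: gconj_compose[OF g])
    qed (simp_all add: h'(2) gconj_G2[OF g] hG)
    have "inv\<^bsub>?H\<^esub> h = inv\<^bsub>G2\<^esub> h" by (rule G2.m_inv_consistent[OF subgroup_stab h])
    then have "inv\<^bsub>?H\<^esub> h = gconj g (inv\<^bsub>G2\<^esub> h')" by (simp only: inv)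
    then have "h \<otimes>\<^bsub>?H\<^esub> p \<otimes>\<^bsub>?H\<^esub> inv\<^bsub>?H\<^esub> h = h o\<^sub>L p o\<^sub>L gconj g (inv\<^bsub>G2\<^esub> h')" by simp
    also have "\<dots> = gconj g (h' o\<^sub>L p' o\<^sub>L inv\<^bsub>G2\<^esub> h')"
      by (simp only: h'(2) p'(2) gconj_compose[OF g])
    finally have "h \<otimes>\<^bsub>?H\<^esub> p \<otimes>\<^bsub>?H\<^esub> inv\<^bsub>?H\<^esub> h = gconj g (h' o\<^sub>L p' o\<^sub>L inv\<^bsub>G2\<^esub> h')" .
    then show "h \<otimes>\<^bsub>?H\<^esub> p \<otimes>\<^bsub>?H\<^esub> inv\<^bsub>?H\<^esub> h \<in> P"
      using uni0_conj[OF h'(1) p'(1)] by (simp add: P_def)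
  qed
  moreover have "subgroup L ?H" by (rule G2.subgroup_incl[OF sL subgroup_stab LH])
  moreover have "lie_group_iso (G2\<lparr>carrier := L\<rparr>) (SL :: (real^2^2) monoid)"
    unfolding L_def by (rule lie_group_iso_gconj_levi[OF g])
  moreover have "L \<inter> P = {\<one>\<^bsub>G2\<^esub>}"
  proof
    show "L \<inter> P \<subseteq> {\<one>\<^bsub>G2\<^esub>}"
    proof
      fix x assume x: "x \<in> L \<inter> P"
      then obtain B where B: "x = gconj g (levi B)" unfolding L_def by blast
      have "gconj g (levi B) \<in> gconj g ` uni0" using x by (simp add: B P_def)
      then have "levi B \<in> uni0" unfolding in_gconj_image[OF g] gconj_inv[OF g] .
      then show "x \<in> {\<one>\<^bsub>G2\<^esub>}" by (simp add: B levi_uni0[OF \<open>levi B \<in> uni0\<close>] gconj_id[OF g])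
    qed
    show "{\<one>\<^bsub>G2\<^esub>} \<subseteq> L \<inter> P" using subgroup.one_closed[OF sL] subgroup.one_closed[OF sP] by blast
  qed
  moreover have "L <#>\<^bsub>G2\<^esub> P = stab l"
  proof
    show "L <#>\<^bsub>G2\<^esub> P \<subseteq> stab l"
    proof
      fix x assume "x \<in> L <#>\<^bsub>G2\<^esub> P"
      then obtain a p where "a \<in> L" "p \<in> P" "x = a \<otimes>\<^bsub>G2\<^esub> p" unfolding set_mult_def by blast
      then show "x \<in> stab l" using subgroup.m_closed[OF subgroup_stab, of a l p] LH PH by blast
    qed
    show "stab l \<subseteq> L <#>\<^bsub>G2\<^esub> P"
    proof
      fix h assume "h \<in> stab l"
      then obtain h' where h': "h' \<in> stab l0" "h = gconj g h'" unfolding st by blast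
      obtain B p where B: "det B = 1" "p \<in> uni0" "h' = levi B o\<^sub>L p" using stab_l0_decomposition[OF h'(1)] by blast
      have "h = gconj g (levi B) \<otimes>\<^bsub>G2\<^esub> gconj g p" by (simp add: h'(2) B(3) gconj_compose[OF g])
      moreover have "gconj g (levi B) \<in> L" "gconj g p \<in> P" using B by (auto simp: L_def P_def SL2set_def)
      ultimately show "h \<in> L <#>\<^bsub>G2\<^esub> P" unfolding set_mult_def by blast
    qed
  qed
  moreover have "stab l \<subseteq> Par l"
  proof
    fix h assume "h \<in> stab l"
    then have "h \<in> carrier G2" "h l = 1 *\<^sub>R l" by (simp_all add: stab_iff)
    then show "h \<in> Par l" unfolding Par_def using zero_less_one by blast
  qed
  ultimately show ?thesis
    unfolding SL2_semidirect_Par_plus_def Pp using subgroup_stab by blast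
qed

section \<open>Reduction of the holonomy\<close>

lemma par_plus_subset_der:
  assumes "l \<noteq> 0"
  shows "par_plus l \<subseteq> der"
  unfolding par_plus_def nilradical_def
proof (rule span_minimal[OF _ subspace_der])
  show "\<Union> {I. nilpotent_ideal (par l) I} \<subseteq> der"
    using par_eq[OF assms] unfolding nilpotent_ideal_def by blast
qed

text \<open>The operator generating the filtration is monotone and maps the space of derivations
  into itself, so its iterates decrease.\<close>

lemma gfil_decreasing:
  assumes "l \<noteq> 0"
  shows "gfil l (- 1) \<subseteq> gfil l (- 2)"
proof -
  define \<Phi> where "\<Phi> W = span {comm Z X | Z X. Z \<in> par_plus l \<and> X \<in> W}" for W
  have "\<Phi> der \<subseteq> der"
    unfolding \<Phi>_def using par_plus_subset_der[OF assms] comm_der by (intro span_minimal[OF _ subspace_der]) blast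
  moreover have "\<Phi> V \<subseteq> \<Phi> W" if "V \<subseteq> W" for V W
    unfolding \<Phi>_def using that by (intro span_mono) blast
  ultimately have "\<Phi> (\<Phi> der) \<subseteq> \<Phi> der" by blast
  then show ?thesis
    unfolding gfil_def g2_eq_der \<Phi>_def[symmetric] by (simp add: eval_nat_numeral)
qed

text \<open>The zero tractor represents the zero coset, which is the fibre of the distribution
  itself. A tractor that vanishes everywhere would thus give the zero section.\<close>

lemma E1_class_zero:
  assumes "l \<noteq> 0" "E1_identification l \<iota>"
  shows "E1_class l \<iota> C u 0 = base_vec C u ` gfil l (- 1)"
  using assms(2) gfil_decreasing[OF assms(1)] unfolding E1_class_def E1_identification_def by auto

theorem proposition3:
  fixes l :: oct
    and M :: "('m::{t2_space, second_countable_topology}, real^5) atlas"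
    and D :: "'m \<Rightarrow> 'm tvec set"
    and Or :: "'m \<Rightarrow> ('m tvec \<times> 'm tvec) set"
    and C :: "('m, 'g::{t2_space, second_countable_topology}) cartan_geometry"
    and \<iota> :: "octop \<Rightarrow> oct"
    and \<sigma> :: "'m \<Rightarrow> 'm tvec set"
    and t :: "'g \<Rightarrow> oct"
    and u :: 'g
  assumes "smooth_atlas M" and "connected (UNIV :: 'm set)"
    and "oriented_235_distribution M D Or"
    and "isotropic_vector l"
    and "regular_normal_geometry l C" and "base C = M" and "underlying_distribution l C D Or"
    and "E1_identification l \<iota>"
    and "\<sigma> \<in> E1_sections M D" and "\<exists>x. \<sigma> x \<noteq> D x"
    and "\<forall>x. \<forall>\<xi>\<in>D x. \<forall>\<eta>\<in>D x. Theta0 l \<iota> C \<sigma> x \<xi> \<eta> = D x"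
    and "t \<in> tractor_sections l C" and "parallel_tractor C t" and "Pi0 l \<iota> C t = \<sigma>"
  shows "SL2_semidirect_Par_plus l (stabilizer G2 blinfun_apply l) \<and>
         (spacelike_tractor t \<longrightarrow> reduces_to (holonomy l C u) SU12) \<and>
         (isotropic_tractor t \<longrightarrow>
            conjugate_into (holonomy l C u) (stabilizer G2 blinfun_apply l)) \<and>
         (timelike_tractor t \<longrightarrow> reduces_to (holonomy l C u) (SL :: (real^3^3) monoid))"
proof -
  have pb: "principal_bundle l C" and cc: "cartan_connection l C"
    using assms(5) by (simp_all add: regular_normal_geometry_def)
  have A: "smooth_atlas (total C)" using pb by (simp add: principal_bundle_def)
  have l: "l \<in> imag_oct" "l \<noteq> 0" "oinner l l = 0" using assms(4) by (simp_all add: isotropic_vector_def)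
  have hol: "holonomy l C u \<subseteq> stab (t u)" by (rule holonomy_subset_stab[OF A cc assms(12,13)])
  have tim: "t u \<in> imag_oct" using assms(12) by (simp add: tractor_sections_def)
  \<comment> \<open>Dividing \<open>t u\<close> by \<open>r\<close> leaves its stabiliser unchanged
    and gives it the square norm of the standard vector \<open>w\<close>.\<close>
  have normalized: "reduces_to (holonomy l C u) K"
    if "lie_group_iso (G2\<lparr>carrier := stab w\<rparr>) K" "w \<in> imag_oct" "w \<noteq> 0" "r \<noteq> 0"
      "oinner (t u) (t u) = r\<^sup>2 * oinner w w" "t u \<noteq> 0" for K :: "('b::topological_space) monoid" and w r
  proof (rule reduces_to_stab[OF _ _ that(1)])
    show "holonomy l C u \<subseteq> stab ((1 / r) *\<^sub>R t u)" using hol that(4) by (simp add: stab_scaleR)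
    show "G2_equiv ((1 / r) *\<^sub>R t u) w"
      using that tim subspace_scale[OF subspace_imag_oct tim]
      by (intro G2_equiv_iff) (simp_all add: oinner.scaleR_left oinner.scaleR_right power2_eq_square)
  qed
  have wt: "w_time \<in> imag_oct" "w_time \<noteq> 0" "oinner w_time w_time = - 1"
    by (simp_all add: w_time_def imag_oct_def zero_prod_def)
  have ws: "w_space \<in> imag_oct" "w_space \<noteq> 0" "oinner w_space w_space = 1"
    by (simp_all add: w_space_def imag_oct_def zero_prod_def axis_eq_0_iff inner_axis_axis)
  have "reduces_to (holonomy l C u) SU12" if "spacelike_tractor t"
  proof (rule normalized[OF lie_group_iso_stab_w_space ws(1,2)])
    have pos: "oinner (t u) (t u) > 0" using that by (simp add: spacelike_tractor_def)
    then show "sqrt (oinner (t u) (t u)) \<noteq> 0"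
      "oinner (t u) (t u) = (sqrt (oinner (t u) (t u)))\<^sup>2 * oinner w_space w_space"
      by (simp_all add: ws(3))
    show "t u \<noteq> 0" using pos by (auto simp: oinner.zero_left)
  qed
  moreover have "reduces_to (holonomy l C u) (SL :: (real^3^3) monoid)" if "timelike_tractor t"
  proof (rule normalized[OF lie_group_iso_stab_w_time wt(1,2)])
    have neg: "oinner (t u) (t u) < 0" using that by (simp add: timelike_tractor_def)
    then show "sqrt (- oinner (t u) (t u)) \<noteq> 0"
      "oinner (t u) (t u) = (sqrt (- oinner (t u) (t u)))\<^sup>2 * oinner w_time w_time"
      by (simp_all add: wt(3))
    show "t u \<noteq> 0" using neg by (auto simp: oinner.zero_left)
  qed
  moreover have "conjugate_into (holonomy l C u) (stab l)" if "isotropic_tractor t"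
  proof -
    obtain x where x: "\<sigma> x \<noteq> D x" using assms(10) by blast
    have "\<exists>v. t v \<noteq> 0"
    proof (rule ccontr)
      assume "\<nexists>v. t v \<noteq> 0"
      then have "\<sigma> x = (\<Union>v\<in>{v. proj C v = x}. base_vec C v ` gfil l (- 1))"
        using E1_class_zero[OF l(2) assms(8), of C] by (simp add: assms(14)[symmetric] Pi0_def)
      also have "\<dots> = (\<Union>v\<in>{v. proj C v = x}. D x)"
      proof (rule SUP_cong[OF refl])
        fix v assume "v \<in> {v. proj C v = x}"
        then have "proj C v = x" by simp
        moreover have "D (proj C v) = base_vec C v ` gfil l (- 1)"
          using assms(7) unfolding underlying_distribution_def by blast
        ultimately show "base_vec C v ` gfil l (- 1) = D x" by simp
      qed
      also have "\<dots> = D x"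
      proof -
        obtain U s where "x \<in> U" "\<forall>y\<in>U. proj C (s y) = y"
          by (rule principal_bundle_local_section[OF pb, of x])
        then have "s x \<in> {v. proj C v = x}" by simp
        then show ?thesis by blast
      qed
      finally show False using x by simp
    qed
    then have "t u \<noteq> 0"
      using parallel_tractor_nonvanishing[OF assms(2) pb cc assms(12,13)] by blast
    moreover have "oinner (t u) (t u) = 0" using that by (simp add: isotropic_tractor_def)
    ultimately have "G2_equiv (t u) l" using l tim by (intro G2_equiv_iff) simp_all
    then show ?thesis by (rule conjugate_into_stab[OF hol])
  qed
  ultimately show ?thesis using SL2_semidirect_stab[OF assms(4)] by blast
qed

end
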